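(* Let $P=A/I_{>1}$ be the infinite root algebra. A $P$-module is $\Theta$-reflexive if and only if it is multibasic. Every $\Theta$-reflexive $P$-module $M$ has a unique finite decomposition into basic submodules, up to isomorphism of the summands and the ordering of the summands: if $M=\bigoplus_{i=1}^m M_i=\bigoplus_{j=1}^n N_j$ with all $M_i,N_j$ basic, then $m=n$ and there is a permutation $\sigma$ with $M_i\cong N_{\sigma(i)}$ for all $i$.
   Context: $\mathbb{F}$ is the field of order $2$. $K$ is the field of Hahn series with value group $\mathbb{R}$ and residue field $\mathbb{F}$: elements are maps $a:\mathbb{R}\to\mathbb{F}$ whose support $\operatorname{supp}(a)=\{q:a_q=1\}$ is a well-ordered subset of $\mathbb{R}$, thought of as formal series $\sum_q a_qt^q$, with pointwise addition and multiplication $(ab)_q=\sum_{u+v=q}a_ub_v$. The valuation is $\nu(a)=\min(\operatorname{supp}(a))$ for $a\ne0$, $\nu(0)=\infty$. $A=\{a\in K:\nu(a)\ge0\}$ is the Hahn ring and $I_{>1}=\{a\in K:\nu(a)>1\}$, an ideal of $A$. The infinite root algebra is $P=A/I_{>1}$. For a $P$-module $M$ write $DM=\operatorname{Hom}_P(M,P)$. $M$ is $\Theta$-reflexive if the canonical evaluation map $M\to D^2M$, $m\mapsto(\alpha\mapsto\alpha(m))$, is an isomorphism. A $P$-module $M$ is basic if it is non-zero and for all $x,y\in M$ we have $x\in Py$ or $y\in Px$; it is multibasic if it is the direct sum of a finite (possibly empty) list of basic submodules. *)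

theory Defs
  imports
    "HOL-Algebra.QuotRing"
    "HOL-Algebra.Module"
    "HOL-Combinatorics.Permutations"
    "HOL-Library.Z2"
    "HOL-Library.Extended_Real"
begin

section \<open>Hahn series over the field of order 2 and the infinite root algebra\<close>

definition supp :: "(real \<Rightarrow> bit) \<Rightarrow> real set" where
  "supp a = {q. a q = 1}"

text \<open>In the product, restricting the index set to the supports leaves only zero terms out; for
  well-ordered supports it makes the index set finite, as \<^const>\<open>sum\<close> requires.\<close>

definition hahn_field :: "(real \<Rightarrow> bit) ring" where
  "hahn_field =
    \<lparr>carrier = {a. well_order_on (supp a) (Restr {(x, y). x \<le> y} (supp a))},
     monoid.mult = (\<lambda>a b q. \<Sum>(u, v)\<in>{(u, v). u \<in> supp a \<and> v \<in> supp b \<and> u + v = q}. a u * b v),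
     one = (\<lambda>q. if q = 0 then 1 else 0),
     zero = (\<lambda>q. 0),
     add = (\<lambda>a b q. a q + b q)\<rparr>"

definition hahn_val :: "(real \<Rightarrow> bit) \<Rightarrow> ereal" where
  "hahn_val a = (if a = \<zero>\<^bsub>hahn_field\<^esub> then \<infinity> else ereal (LEAST q. q \<in> supp a))"

definition hahn_ring :: "(real \<Rightarrow> bit) ring" where
  "hahn_ring = hahn_field\<lparr>carrier := {a \<in> carrier hahn_field. hahn_val a \<ge> 0}\<rparr>"

definition hahn_ideal_gt_1 :: "(real \<Rightarrow> bit) set" where
  "hahn_ideal_gt_1 = {a \<in> carrier hahn_field. hahn_val a > 1}"

definition root_algebra :: "(real \<Rightarrow> bit) set ring" where
  "root_algebra = hahn_ring Quot hahn_ideal_gt_1"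


section \<open>Homomorphisms, duals and reflexivity\<close>

text \<open>Homomorphisms are extensional functions, so that they are equal as soon as they agree on
  the carrier.\<close>

definition module_hom ::
  "('r, 's) ring_scheme \<Rightarrow> ('r, 'a, 'm) module_scheme \<Rightarrow> ('r, 'b, 'n) module_scheme \<Rightarrow> ('a \<Rightarrow> 'b) set"
  where
  "module_hom R M N = {f \<in> carrier M \<rightarrow>\<^sub>E carrier N.
     (\<forall>x\<in>carrier M. \<forall>y\<in>carrier M. f (x \<oplus>\<^bsub>M\<^esub> y) = f x \<oplus>\<^bsub>N\<^esub> f y) \<and>
     (\<forall>r\<in>carrier R. \<forall>x\<in>carrier M. f (r \<odot>\<^bsub>M\<^esub> x) = r \<odot>\<^bsub>N\<^esub> f x)}"

definition module_iso ::
  "('r, 's) ring_scheme \<Rightarrow> ('r, 'a, 'm) module_scheme \<Rightarrow> ('r, 'b, 'n) module_scheme \<Rightarrow> ('a \<Rightarrow> 'b) set"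
  where
  "module_iso R M N = {f \<in> module_hom R M N. bij_betw f (carrier M) (carrier N)}"

definition regular_module :: "('r, 's) ring_scheme \<Rightarrow> ('r, 'r) module" where
  "regular_module R =
    \<lparr>carrier = carrier R, monoid.mult = monoid.mult R, one = \<one>\<^bsub>R\<^esub>, zero = \<zero>\<^bsub>R\<^esub>, add = add R, smult = monoid.mult R\<rparr>"

text \<open>The record type of modules extends that of rings; its multiplicative fields play no role
  in \<^locale>\<open>Module.module\<close> and are left unspecified here.\<close>

definition dual_module ::
  "('r, 's) ring_scheme \<Rightarrow> ('r, 'a, 'm) module_scheme \<Rightarrow> ('r, 'a \<Rightarrow> 'r) module" where
  "dual_module R M =
    \<lparr>carrier = module_hom R M (regular_module R),
     monoid.mult = undefined,
     one = undefined,
     zero = (\<lambda>x\<in>carrier M. \<zero>\<^bsub>R\<^esub>),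
     add = (\<lambda>\<alpha> \<beta>. \<lambda>x\<in>carrier M. \<alpha> x \<oplus>\<^bsub>R\<^esub> \<beta> x),
     smult = (\<lambda>r \<alpha>. \<lambda>x\<in>carrier M. r \<otimes>\<^bsub>R\<^esub> \<alpha> x)\<rparr>"

definition evaluation ::
  "('r, 's) ring_scheme \<Rightarrow> ('r, 'a, 'm) module_scheme \<Rightarrow> 'a \<Rightarrow> ('a \<Rightarrow> 'r) \<Rightarrow> 'r" where
  "evaluation R M = (\<lambda>m\<in>carrier M. \<lambda>\<alpha>\<in>carrier (dual_module R M). \<alpha> m)"

definition theta_reflexive :: "('r, 's) ring_scheme \<Rightarrow> ('r, 'a, 'm) module_scheme \<Rightarrow> bool" where
  "theta_reflexive R M \<longleftrightarrow> evaluation R M \<in> module_iso R M (dual_module R (dual_module R M))"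


section \<open>Basic and multibasic modules\<close>

definition basic :: "('r, 's) ring_scheme \<Rightarrow> ('r, 'a, 'm) module_scheme \<Rightarrow> bool" where
  "basic R M \<longleftrightarrow> carrier M \<noteq> {\<zero>\<^bsub>M\<^esub>} \<and>
     (\<forall>x\<in>carrier M. \<forall>y\<in>carrier M.
        (\<exists>r\<in>carrier R. x = r \<odot>\<^bsub>M\<^esub> y) \<or> (\<exists>r\<in>carrier R. y = r \<odot>\<^bsub>M\<^esub> x))"

text \<open>Internal direct sum: every element of \<^term>\<open>M\<close> is in exactly one way a sum of elements,
  one from each submodule in the list. The empty list decomposes precisely the zero module.\<close>

definition is_direct_sum ::
  "('r, 's) ring_scheme \<Rightarrow> ('r, 'a, 'm) module_scheme \<Rightarrow> 'a set list \<Rightarrow> bool" where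
  "is_direct_sum R M Ns \<longleftrightarrow>
     (\<forall>N\<in>set Ns. submodule N R M) \<and>
     bij_betw (\<lambda>x. \<Oplus>\<^bsub>M\<^esub>i\<in>{..<length Ns}. x i) (\<Pi>\<^sub>E i\<in>{..<length Ns}. Ns ! i) (carrier M)"

definition basic_decomposition ::
  "('r, 's) ring_scheme \<Rightarrow> ('r, 'a, 'm) module_scheme \<Rightarrow> 'a set list \<Rightarrow> bool" where
  "basic_decomposition R M Ns \<longleftrightarrow>
     is_direct_sum R M Ns \<and> (\<forall>N\<in>set Ns. basic R (M\<lparr>carrier := N\<rparr>))"

definition multibasic :: "('r, 's) ring_scheme \<Rightarrow> ('r, 'a, 'm) module_scheme \<Rightarrow> bool" where
  "multibasic R M \<longleftrightarrow> (\<exists>Ns. basic_decomposition R M Ns)"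

end

theory Submission
  imports Defs
begin

text \<open>
  Both reflexivity and being multibasic are equivalent to linear compactness: every down-directed family
  of cosets of submodules has a common element. The ring \<open>P\<close> is uniserial, linearly compact and
  self-injective. Hence functionals extend and separate points from submodules, and a functional on the
  dual is the same as a compatible family of cosets; so the reflexive modules are the linearly compact ones.

  Basic modules are linearly compact, and linear compactness passes to finite sums. Conversely, a
  linearly compact module contains no infinite independent sequence, because its infinite sum would
  exist. Consequently a nonzero linearly compact module contains an element whose divisibility is
  predictable; dividing it as far as possible yields a pure basic submodule, which splits off, and the
  iteration stops. Uniqueness is the exchange argument of the Krull-Schmidt theorem: an endomorphism of
  a basic module acts on each element as a scalar, and \<open>P\<close> is local.
\<close>

section \<open>Modules and linear compactness\<close>

text \<open>Beyond the Hahn series only the facts in \<open>root_ring\<close> matter: up to units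
  the nonzero elements are powers t^a with 0 <= a <= 1, and t^a vanishes exactly for a > 1. The
  cutoff spares t^1, so this power generates the smallest nonzero ideal and is killed by every
  nonunit; this makes P injective over itself and lets functionals detect elements. The obstacle is
  that P is far from Noetherian: exponents fill an interval, suprema of heights and infima of
  exponents need not be attained, and basic modules need not be cyclic. Each passage to such a limit
  is therefore posed as a system of cosets and solved by linear compactness. Nor is there a length
  function behind the finiteness of a decomposition; its only source is the absence of infinite
  independent sequences, which serves both to find an element of predictable divisibility and to
  stop the splitting. The ring axioms for P come with the assumption that M is a module over it, so
  only products with powers of t are ever computed.\<close>

text \<open>Nonempty cosets of submodules. The sign is put on the scalar, so that only the additive inverse
  of the ring occurs.\<close>

definition affine_subset ::
  "('r, 's) ring_scheme \<Rightarrow> ('r, 'a, 'm) module_scheme \<Rightarrow> 'a set \<Rightarrow> bool" where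
  "affine_subset R M C \<longleftrightarrow> C \<noteq> {} \<and> (\<forall>x\<in>C. \<forall>y\<in>C. \<forall>z\<in>C. \<forall>r\<in>carrier R.
     x \<oplus>\<^bsub>M\<^esub> (r \<odot>\<^bsub>M\<^esub> y \<oplus>\<^bsub>M\<^esub> (\<ominus>\<^bsub>R\<^esub> r) \<odot>\<^bsub>M\<^esub> z) \<in> C)"

definition down_directed :: "'a set set \<Rightarrow> bool" where
  "down_directed F \<longleftrightarrow> (\<forall>C\<in>F. \<forall>D\<in>F. \<exists>E\<in>F. E \<subseteq> C \<inter> D)"

text \<open>Linear compactness for the discrete topology. Directed families of nonempty cosets stand
  in for families with the finite intersection property. \<open>N\<close> is a set and not a module
  record, so that submodules and their sums are covered inside one \<open>M\<close>.\<close>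

definition linearly_compact ::
  "('r, 's) ring_scheme \<Rightarrow> ('r, 'a, 'm) module_scheme \<Rightarrow> 'a set \<Rightarrow> bool" where
  "linearly_compact R M N \<longleftrightarrow>
     (\<forall>F. (\<forall>C\<in>F. C \<subseteq> N \<and> affine_subset R M C) \<and> down_directed F \<longrightarrow>
       (\<exists>x\<in>N. \<forall>C\<in>F. x \<in> C))"

text \<open>\<open>T a\<close> abstracts the class of t^a. The power \<open>T 1\<close> survives the
  cutoff and generates the socle; this nonzero bottom power is behind all the duality
  statements.\<close>

locale root_ring = cring R for R (structure) +
  fixes T :: "real \<Rightarrow> 'a"
  assumes T_closed [simp, intro]: "0 \<le> a \<Longrightarrow> T a \<in> carrier R"
    and T_0: "T 0 = \<one>"
    and T_add: "0 \<le> a \<Longrightarrow> 0 \<le> b \<Longrightarrow> T (a + b) = T a \<otimes> T b"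
    and T_eq_zero_iff: "0 \<le> a \<Longrightarrow> T a = \<zero> \<longleftrightarrow> 1 < a"
    and unit_T_decomp: "r \<in> carrier R \<Longrightarrow> r \<noteq> \<zero> \<Longrightarrow> \<exists>u\<in>Units R. \<exists>a\<ge>0. a \<le> 1 \<and> r = u \<otimes> T a"
    and ring_linearly_compact: "linearly_compact R (regular_module R) (carrier R)"


section \<open>The infinite root algebra\<close>

definition wo :: "real set \<Rightarrow> bool" where
  "wo A \<longleftrightarrow> (\<forall>S\<subseteq>A. S \<noteq> {} \<longrightarrow> (\<exists>m\<in>S. \<forall>s\<in>S. m \<le> s))"

text \<open>The real order restricted to any set is linear, so the only content of a well-order here
  is well-foundedness of the strict part, that is, least elements of nonempty subsets.\<close>

lemma well_order_on_real_iff: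
  "well_order_on A (Restr {(x::real, y). x \<le> y} A) \<longleftrightarrow> wo A"
proof -
  have lin: "linear_order_on A (Restr {(x::real, y). x \<le> y} A)"
    by (auto simp: linear_order_on_def partial_order_on_def preorder_on_def refl_on_def trans_def
        antisym_def total_on_def)
  have "wf (Restr {(x::real, y). x \<le> y} A - Id) \<longleftrightarrow> wo A" (is "wf ?r \<longleftrightarrow> _")
  proof
    assume wf: "wf ?r"
    show "wo A" unfolding wo_def
    proof (intro allI impI)
      fix S assume S: "S \<subseteq> A" "S \<noteq> {}"
      then obtain x where "x \<in> S" by blast
      from wfE_min[OF wf this] obtain z where z: "z \<in> S" "\<And>y. (y, z) \<in> ?r \<Longrightarrow> y \<notin> S"
        by blast
      show "\<exists>m\<in>S. \<forall>s\<in>S. m \<le> s"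
      proof (intro bexI ballI)
        fix s assume "s \<in> S"
        with z(2)[of s] z(1) S(1) show "z \<le> s" by force
      qed (rule z(1))
    qed
  next
    assume "wo A"
    show "wf ?r"
    proof (rule wfI_min)
      fix x :: real and Q assume x: "x \<in> Q"
      show "\<exists>z\<in>Q. \<forall>y. (y, z) \<in> ?r \<longrightarrow> y \<notin> Q"
      proof (cases "Q \<inter> A = {}")
        case True with x show ?thesis by blast
      next
        case False
        with \<open>wo A\<close> obtain m where "m \<in> Q \<inter> A" "\<forall>s\<in>Q \<inter> A. m \<le> s"
          unfolding wo_def by (meson inf_le2)
        then show ?thesis by (intro bexI[of _ m]) force+
      qed
    qed
  qed
  with lin show ?thesis by (simp add: well_order_on_def)
qed

lemma wo_subset: "wo B \<Longrightarrow> A \<subseteq> B \<Longrightarrow> wo A"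
  unfolding wo_def by (meson subset_trans)

lemma wo_Un:
  assumes "wo A" "wo B" shows "wo (A \<union> B)"
  unfolding wo_def
proof (intro allI impI)
  fix S assume S: "S \<subseteq> A \<union> B" "S \<noteq> {}"
  have *: "S \<inter> X = {} \<or> (\<exists>m\<in>S \<inter> X. \<forall>s\<in>S \<inter> X. m \<le> s)" if "wo X" for X
    using that unfolding wo_def by (meson inf_le2)
  show "\<exists>m\<in>S. \<forall>s\<in>S. m \<le> s"
    using *[OF assms(1)] *[OF assms(2)]
  proof (elim disjE bexE)
    assume "S \<inter> A = {}" "S \<inter> B = {}" with S show ?thesis by blast
  next
    fix m assume "S \<inter> A = {}" "m \<in> S \<inter> B" "\<forall>s\<in>S \<inter> B. m \<le> s"
    with S show ?thesis by blast
  next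
    fix m assume "S \<inter> B = {}" "m \<in> S \<inter> A" "\<forall>s\<in>S \<inter> A. m \<le> s"
    with S show ?thesis by blast
  next
    fix m n assume mn: "m \<in> S \<inter> A" "\<forall>s\<in>S \<inter> A. m \<le> s" "n \<in> S \<inter> B" "\<forall>s\<in>S \<inter> B. n \<le> s"
    show ?thesis
    proof (intro bexI[of _ "min m n"] ballI)
      fix s assume "s \<in> S"
      with S(1) have "s \<in> S \<inter> A \<or> s \<in> S \<inter> B" by blast
      with mn(2,4) show "min m n \<le> s" by (meson min.coboundedI1 min.coboundedI2)
    qed (use mn in \<open>auto simp: min_def\<close>)
  qed
qed

lemma wo_singleton: "wo {a}"
  unfolding wo_def by blast

lemma wo_translate:
  assumes "wo A" shows "wo ((\<lambda>q. q + c) ` A)"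
  unfolding wo_def
proof (intro allI impI)
  fix S assume S: "S \<subseteq> (\<lambda>q. q + c) ` A" "S \<noteq> {}"
  have "(\<lambda>q. q - c) ` S \<subseteq> A" using S(1) by auto
  with assms S(2) obtain m where "m \<in> (\<lambda>q. q - c) ` S" "\<forall>s\<in>(\<lambda>q. q - c) ` S. m \<le> s"
    unfolding wo_def by (meson image_is_empty)
  then show "\<exists>m\<in>S. \<forall>s\<in>S. m \<le> s" by force
qed

declare add_bit_eq_xor [simp del]

lemma bit_add_self [simp]: "(x::bit) + x = 0"
  by (cases x) auto

lemma bit_add_left_self [simp]: "(x::bit) + (x + y) = y"
  by (simp add: add.assoc[symmetric])

lemma supp_add: "supp (\<lambda>q. a q + b q) \<subseteq> supp a \<union> supp b"
  by (auto simp: supp_def)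

lemma bit_neq_1 [simp]: "(x::bit) \<noteq> 1 \<longleftrightarrow> x = 0"
  by (cases x) auto

lemma not_in_supp: "q \<notin> supp a \<longleftrightarrow> a q = 0"
  by (simp add: supp_def)

lemma wo_supp_add: "wo (supp a) \<Longrightarrow> wo (supp b) \<Longrightarrow> wo (supp (\<lambda>q. a q + b q))"
  by (rule wo_subset[OF wo_Un supp_add])

lemma supp_monomial: "supp (\<lambda>q. if q = a then 1 else 0) = {a}"
  by (auto simp: supp_def)

lemma supp_shift: "supp (\<lambda>q. b (q - c)) = (\<lambda>q. q + c) ` supp b"
  by (force simp: supp_def image_iff)

section \<open>Valuation bounds and cosets as conditions on coefficients\<close>

lemma carrier_hahn_field: "a \<in> carrier hahn_field \<longleftrightarrow> wo (supp a)"
  unfolding well_order_on_real_iff[symmetric] by (simp add: hahn_field_def)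

text \<open>For well-ordered support the valuation of a nonzero series is the least exponent, so a
  bound on it says which coefficients vanish. After the next two membership rules the valuation no
  longer appears.\<close>

lemma hahn_val_ge_iff:
  assumes "wo (supp a)" shows "hahn_val a \<ge> ereal c \<longleftrightarrow> (\<forall>q<c. a q = 0)"
    and "hahn_val a > ereal c \<longleftrightarrow> (\<forall>q\<le>c. a q = 0)"
proof -
  have z: "\<zero>\<^bsub>hahn_field\<^esub> = (\<lambda>q. 0)" by (simp add: hahn_field_def)
  have "(hahn_val a \<ge> ereal c \<longleftrightarrow> (\<forall>q<c. a q = 0)) \<and> (hahn_val a > ereal c \<longleftrightarrow> (\<forall>q\<le>c. a q = 0))"
  proof (cases "a = (\<lambda>q. 0)")
    case True then show ?thesis by (simp add: hahn_val_def z)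
  next
    case False
    then have "supp a \<noteq> {}" by (force simp: not_in_supp[symmetric])
    with assms obtain m where m: "m \<in> supp a" "\<forall>s\<in>supp a. m \<le> s"
      unfolding wo_def by blast
    have "(LEAST q. q \<in> supp a) = m" using m by (intro Least_equality) auto
    then have v: "hahn_val a = ereal m" using False by (simp add: hahn_val_def z)
    have "m \<ge> c \<longleftrightarrow> (\<forall>q<c. a q = 0)" "m > c \<longleftrightarrow> (\<forall>q\<le>c. a q = 0)"
      using m unfolding not_in_supp[symmetric] by (meson leD le_less_linear less_le_trans order.trans)+
    with v show ?thesis by simp
  qed
  then show "hahn_val a \<ge> ereal c \<longleftrightarrow> (\<forall>q<c. a q = 0)" "hahn_val a > ereal c \<longleftrightarrow> (\<forall>q\<le>c. a q = 0)"
    by auto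
qed

lemma carrier_hahn_ring: "a \<in> carrier hahn_ring \<longleftrightarrow> wo (supp a) \<and> (\<forall>q<0. a q = 0)"
  using hahn_val_ge_iff(1)[of a 0]
  by (auto simp: hahn_ring_def carrier_hahn_field zero_ereal_def[symmetric])

lemma hahn_ideal_iff: "a \<in> hahn_ideal_gt_1 \<longleftrightarrow> wo (supp a) \<and> (\<forall>q\<le>1. a q = 0)"
  using hahn_val_ge_iff(2)[of a 1]
  by (auto simp: hahn_ideal_gt_1_def carrier_hahn_field one_ereal_def[symmetric])

lemma add_hahn_ring: "a \<oplus>\<^bsub>hahn_ring\<^esub> b = (\<lambda>q. a q + b q)"
  by (simp add: hahn_ring_def hahn_field_def)

abbreviation pclass :: "(real \<Rightarrow> bit) \<Rightarrow> (real \<Rightarrow> bit) set" where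
  "pclass a \<equiv> hahn_ideal_gt_1 +>\<^bsub>hahn_ring\<^esub> a"

text \<open>Residues modulo the ideal are series cut off after exponent 1. In characteristic 2 the
  difference of \<open>b\<close> and \<open>a\<close> is their sum, which therefore serves as the
  element of the ideal.\<close>

lemma pclass_eq:
  assumes "wo (supp a)" shows "pclass a = {b. wo (supp b) \<and> (\<forall>q\<le>1. b q = a q)}"
proof (intro equalityI subsetI)
  fix b assume "b \<in> pclass a"
  then obtain h where "h \<in> hahn_ideal_gt_1" "b = (\<lambda>q. h q + a q)"
    by (auto simp: a_r_coset_def' add_hahn_ring)
  then show "b \<in> {b. wo (supp b) \<and> (\<forall>q\<le>1. b q = a q)}"
    using assms wo_supp_add[of h a] by (auto simp: hahn_ideal_iff)
next
  fix b assume b: "b \<in> {b. wo (supp b) \<and> (\<forall>q\<le>1. b q = a q)}"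
  then have "(\<lambda>q. b q + a q) \<in> hahn_ideal_gt_1"
    using assms by (auto simp: hahn_ideal_iff wo_supp_add)
  moreover have "b = (\<lambda>q. (b q + a q) + a q)" by (simp add: add.assoc)
  ultimately show "b \<in> pclass a" unfolding a_r_coset_def' add_hahn_ring by blast
qed

lemma mem_pclass: "wo (supp a) \<Longrightarrow> b \<in> pclass a \<longleftrightarrow> wo (supp b) \<and> (\<forall>q\<le>1. b q = a q)"
  by (simp add: pclass_eq)

lemma pclass_cong_iff:
  "wo (supp a) \<Longrightarrow> wo (supp b) \<Longrightarrow> pclass a = pclass b \<longleftrightarrow> (\<forall>q\<le>1. a q = b q)"
  by (auto simp: pclass_eq)

lemma carrier_root_algebra:
  "carrier root_algebra = {pclass a |a. wo (supp a) \<and> (\<forall>q<0. a q = 0)}"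
  by (auto simp: root_algebra_def FactRing_def A_RCOSETS_def' carrier_hahn_ring)

lemma pclass_closed: "wo (supp a) \<Longrightarrow> \<forall>q<0. a q = 0 \<Longrightarrow> pclass a \<in> carrier root_algebra"
  unfolding carrier_root_algebra by blast

lemma zero_root_algebra: "\<zero>\<^bsub>root_algebra\<^esub> = pclass (\<lambda>q. 0)"
proof -
  have "wo (supp (\<lambda>q. 0))" by (simp add: supp_def wo_def)
  then show ?thesis by (auto simp: root_algebra_def FactRing_def mem_pclass hahn_ideal_iff)
qed

lemma one_root_algebra: "\<one>\<^bsub>root_algebra\<^esub> = pclass (\<lambda>q. if q = 0 then 1 else 0)"
  by (simp add: root_algebra_def FactRing_def hahn_ring_def hahn_field_def)

lemma add_root_algebra:
  assumes a: "wo (supp a)" and b: "wo (supp b)"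
  shows "pclass a \<oplus>\<^bsub>root_algebra\<^esub> pclass b = pclass (\<lambda>q. a q + b q)"
proof -
  have "pclass a \<oplus>\<^bsub>root_algebra\<^esub> pclass b = {(\<lambda>q. x q + y q) |x y. x \<in> pclass a \<and> y \<in> pclass b}"
    by (auto simp: root_algebra_def FactRing_def set_add_def' add_hahn_ring)
  also have "\<dots> = pclass (\<lambda>q. a q + b q)"
  proof (intro equalityI subsetI)
    fix c assume "c \<in> {(\<lambda>q. x q + y q) |x y. x \<in> pclass a \<and> y \<in> pclass b}"
    then show "c \<in> pclass (\<lambda>q. a q + b q)"
      using a b by (auto simp: mem_pclass wo_supp_add)
  next
    fix c assume c: "c \<in> pclass (\<lambda>q. a q + b q)"
    \<comment> \<open>The summand from the first coset is \<open>a\<close> itself; the second is the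
      difference of \<open>c\<close> and \<open>a\<close>, again written as a sum.\<close>
    then have "(\<lambda>q. c q + a q) \<in> pclass b"
      using a b by (auto simp: mem_pclass wo_supp_add add.commute)
    moreover have "a \<in> pclass a" using a by (simp add: mem_pclass)
    moreover have "c = (\<lambda>q. a q + (c q + a q))" by (simp add: add.commute)
    ultimately show "c \<in> {(\<lambda>q. x q + y q) |x y. x \<in> pclass a \<and> y \<in> pclass b}"
      unfolding mem_Collect_eq by (intro exI[of _ a] exI[of _ "\<lambda>q. c q + a q"]) simp
  qed
  finally show ?thesis .
qed


section \<open>Powers of the root and units of P\<close>

definition tpow :: "real \<Rightarrow> (real \<Rightarrow> bit) set" where
  "tpow a = pclass (\<lambda>q. if q = a then 1 else 0)"

text \<open>At most one pair of exponents contributes, so the product is a shift of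
  \<open>b\<close>. Products of general series are never expanded; they are reached through the ring
  axioms.\<close>

lemma mult_hahn_ring_monomial:
  "(\<lambda>q. if q = c then 1 else 0) \<otimes>\<^bsub>hahn_ring\<^esub> b = (\<lambda>q. b (q - c))"
proof
  fix q
  have "{(u, v). u \<in> {c} \<and> v \<in> supp b \<and> u + v = q} = (if b (q - c) = 1 then {(c, q - c)} else {})"
    by (auto simp: supp_def)
  then have "(\<Sum>(u, v)\<in>{(u, v). u \<in> {c} \<and> v \<in> supp b \<and> u + v = q}. (if u = c then 1 else 0) * b v) = b (q - c)"
    by (cases "b (q - c)") (simp_all only: if_True if_False, simp_all)
  then show "((\<lambda>q. if q = c then 1 else 0) \<otimes>\<^bsub>hahn_ring\<^esub> b) q = b (q - c)"
    unfolding hahn_ring_def hahn_field_def supp_monomial[of c, symmetric] by simp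
qed

lemma wo_supp_shift: "wo (supp b) \<Longrightarrow> wo (supp (\<lambda>q. b (q - c)))"
  by (simp add: supp_shift wo_translate)

lemma wo_supp_monomial: "wo (supp (\<lambda>q. if q = c then 1 else 0))"
  by (simp add: supp_monomial wo_singleton)

text \<open>A product of cosets is closed under adding the ideal and contains the coset of the product of
  representatives; since it is a coset itself, it equals that coset. This spares a proof that
  multiplication of Hahn series is well defined modulo the ideal.\<close>

lemma tpow_mult_pclass:
  assumes "cring root_algebra" and c: "0 \<le> c" and b: "wo (supp b)" "\<forall>q<0. b q = 0"
  shows "tpow c \<otimes>\<^bsub>root_algebra\<^esub> pclass b = pclass (\<lambda>q. b (q - c))"
proof -
  interpret cring root_algebra by fact
  let ?p = "tpow c \<otimes>\<^bsub>root_algebra\<^esub> pclass b" and ?m = "\<lambda>q::real. if q = c then 1 else (0::bit)"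
  have "tpow c \<in> carrier root_algebra" "pclass b \<in> carrier root_algebra"
    using b c wo_supp_monomial by (auto simp: tpow_def intro!: pclass_closed)
  then have "?p \<in> carrier root_algebra" by (rule m_closed)
  then obtain d where d: "?p = pclass d" "wo (supp d)"
    unfolding carrier_root_algebra by blast
  have "?m \<in> pclass ?m" "b \<in> pclass b" using b wo_supp_monomial by (auto simp: mem_pclass)
  then have "pclass (?m \<otimes>\<^bsub>hahn_ring\<^esub> b) \<subseteq> ?p"
    unfolding root_algebra_def FactRing_def rcoset_mult_def tpow_def by auto
  moreover have "(\<lambda>q. b (q - c)) \<in> pclass (\<lambda>q. b (q - c))"
    using b wo_supp_shift by (simp add: mem_pclass)
  ultimately have "(\<lambda>q. b (q - c)) \<in> pclass d"
    using d(1) by (auto simp: mult_hahn_ring_monomial)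
  then show ?thesis using d wo_supp_shift[OF b(1)] by (simp add: mem_pclass pclass_cong_iff)
qed

text \<open>Squaring is additive in characteristic 2, so (1 + e)^(2^k) = 1 + e^(2^k). For k = n this
  power is 1, since 2^n is at least n, and the preceding power of 1 + e is the inverse.\<close>

lemma (in cring) unit_one_plus_nilpotent:
  assumes char: "\<And>x. x \<in> carrier R \<Longrightarrow> x \<oplus> x = \<zero>"
    and e: "e \<in> carrier R" and n: "e [^] (n::nat) = \<zero>"
  shows "\<one> \<oplus> e \<in> Units R"
proof -
  have pow: "(\<one> \<oplus> e) [^] (2 ^ k :: nat) = \<one> \<oplus> e [^] (2 ^ k :: nat)" for k
  proof (induction k)
    case 0 show ?case using e by simp
  next
    case (Suc k)
    let ?f = "e [^] (2 ^ k :: nat)"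
    have f: "?f \<in> carrier R" using e by simp
    have "(\<one> \<oplus> e) [^] (2 ^ Suc k :: nat) = (\<one> \<oplus> ?f) \<otimes> (\<one> \<oplus> ?f)"
      using e by (simp add: mult_2 nat_pow_mult[symmetric] Suc del: nat_pow_mult)
    also have "\<dots> = \<one> \<oplus> ((?f \<oplus> ?f) \<oplus> ?f \<otimes> ?f)" using f by algebra
    also have "\<dots> = \<one> \<oplus> e [^] (2 ^ Suc k :: nat)"
      using e f char[OF f] by (simp add: mult_2 nat_pow_mult)
    finally show ?case .
  qed
  have "n \<le> 2 ^ n" by (simp add: less_imp_le)
  then have "e [^] (2 ^ n :: nat) = e [^] n \<otimes> e [^] (2 ^ n - n)" using e by (simp add: nat_pow_mult)
  also have "\<dots> = \<zero>" using e n by simp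
  finally have "(\<one> \<oplus> e) [^] (2 ^ n :: nat) = \<one>" using pow[of n] by simp
  moreover have "(2 ^ n :: nat) = Suc (2 ^ n - 1)" by simp
  ultimately have *: "(\<one> \<oplus> e) \<otimes> (\<one> \<oplus> e) [^] (2 ^ n - 1 :: nat) = \<one>"
    using e by (metis a_closed nat_pow_Suc2 one_closed)
  have "(\<one> \<oplus> e) [^] (2 ^ n - 1 :: nat) \<in> carrier R" "\<one> \<oplus> e \<in> carrier R" using e by auto
  with * show ?thesis unfolding Units_def using m_comm by fastforce
qed

context
  assumes P: "cring root_algebra"
begin

interpretation P: cring root_algebra by (rule P)

lemma tpow_closed: "0 \<le> a \<Longrightarrow> tpow a \<in> carrier root_algebra"
  using wo_supp_monomial by (auto simp: tpow_def intro!: pclass_closed)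

lemma tpow_add: "0 \<le> a \<Longrightarrow> 0 \<le> b \<Longrightarrow> tpow (a + b) = tpow a \<otimes>\<^bsub>root_algebra\<^esub> tpow b"
  using tpow_mult_pclass[OF P, of a "\<lambda>q. if q = b then 1 else 0"]
  by (simp add: tpow_def wo_supp_monomial algebra_simps)

lemma wo_supp_0: "wo (supp (\<lambda>q. 0))"
  by (simp add: supp_def wo_def)

lemma tpow_eq_zero_iff: "tpow a = \<zero>\<^bsub>root_algebra\<^esub> \<longleftrightarrow> 1 < a"
  by (auto simp: tpow_def zero_root_algebra pclass_cong_iff wo_supp_monomial wo_supp_0)

lemma root_algebra_char_2: "x \<in> carrier root_algebra \<Longrightarrow> x \<oplus>\<^bsub>root_algebra\<^esub> x = \<zero>\<^bsub>root_algebra\<^esub>"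
  by (auto simp: carrier_root_algebra add_root_algebra zero_root_algebra)

lemma tpow_pow: "0 \<le> h \<Longrightarrow> tpow h [^]\<^bsub>root_algebra\<^esub> (n::nat) = tpow (real n * h)"
proof (induction n)
  case 0 show ?case by (simp add: one_root_algebra tpow_def)
next
  case (Suc n)
  then show ?case using tpow_add[of "real n * h" h] by (simp add: algebra_simps)
qed

text \<open>Subtracting 1 leaves a series which, if nonzero, has a least exponent h > 0 because its
  support is well ordered. It is then t^h times a series, and its n-th power vanishes in P as soon
  as n h > 1.\<close>

lemma unit_pclass:
  assumes s: "wo (supp s)" "\<forall>q<0. s q = 0" "s 0 = 1"
  shows "pclass s \<in> Units root_algebra"
proof -
  let ?e = "\<lambda>q. s q + (if q = 0 then 1 else 0)"
  have e: "wo (supp ?e)" "\<forall>q\<le>0. ?e q = 0"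
    using s wo_supp_monomial[of 0] by (auto intro!: wo_supp_add simp: order.order_iff_strict)
  have eP: "pclass ?e \<in> carrier root_algebra"
    by (rule pclass_closed[OF e(1)]) (use e(2) in \<open>meson less_imp_le\<close>)
  have s_eq: "pclass s = \<one>\<^bsub>root_algebra\<^esub> \<oplus>\<^bsub>root_algebra\<^esub> pclass ?e"
    using e(1) wo_supp_monomial[of 0] by (simp add: one_root_algebra add_root_algebra add.commute add.assoc)
  have "\<exists>n::nat. pclass ?e [^]\<^bsub>root_algebra\<^esub> n = \<zero>\<^bsub>root_algebra\<^esub>"
  proof (cases "supp ?e = {}")
    case True
    then have "?e = (\<lambda>q. 0)" by (intro ext) (metis empty_iff not_in_supp)
    then have "pclass ?e = \<zero>\<^bsub>root_algebra\<^esub>" unfolding zero_root_algebra by (rule arg_cong)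
    then have "pclass ?e [^]\<^bsub>root_algebra\<^esub> (1::nat) = \<zero>\<^bsub>root_algebra\<^esub>" by simp
    then show ?thesis by blast
  next
    case False
    then obtain h where h: "h \<in> supp ?e" "\<forall>q\<in>supp ?e. h \<le> q"
      using e(1) unfolding wo_def by blast
    have "0 < h" using h(1) e(2) by (metis not_in_supp not_less)
    \<comment> \<open>Shifting down by the least exponent creates no negative exponents, so the
      quotient by t^h is still in the Hahn ring.\<close>
    let ?e' = "\<lambda>q. ?e (q + h)"
    have wo': "wo (supp ?e')" using wo_supp_shift[OF e(1), of "- h"] by simp
    have neg': "\<forall>q<0. ?e' q = 0"
    proof (intro allI impI)
      fix q :: real assume "q < 0"
      then have "q + h \<notin> supp ?e" using h(2) by force
      then show "?e' q = 0" by (simp only: not_in_supp)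
    qed
    have e'P: "pclass ?e' \<in> carrier root_algebra" by (rule pclass_closed[OF wo' neg'])
    have "pclass ?e = tpow h \<otimes>\<^bsub>root_algebra\<^esub> pclass ?e'"
      using tpow_mult_pclass[OF P _ wo' neg', of h] \<open>0 < h\<close> by simp
    then have pw: "pclass ?e [^]\<^bsub>root_algebra\<^esub> n = tpow (real n * h) \<otimes>\<^bsub>root_algebra\<^esub> pclass ?e' [^]\<^bsub>root_algebra\<^esub> n" for n :: nat
      using e'P tpow_closed[of h] \<open>0 < h\<close> by (simp add: P.nat_pow_distrib tpow_pow)
    obtain n :: nat where "1 < real n * h" using \<open>0 < h\<close> ex_less_of_nat_mult by blast
    then have "tpow (real n * h) = \<zero>\<^bsub>root_algebra\<^esub>" by (simp add: tpow_eq_zero_iff)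
    with pw[of n] e'P have "pclass ?e [^]\<^bsub>root_algebra\<^esub> n = \<zero>\<^bsub>root_algebra\<^esub>" by simp
    then show ?thesis by blast
  qed
  then obtain n :: nat where "pclass ?e [^]\<^bsub>root_algebra\<^esub> n = \<zero>\<^bsub>root_algebra\<^esub>" ..
  from P.unit_one_plus_nilpotent[OF root_algebra_char_2 eP this] show ?thesis
    by (simp only: s_eq)
qed

text \<open>Dividing by t^m, with m the least exponent of \<open>b\<close>, leaves constant
  coefficient 1 and therefore a unit. A nonzero class has an exponent at most 1, which bounds
  m.\<close>

lemma leading_term:
  assumes b: "wo (supp b)" "\<forall>q<0. b q = 0" and nz: "pclass b \<noteq> \<zero>\<^bsub>root_algebra\<^esub>"
  obtains m u where "0 \<le> m" "m \<le> 1" "u \<in> Units root_algebra"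
    "pclass b = u \<otimes>\<^bsub>root_algebra\<^esub> tpow m" "b m = 1" "\<forall>q<m. b q = 0"
proof -
  from nz obtain p where p: "p \<le> 1" "p \<in> supp b"
    unfolding zero_root_algebra pclass_cong_iff[OF b(1) wo_supp_0] not_in_supp[symmetric] by blast
  then obtain m where m: "m \<in> supp b" "\<forall>q\<in>supp b. m \<le> q"
    using b(1) unfolding wo_def by blast
  have m0: "0 \<le> m" using m(1) b(2) by (metis not_in_supp not_less)
  have m1: "m \<le> 1" using m(2) p by force
  have bm: "b m = 1" using m(1) by (simp add: supp_def)
  have low: "\<forall>q<m. b q = 0" using m(2) by (metis not_in_supp leD)
  let ?s = "\<lambda>q. b (q + m)"
  have s: "wo (supp ?s)" "\<forall>q<0. ?s q = 0" "?s 0 = 1"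
    using wo_supp_shift[OF b(1), of "- m"] low bm by auto
  have "pclass b = tpow m \<otimes>\<^bsub>root_algebra\<^esub> pclass ?s"
    using tpow_mult_pclass[OF P m0 s(1,2)] by simp
  moreover have "pclass ?s \<in> Units root_algebra" by (rule unit_pclass[OF s])
  ultimately show ?thesis
    using that[OF m0 m1 _ _ bm low, of "pclass ?s"] P.m_comm tpow_closed[OF m0] P.Units_closed by simp
qed

section \<open>Linear compactness of P\<close>

definition repr :: "(real \<Rightarrow> bit) set \<Rightarrow> real \<Rightarrow> bit" where
  "repr X = (SOME a. wo (supp a) \<and> (\<forall>q<0. a q = 0) \<and> X = pclass a)"

lemma repr:
  assumes "X \<in> carrier root_algebra"
  shows "wo (supp (repr X))" "\<forall>q<0. repr X q = 0" "pclass (repr X) = X"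
proof -
  from assms have "\<exists>a. wo (supp a) \<and> (\<forall>q<0. a q = 0) \<and> X = pclass a"
    unfolding carrier_root_algebra by blast
  from someI_ex[OF this] show "wo (supp (repr X))" "\<forall>q<0. repr X q = 0" "pclass (repr X) = X"
    unfolding repr_def by auto
qed

lemma add_repr:
  assumes "X \<in> carrier root_algebra" "Y \<in> carrier root_algebra"
  shows "X \<oplus>\<^bsub>root_algebra\<^esub> Y = pclass (\<lambda>q. repr X q + repr Y q)"
  using add_root_algebra[of "repr X" "repr Y"] repr[OF assms(1)] repr[OF assms(2)] by simp

text \<open>The exponents up to which all elements of some member of the family agree determine a
  pseudo-limit of the family.\<close>

lemma root_algebra_linearly_compact:
  "linearly_compact root_algebra (regular_module root_algebra) (carrier root_algebra)"
  unfolding linearly_compact_def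
proof (intro allI impI)
  fix F
  assume F: "(\<forall>C\<in>F. C \<subseteq> carrier root_algebra \<and> affine_subset root_algebra (regular_module root_algebra) C) \<and> down_directed F"
  \<comment> \<open>\<open>det C q\<close> says that the members of \<open>C\<close> agree up to
    exponent q. The coefficients of \<open>repr\<close> above exponent 1 depend on the chosen
    series, so \<open>f\<close> is set to 0 there.\<close>
  define det where "det C q \<longleftrightarrow> (\<forall>x\<in>C. \<forall>y\<in>C. \<forall>p\<le>q. repr x p = repr y p)" for C and q :: real
  define f where "f q = (if q \<le> 1 \<and> (\<exists>C\<in>F. det C q \<and> (\<exists>x\<in>C. repr x q = 1)) then 1 else 0::bit)" for q
  have sub: "\<And>C. C \<in> F \<Longrightarrow> C \<subseteq> carrier root_algebra" using F by blast
  have ne: "\<exists>x. x \<in> C" if "C \<in> F" for C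
  proof -
    have "affine_subset root_algebra (regular_module root_algebra) C" using F that by blast
    then have "C \<noteq> {}" by (simp add: affine_subset_def)
    then show ?thesis by blast
  qed
  have f_eq: "f p = repr x p" if C: "C \<in> F" "det C q" "q \<le> 1" "x \<in> C" "p \<le> q" for C q x p
  proof -
    have "f p = 1 \<longleftrightarrow> repr x p = 1"
    proof
      assume "f p = 1"
      then obtain D y where D: "D \<in> F" "det D p" "y \<in> D" "repr y p = 1"
        unfolding f_def by (auto split: if_splits)
      \<comment> \<open>Directedness: a point z common to both members carries the coefficient from
        y over to x.\<close>
      obtain E where E: "E \<in> F" "E \<subseteq> C \<inter> D" using F C(1) D(1) unfolding down_directed_def by blast
      with ne obtain z where "z \<in> E" by blast
      then have z: "z \<in> C" "z \<in> D" using E by auto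
      have "repr x p = repr z p" using C z unfolding det_def by blast
      also have "\<dots> = repr y p" using D z unfolding det_def by blast
      finally show "repr x p = 1" using D by simp
    next
      assume "repr x p = 1"
      moreover have "det C p" using C unfolding det_def by (meson order.trans)
      ultimately show "f p = 1" unfolding f_def using C by auto
    qed
    then show ?thesis by (cases "f p"; cases "repr x p") auto
  qed
  have f1: "\<exists>C x. C \<in> F \<and> det C q \<and> q \<le> 1 \<and> x \<in> C" if "f q = 1" for q
    using that unfolding f_def by (auto split: if_splits)
  have wf: "wo (supp f)" unfolding wo_def
  proof (intro allI impI)
    fix S assume S: "S \<subseteq> supp f" "S \<noteq> {}"
    then obtain s where s: "s \<in> S" by blast
    with S(1) have "f s = 1" by (auto simp: supp_def)
    from f1[OF this] obtain C x where C: "C \<in> F" "det C s" "s \<le> 1" "x \<in> C" by blast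
    \<comment> \<open>Up to s the series \<open>f\<close> coincides with a single representative, so
      the part of S up to s inherits a least element from a genuine Hahn series.\<close>
    have "S \<inter> {..s} \<subseteq> supp (repr x)"
      using S(1) f_eq[OF C] by (auto simp: supp_def)
    moreover have "wo (supp (repr x))" using repr(1)[of x] sub[OF C(1)] C(4) by blast
    ultimately obtain m where m: "m \<in> S \<inter> {..s}" "\<forall>q\<in>S \<inter> {..s}. m \<le> q"
      unfolding wo_def using s by (metis IntI atMost_iff empty_iff order_refl)
    show "\<exists>m\<in>S. \<forall>q\<in>S. m \<le> q"
    proof (intro bexI ballI)
      fix q assume "q \<in> S" with m show "m \<le> q" by (cases "q \<le> s") auto
    qed (use m in auto)
  qed
  have f_neg: "\<forall>q<0. f q = 0"
  proof (intro allI impI, rule ccontr)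
    fix q :: real assume q: "q < 0" "f q \<noteq> 0"
    then have "f q = 1" by (cases "f q") auto
    from f1[OF this] obtain C x where C: "C \<in> F" "det C q" "q \<le> 1" "x \<in> C" by blast
    then have "f q = repr x q" by (intro f_eq[OF C]) auto
    also have "\<dots> = 0" using repr(2)[of x] sub[OF C(1)] C(4) q(1) by blast
    finally show False using q by simp
  qed
  have fP: "pclass f \<in> carrier root_algebra" by (rule pclass_closed[OF wf f_neg])
  have "pclass f \<in> C" if C: "C \<in> F" for C
  proof (rule ccontr)
    assume nC: "pclass f \<notin> C"
    obtain x where x: "x \<in> C" using ne[OF C] by blast
    then have xP: "x \<in> carrier root_algebra" using C sub by blast
    let ?d = "\<lambda>q. f q + repr x q"
    have d: "wo (supp ?d)" "\<forall>q<0. ?d q = 0"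
      using wo_supp_add[OF wf repr(1)[OF xP]] f_neg repr(2)[OF xP] by auto
    have D: "pclass f \<oplus>\<^bsub>root_algebra\<^esub> x = pclass ?d"
      using add_root_algebra[OF wf repr(1)[OF xP]] repr(3)[OF xP] by simp
    have "pclass f = x" if "pclass ?d = \<zero>\<^bsub>root_algebra\<^esub>"
    proof -
      have "pclass f = pclass f \<oplus>\<^bsub>root_algebra\<^esub> (x \<oplus>\<^bsub>root_algebra\<^esub> x)"
        using fP xP root_algebra_char_2 by simp
      also have "\<dots> = x" using D that fP xP by (simp add: P.a_assoc[symmetric])
      finally show ?thesis .
    qed
    with x nC have nz: "pclass ?d \<noteq> \<zero>\<^bsub>root_algebra\<^esub>" by blast
    \<comment> \<open>w is the first exponent at which \<open>f\<close> and \<open>repr x\<close>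
      differ. \<open>C\<close> cannot be determined up to w, so it has two points whose difference
      starts at some m at most w; a multiple of that difference equals the difference of
      \<open>f\<close> and x in P, and the coset property puts the class of \<open>f\<close> into
      \<open>C\<close>.\<close>
    obtain w u where w: "0 \<le> w" "w \<le> 1" "u \<in> Units root_algebra"
      "pclass ?d = u \<otimes>\<^bsub>root_algebra\<^esub> tpow w" "?d w = 1" "\<forall>q<w. ?d q = 0"
      by (rule leading_term[OF d nz])
    have "\<not> det C w" using f_eq[OF C _ w(2) x order_refl] w(5) by auto
    then obtain y z p where yz: "y \<in> C" "z \<in> C" "p \<le> w" "repr y p \<noteq> repr z p"
      unfolding det_def by blast
    have yzP: "y \<in> carrier root_algebra" "z \<in> carrier root_algebra" using yz C sub by auto
    let ?g = "\<lambda>q. repr y q + repr z q"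
    have g: "wo (supp ?g)" "\<forall>q<0. ?g q = 0" "?g p = 1"
    proof -
      show "wo (supp ?g)" by (rule wo_supp_add[OF repr(1)[OF yzP(1)] repr(1)[OF yzP(2)]])
      show "\<forall>q<0. ?g q = 0" using repr(2)[OF yzP(1)] repr(2)[OF yzP(2)] by simp
      show "?g p = 1" using yz(4) by (cases "repr y p"; cases "repr z p") auto
    qed
    have nz': "pclass ?g \<noteq> \<zero>\<^bsub>root_algebra\<^esub>"
      unfolding zero_root_algebra pclass_cong_iff[OF g(1) wo_supp_0]
      using yz(3) w(2) g(3) by (metis order.trans zero_neq_one)
    obtain m v where m: "0 \<le> m" "m \<le> 1" "v \<in> Units root_algebra"
      "pclass ?g = v \<otimes>\<^bsub>root_algebra\<^esub> tpow m" "?g m = 1" "\<forall>q<m. ?g q = 0"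
      by (rule leading_term[OF g(1,2) nz'])
    have "m \<le> w" using m(6) g(3) yz(3) by (metis linorder_not_le order.trans zero_neq_one less_le_trans)
    \<comment> \<open>This is the quotient of the leading terms u t^w and v t^m.\<close>
    define r where "r = u \<otimes>\<^bsub>root_algebra\<^esub> tpow (w - m) \<otimes>\<^bsub>root_algebra\<^esub> inv\<^bsub>root_algebra\<^esub> v"
    have cl: "u \<in> carrier root_algebra" "v \<in> carrier root_algebra" "inv\<^bsub>root_algebra\<^esub> v \<in> carrier root_algebra"
      "tpow (w - m) \<in> carrier root_algebra" "tpow m \<in> carrier root_algebra"
      using w m \<open>m \<le> w\<close> tpow_closed P.Units_closed P.Units_inv_closed by auto
    then have rP: "r \<in> carrier root_algebra" unfolding r_def by simp
    have "r \<otimes>\<^bsub>root_algebra\<^esub> pclass ?g =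
        u \<otimes>\<^bsub>root_algebra\<^esub> (tpow (w - m) \<otimes>\<^bsub>root_algebra\<^esub> tpow m) \<otimes>\<^bsub>root_algebra\<^esub> (inv\<^bsub>root_algebra\<^esub> v \<otimes>\<^bsub>root_algebra\<^esub> v)"
      unfolding r_def m(4) using cl by (simp add: P.m_ac)
    also have "\<dots> = pclass ?d"
      using cl m(1,3) w(4) \<open>m \<le> w\<close> tpow_add[of "w - m" m] by simp
    finally have r: "r \<otimes>\<^bsub>root_algebra\<^esub> pclass ?g = pclass ?d" .
    \<comment> \<open>Signs vanish in characteristic 2, which turns the affine combination into the
      sum of x and r (y + z).\<close>
    have "\<ominus>\<^bsub>root_algebra\<^esub> r = r" using root_algebra_char_2[OF rP] rP P.minus_equality by simp
    then have "x \<oplus>\<^bsub>root_algebra\<^esub> (r \<otimes>\<^bsub>root_algebra\<^esub> y \<oplus>\<^bsub>root_algebra\<^esub> (\<ominus>\<^bsub>root_algebra\<^esub> r) \<otimes>\<^bsub>root_algebra\<^esub> z)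
      = x \<oplus>\<^bsub>root_algebra\<^esub> r \<otimes>\<^bsub>root_algebra\<^esub> pclass ?g"
      using rP yzP by (simp add: add_repr[symmetric] P.r_distr)
    also have "\<dots> = x \<oplus>\<^bsub>root_algebra\<^esub> (pclass f \<oplus>\<^bsub>root_algebra\<^esub> x)"
      by (simp only: r D)
    also have "\<dots> = (x \<oplus>\<^bsub>root_algebra\<^esub> x) \<oplus>\<^bsub>root_algebra\<^esub> pclass f"
      using fP xP by (simp add: P.a_ac)
    also have "\<dots> = pclass f" using root_algebra_char_2 xP fP by simp
    finally have "pclass f = x \<oplus>\<^bsub>root_algebra\<^esub> (r \<otimes>\<^bsub>root_algebra\<^esub> y \<oplus>\<^bsub>root_algebra\<^esub> (\<ominus>\<^bsub>root_algebra\<^esub> r) \<otimes>\<^bsub>root_algebra\<^esub> z)"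
      by simp
    moreover have "affine_subset root_algebra (regular_module root_algebra) C" using F C by blast
    ultimately have "pclass f \<in> C"
      unfolding affine_subset_def regular_module_def using x yz(1,2) rP by simp
    with nC show False ..
  qed
  with fP show "\<exists>x\<in>carrier root_algebra. \<forall>C\<in>F. x \<in> C" by blast
qed

lemma root_ring_root_algebra: "root_ring root_algebra tpow"
proof
  show "\<And>a. 0 \<le> a \<Longrightarrow> tpow a \<in> carrier root_algebra" by (rule tpow_closed)
  show "tpow 0 = \<one>\<^bsub>root_algebra\<^esub>" by (simp add: tpow_def one_root_algebra)
  show "\<And>a b. 0 \<le> a \<Longrightarrow> 0 \<le> b \<Longrightarrow> tpow (a + b) = tpow a \<otimes>\<^bsub>root_algebra\<^esub> tpow b" by (rule tpow_add)
  show "\<And>a. 0 \<le> a \<Longrightarrow> tpow a = \<zero>\<^bsub>root_algebra\<^esub> \<longleftrightarrow> 1 < a" by (rule tpow_eq_zero_iff)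
  show "linearly_compact root_algebra (regular_module root_algebra) (carrier root_algebra)"
    by (rule root_algebra_linearly_compact)
  fix r assume "r \<in> carrier root_algebra" "r \<noteq> \<zero>\<^bsub>root_algebra\<^esub>"
  then show "\<exists>u\<in>Units root_algebra. \<exists>a\<ge>0. a \<le> 1 \<and> r = u \<otimes>\<^bsub>root_algebra\<^esub> tpow a"
    using repr[of r] leading_term[of "repr r"] by metis
qed

end


section \<open>Self-injectivity\<close>

context root_ring
begin

section \<open>P is local and uniserial with a simple socle\<close>

lemma one_not_zero' [simp]: "\<one> \<noteq> \<zero>"
  using T_0 T_eq_zero_iff[of 0] by auto

lemma nonunit_T:
  assumes "r \<in> carrier R" "r \<notin> Units R"
  obtains a c where "0 < a" "c \<in> carrier R" "r = T a \<otimes> c"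
proof (cases "r = \<zero>")
  case True
  \<comment> \<open>Zero is covered by the exponent 2, since powers beyond 1 vanish.\<close>
  then show ?thesis using that[of 2 \<one>] T_eq_zero_iff[of 2] by simp
next
  case False
  with unit_T_decomp assms(1) obtain u a where ua: "u \<in> Units R" "0 \<le> a" "r = u \<otimes> T a" by blast
  have "a \<noteq> 0" using ua assms(2) T_0 by auto
  then show ?thesis using that[of a u] ua m_comm[of u "T a"] by auto
qed

lemma T_pow: "0 \<le> a \<Longrightarrow> T a [^] (n::nat) = T (real n * a)"
proof (induction n)
  case 0 show ?case by (simp add: T_0)
next
  case (Suc n)
  then show ?case using T_add[of "real n * a" a] by (simp add: algebra_simps)
qed

text \<open>Some multiple of \<open>a\<close> exceeds 1, so the element is nilpotent, whereas the
  product of a unit with its inverse stays 1 in every power.\<close>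

lemma T_mult_not_unit:
  assumes "0 < a" "c \<in> carrier R" shows "T a \<otimes> c \<notin> Units R"
proof
  assume u: "T a \<otimes> c \<in> Units R"
  obtain n :: nat where "1 < real n * a" using \<open>0 < a\<close> ex_less_of_nat_mult by blast
  then have "T a [^] n = \<zero>" using assms T_pow[of a n] T_eq_zero_iff[of "real n * a"] by simp
  then have z: "(T a \<otimes> c) [^] n = \<zero>" using assms by (simp add: nat_pow_distrib)
  have c: "T a \<otimes> c \<in> carrier R" "inv (T a \<otimes> c) \<in> carrier R" using u assms by simp_all
  have "(inv (T a \<otimes> c) \<otimes> (T a \<otimes> c)) [^] n = inv (T a \<otimes> c) [^] n \<otimes> (T a \<otimes> c) [^] n"
    by (rule nat_pow_distrib[OF c(2,1)])
  then show False using z c u by simp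
qed

text \<open>Locality: two nonunits share the factor \<open>T a\<close> for the smaller of their
  positive exponents, and so does their sum.\<close>

lemma nonunit_add:
  assumes r: "r \<in> carrier R" "r \<notin> Units R" and s: "s \<in> carrier R" "s \<notin> Units R"
  shows "r \<oplus> s \<notin> Units R"
proof -
  have *: "T a \<otimes> c \<oplus> T b \<otimes> d \<notin> Units R" if "0 < a" "a \<le> b" "c \<in> carrier R" "d \<in> carrier R" for a b c d
  proof -
    have "T b = T a \<otimes> T (b - a)" using T_add[of a "b - a"] that by simp
    then have "T a \<otimes> c \<oplus> T b \<otimes> d = T a \<otimes> (c \<oplus> T (b - a) \<otimes> d)"
      using that by (simp add: r_distr m_assoc)
    then show ?thesis using T_mult_not_unit[of a "c \<oplus> T (b - a) \<otimes> d"] that by simp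
  qed
  obtain a c where a: "0 < a" "c \<in> carrier R" "r = T a \<otimes> c" by (rule nonunit_T[OF r])
  obtain b d where b: "0 < b" "d \<in> carrier R" "s = T b \<otimes> d" by (rule nonunit_T[OF s])
  show ?thesis
  proof (cases "a \<le> b")
    case True then show ?thesis using *[of a b c d] a b by simp
  next
    case False
    then show ?thesis using *[of b a d c] a b a_comm[of "T a \<otimes> c" "T b \<otimes> d"] by simp
  qed
qed

text \<open>Up to units divisibility is the reverse order of the exponents. This is the uniserial
  property of the ring from which the chain arguments come.\<close>

lemma dvd_total:
  assumes r: "r \<in> carrier R" and s: "s \<in> carrier R"
  shows "(\<exists>c\<in>carrier R. r = c \<otimes> s) \<or> (\<exists>c\<in>carrier R. s = c \<otimes> r)"
proof -
  have *: "\<exists>c\<in>carrier R. u \<otimes> T a = c \<otimes> (v \<otimes> T b)"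
    if "u \<in> Units R" "v \<in> Units R" "0 \<le> b" "b \<le> a" for u v a b
  proof
    have uv: "u \<in> carrier R" "v \<in> carrier R" "inv v \<in> carrier R" using that by auto
    have "u \<otimes> T (a - b) \<otimes> inv v \<otimes> (v \<otimes> T b) = u \<otimes> (T (a - b) \<otimes> T b) \<otimes> (inv v \<otimes> v)"
      using uv that by (simp add: m_ac del: Units_l_inv Units_r_inv)
    also have "\<dots> = u \<otimes> T a" using that uv T_add[of "a - b" b] by simp
    finally show "u \<otimes> T a = u \<otimes> T (a - b) \<otimes> inv v \<otimes> (v \<otimes> T b)" by simp
    show "u \<otimes> T (a - b) \<otimes> inv v \<in> carrier R" using uv that by simp
  qed
  show ?thesis
  proof (cases "r = \<zero> \<or> s = \<zero>")
    case True
    then have "r = \<zero> \<otimes> s \<or> s = \<zero> \<otimes> r" using r s by auto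
    then show ?thesis by blast
  next
    case False
    then obtain u a v b where "u \<in> Units R" "0 \<le> a" "r = u \<otimes> T a" "v \<in> Units R" "0 \<le> b" "s = v \<otimes> T b"
      using unit_T_decomp r s by metis
    then show ?thesis using *[of u v b a] *[of v u a b] by (cases "a \<le> b") auto
  qed
qed

text \<open>Multiplication by \<open>T (1 - b)\<close> moves s = u T b to a unit multiple of the
  bottom power \<open>T 1\<close>. The result is nonzero, but any further positive exponent passes
  the cutoff.\<close>

lemma socle_multiplier:
  assumes s: "s \<in> carrier R" "s \<noteq> \<zero>"
  obtains c where "c \<in> carrier R" "c \<otimes> s \<noteq> \<zero>"
    "\<And>d. d \<in> carrier R \<Longrightarrow> d \<notin> Units R \<Longrightarrow> c \<otimes> (d \<otimes> s) = \<zero>"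
proof -
  obtain u b where b: "u \<in> Units R" "0 \<le> b" "b \<le> 1" "s = u \<otimes> T b" using unit_T_decomp s by blast
  have u: "u \<in> carrier R" using b(1) by (rule Units_closed)
  have s1: "T (1 - b) \<otimes> s = u \<otimes> T 1" using b u T_add[of "1 - b" b] by (simp add: m_lcomm)
  show ?thesis
  proof (rule that[of "T (1 - b)"])
    show "T (1 - b) \<in> carrier R" using b by simp
    show "T (1 - b) \<otimes> s \<noteq> \<zero>"
    proof
      assume "T (1 - b) \<otimes> s = \<zero>"
      then have uz: "u \<otimes> T 1 = \<zero>" using s1 by simp
      have "T 1 = inv u \<otimes> (u \<otimes> T 1)" using b(1) u by (simp add: m_assoc[symmetric])
      also have "\<dots> = \<zero>" using uz b(1) by simp
      finally show False using T_eq_zero_iff[of 1] by simp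
    qed
    fix d assume "d \<in> carrier R" "d \<notin> Units R"
    then obtain a e where d: "0 < a" "e \<in> carrier R" "d = T a \<otimes> e" by (rule nonunit_T)
    have "T (1 - b) \<otimes> (d \<otimes> s) = d \<otimes> (T (1 - b) \<otimes> s)"
      using \<open>d \<in> carrier R\<close> s b by (simp add: m_lcomm)
    also have "\<dots> = e \<otimes> u \<otimes> (T a \<otimes> T 1)"
      using s1 d u by (simp add: m_ac)
    also have "\<dots> = \<zero>" using d u T_add[of a 1] T_eq_zero_iff[of "a + 1"] by simp
    finally show "T (1 - b) \<otimes> (d \<otimes> s) = \<zero>" .
  qed
qed

text \<open>This is the strict side of the comparison: with a unit as cofactor, \<open>s\<close>
  would be a multiple of \<open>r\<close>.\<close>

lemma proper_multiple:
  assumes r: "r \<in> carrier R" and s: "s \<in> carrier R" and n: "\<And>p. p \<in> carrier R \<Longrightarrow> s \<noteq> p \<otimes> r"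
  obtains c where "c \<in> carrier R" "c \<notin> Units R" "r = c \<otimes> s"
proof -
  from n dvd_total[OF r s] obtain c where c: "c \<in> carrier R" "r = c \<otimes> s" by blast
  have "c \<notin> Units R"
  proof
    assume "c \<in> Units R"
    then have "s = inv c \<otimes> r" using c s by (simp add: m_assoc[symmetric])
    with n \<open>c \<in> Units R\<close> show False by blast
  qed
  with c that show ?thesis by blast
qed

text \<open>Double annihilator condition for principal ideals. If \<open>s\<close> were no multiple
  of \<open>r\<close>, then r = d s with d a nonunit, and the socle multiplier of \<open>s\<close>
  kills \<open>r\<close> but not \<open>s\<close>.\<close>

lemma ann_imp_dvd:
  assumes r: "r \<in> carrier R" and s: "s \<in> carrier R"
    and ann: "\<And>c. c \<in> carrier R \<Longrightarrow> c \<otimes> r = \<zero> \<Longrightarrow> c \<otimes> s = \<zero>"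
  shows "\<exists>p\<in>carrier R. s = p \<otimes> r"
proof (rule ccontr)
  assume n: "\<not> ?thesis"
  then obtain d where d: "d \<in> carrier R" "d \<notin> Units R" "r = d \<otimes> s"
    using proper_multiple[OF r s] by blast
  have "s \<noteq> \<zero>" using n r by (metis l_null zero_closed)
  then obtain c where "c \<in> carrier R" "c \<otimes> s \<noteq> \<zero>" "c \<otimes> (d \<otimes> s) = \<zero>"
    using socle_multiplier[OF s] d by metis
  with ann d show False by blast
qed

lemma regular_module_sel [simp]:
  "carrier (regular_module R) = carrier R" "add (regular_module R) = add R"
  "smult (regular_module R) = monoid.mult R" "\<zero>\<^bsub>regular_module R\<^esub> = \<zero>"
  by (simp_all add: regular_module_def)

text \<open>Baer's criterion, where the ideal may fail to be principal. For each r the admissible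
  multipliers form a nonempty coset \<open>C r\<close> by the double annihilator condition. Total
  divisibility makes these cosets nested, and linear compactness of the ring picks a common
  multiplier.\<close>

lemma baer:
  assumes J: "J \<subseteq> carrier R" "\<And>c r. c \<in> carrier R \<Longrightarrow> r \<in> J \<Longrightarrow> c \<otimes> r \<in> J"
    and g: "\<And>r. r \<in> J \<Longrightarrow> g r \<in> carrier R" "\<And>c r. c \<in> carrier R \<Longrightarrow> r \<in> J \<Longrightarrow> g (c \<otimes> r) = c \<otimes> g r"
    and z: "\<And>r. r \<in> J \<Longrightarrow> r = \<zero> \<Longrightarrow> g r = \<zero>"
  shows "\<exists>p\<in>carrier R. \<forall>r\<in>J. g r = r \<otimes> p"
proof -
  define C where "C r = {p \<in> carrier R. r \<otimes> p = g r}" for r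
  have ne: "C r \<noteq> {}" if r: "r \<in> J" for r
  proof -
    have "c \<otimes> g r = \<zero>" if "c \<in> carrier R" "c \<otimes> r = \<zero>" for c
      using that r J g z by metis
    then obtain p where "p \<in> carrier R" "g r = p \<otimes> r" using ann_imp_dvd[of r "g r"] r J g by blast
    moreover from this have "g r = r \<otimes> p" using r J m_comm by auto
    ultimately show ?thesis unfolding C_def by auto
  qed
  \<comment> \<open>A multiplier for r works for all multiples of r, so of two comparable elements
    the divisor has the smaller coset.\<close>
  have sub: "C r \<subseteq> C (c \<otimes> r)" if "r \<in> J" "c \<in> carrier R" for c r
    using that J g unfolding C_def by (auto simp: m_assoc)
  have "\<exists>E\<in>C ` J. E \<subseteq> C r \<inter> C s" if "r \<in> J" "s \<in> J" for r s
  proof -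
    from that J have "(\<exists>c\<in>carrier R. r = c \<otimes> s) \<or> (\<exists>c\<in>carrier R. s = c \<otimes> r)"
      by (intro dvd_total) auto
    then show ?thesis using sub that by blast
  qed
  then have "down_directed (C ` J)" unfolding down_directed_def by blast
  moreover have "affine_subset R (regular_module R) (C r)" if r: "r \<in> J" for r
    unfolding affine_subset_def
  proof (intro conjI ballI)
    fix x y z c assume "x \<in> C r" "y \<in> C r" "z \<in> C r" "c \<in> carrier R"
    moreover have "r \<in> carrier R" using r J by blast
    moreover from calculation have "r \<otimes> (x \<oplus> (c \<otimes> y \<oplus> (\<ominus> c) \<otimes> z)) = r \<otimes> x \<oplus> (c \<otimes> (r \<otimes> y) \<oplus> \<ominus> (c \<otimes> (r \<otimes> z)))"
      unfolding C_def mem_Collect_eq by algebra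
    ultimately show "x \<oplus>\<^bsub>regular_module R\<^esub> (c \<odot>\<^bsub>regular_module R\<^esub> y \<oplus>\<^bsub>regular_module R\<^esub> (\<ominus> c) \<odot>\<^bsub>regular_module R\<^esub> z) \<in> C r"
      using r J g unfolding C_def by (simp add: r_neg a_minus_def)
  qed (use ne r in blast)
  ultimately obtain p where "p \<in> carrier R" "\<forall>D\<in>C ` J. p \<in> D"
    using ring_linearly_compact C_def unfolding linearly_compact_def
    by (elim allE[of _ "C ` J"]) auto
  then show ?thesis unfolding C_def by (intro bexI[of _ p]) auto
qed

end

section \<open>Submodules and cosets in terms of differences\<close>

lemma (in abelian_group) minus_eq_zero_iff [simp]:
  "x \<in> carrier G \<Longrightarrow> y \<in> carrier G \<Longrightarrow> x \<ominus> y = \<zero> \<longleftrightarrow> x = y"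
  using minus_equality[of x "\<ominus> y"] by (auto simp: a_minus_def r_neg)

lemma (in abelian_group) minus_self [simp]: "x \<in> carrier G \<Longrightarrow> x \<ominus> x = \<zero>"
  by simp

context Module.module
begin

lemma
  assumes "submodule N R M"
  shows submodule_carrier: "x \<in> N \<Longrightarrow> x \<in> carrier M"
    and submodule_zero: "\<zero>\<^bsub>M\<^esub> \<in> N"
    and submodule_add: "x \<in> N \<Longrightarrow> y \<in> N \<Longrightarrow> x \<oplus>\<^bsub>M\<^esub> y \<in> N"
    and submodule_neg: "x \<in> N \<Longrightarrow> \<ominus>\<^bsub>M\<^esub> x \<in> N"
    and submodule_minus: "x \<in> N \<Longrightarrow> y \<in> N \<Longrightarrow> x \<ominus>\<^bsub>M\<^esub> y \<in> N"
    and submodule_smult: "r \<in> carrier R \<Longrightarrow> x \<in> N \<Longrightarrow> r \<odot>\<^bsub>M\<^esub> x \<in> N"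
proof -
  note E = submoduleE[OF assms]
  show "x \<in> N \<Longrightarrow> x \<in> carrier M" "x \<in> N \<Longrightarrow> y \<in> N \<Longrightarrow> x \<oplus>\<^bsub>M\<^esub> y \<in> N" "x \<in> N \<Longrightarrow> \<ominus>\<^bsub>M\<^esub> x \<in> N"
    "r \<in> carrier R \<Longrightarrow> x \<in> N \<Longrightarrow> r \<odot>\<^bsub>M\<^esub> x \<in> N" using E by auto
  show "x \<in> N \<Longrightarrow> y \<in> N \<Longrightarrow> x \<ominus>\<^bsub>M\<^esub> y \<in> N" using E by (simp add: a_minus_def)
  from E(2) obtain y where "y \<in> N" by blast
  then have "y \<oplus>\<^bsub>M\<^esub> (\<ominus>\<^bsub>M\<^esub> y) \<in> N" "y \<in> carrier M" using E by blast+
  then show "\<zero>\<^bsub>M\<^esub> \<in> N" by (simp add: M.r_neg)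
qed

lemmas submodule_simps = submodule_carrier submodule_zero submodule_add submodule_neg
  submodule_minus submodule_smult

lemma submoduleI':
  assumes "H \<subseteq> carrier M" "\<zero>\<^bsub>M\<^esub> \<in> H" "\<And>a b. a \<in> H \<Longrightarrow> b \<in> H \<Longrightarrow> a \<oplus>\<^bsub>M\<^esub> b \<in> H"
    "\<And>a x. a \<in> carrier R \<Longrightarrow> x \<in> H \<Longrightarrow> a \<odot>\<^bsub>M\<^esub> x \<in> H"
  shows "submodule H R M"
proof (rule submoduleI)
  fix a assume a: "a \<in> H"
  then have "(\<ominus> \<one>) \<odot>\<^bsub>M\<^esub> a \<in> H" using assms by simp
  then show "\<ominus>\<^bsub>M\<^esub> a \<in> H" using a assms(1) smult_l_minus[of \<one> a] by auto
qed (use assms in auto)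

lemma zero_submodule: "submodule {\<zero>\<^bsub>M\<^esub>} R M"
  by (rule submoduleI') auto

lemma smult_minus_distr:
  "r \<in> carrier R \<Longrightarrow> x \<in> carrier M \<Longrightarrow> y \<in> carrier M \<Longrightarrow>
    r \<odot>\<^bsub>M\<^esub> (x \<ominus>\<^bsub>M\<^esub> y) = r \<odot>\<^bsub>M\<^esub> x \<ominus>\<^bsub>M\<^esub> r \<odot>\<^bsub>M\<^esub> y"
  by (simp add: a_minus_def smult_r_distr smult_r_minus)

lemma smult_minus_l_distr:
  "r \<in> carrier R \<Longrightarrow> s \<in> carrier R \<Longrightarrow> x \<in> carrier M \<Longrightarrow>
    (r \<ominus> s) \<odot>\<^bsub>M\<^esub> x = r \<odot>\<^bsub>M\<^esub> x \<ominus>\<^bsub>M\<^esub> s \<odot>\<^bsub>M\<^esub> x"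
  by (simp add: a_minus_def smult_l_distr smult_l_minus)

lemma affine_subset_iff:
  assumes "C \<subseteq> carrier M"
  shows "affine_subset R M C \<longleftrightarrow> C \<noteq> {} \<and>
    (\<forall>x\<in>C. \<forall>y\<in>C. \<forall>z\<in>C. \<forall>r\<in>carrier R. x \<oplus>\<^bsub>M\<^esub> r \<odot>\<^bsub>M\<^esub> (y \<ominus>\<^bsub>M\<^esub> z) \<in> C)"
proof -
  have "r \<odot>\<^bsub>M\<^esub> (y \<ominus>\<^bsub>M\<^esub> z) = r \<odot>\<^bsub>M\<^esub> y \<oplus>\<^bsub>M\<^esub> (\<ominus> r) \<odot>\<^bsub>M\<^esub> z"
    if "r \<in> carrier R" "y \<in> C" "z \<in> C" for r y z
    using that assms by (auto simp: a_minus_def smult_r_distr smult_r_minus smult_l_minus subset_iff)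
  then show ?thesis by (simp add: affine_subset_def)
qed

end

section \<open>Extension of functionals: P is an injective cogenerator\<close>

locale root_module = Module.module R M + root_ring R T
  for R (structure) and T and M (structure)
begin

text \<open>Graphs of partial linear functionals. As sets of pairs they are ordered by inclusion, so
  Zorn's lemma works with plain unions; by linearity single-valuedness need only be asked at
  zero.\<close>

definition linear_graph :: "('c \<times> 'a) set \<Rightarrow> bool" where
  "linear_graph G \<longleftrightarrow> G \<subseteq> carrier M \<times> carrier R \<and>
     (\<forall>x r y s. (x, r) \<in> G \<longrightarrow> (y, s) \<in> G \<longrightarrow> (x \<oplus>\<^bsub>M\<^esub> y, r \<oplus> s) \<in> G) \<and>
     (\<forall>c\<in>carrier R. \<forall>x r. (x, r) \<in> G \<longrightarrow> (c \<odot>\<^bsub>M\<^esub> x, c \<otimes> r) \<in> G) \<and>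
     (\<forall>r. (\<zero>\<^bsub>M\<^esub>, r) \<in> G \<longrightarrow> r = \<zero>)"

lemma linear_graphD:
  assumes "linear_graph G"
  shows "(x, r) \<in> G \<Longrightarrow> x \<in> carrier M" "(x, r) \<in> G \<Longrightarrow> r \<in> carrier R"
    "(x, r) \<in> G \<Longrightarrow> (y, s) \<in> G \<Longrightarrow> (x \<oplus>\<^bsub>M\<^esub> y, r \<oplus> s) \<in> G"
    "c \<in> carrier R \<Longrightarrow> (x, r) \<in> G \<Longrightarrow> (c \<odot>\<^bsub>M\<^esub> x, c \<otimes> r) \<in> G"
    "(\<zero>\<^bsub>M\<^esub>, r) \<in> G \<Longrightarrow> r = \<zero>"
  using assms unfolding linear_graph_def by blast+

lemma linear_graph_unique:
  assumes G: "linear_graph G" and r: "(x, r) \<in> G" and s: "(x, s) \<in> G"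
  shows "r = s"
proof -
  note D = linear_graphD[OF G]
  have c: "x \<in> carrier M" "r \<in> carrier R" "s \<in> carrier R" using D r s by blast+
  have "(x \<oplus>\<^bsub>M\<^esub> (\<ominus> \<one>) \<odot>\<^bsub>M\<^esub> x, r \<oplus> (\<ominus> \<one>) \<otimes> s) \<in> G" using D(3)[OF r D(4)[OF _ s]] by simp
  then have "(\<zero>\<^bsub>M\<^esub>, r \<oplus> (\<ominus> s)) \<in> G" using c by (simp add: smult_l_minus l_minus M.r_neg)
  then have "r \<oplus> (\<ominus> s) = \<zero>" by (rule D(5))
  then show ?thesis using R.minus_equality[of r "\<ominus> s"] c by simp
qed

text \<open>The scalars that take x into the domain form an ideal, and the old graph gives a linear
  map on it. By Baer's criterion that map is multiplication by some p, which can serve as the value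
  at x.\<close>

lemma linear_graph_extend:
  assumes G: "linear_graph G" and ne: "(\<zero>\<^bsub>M\<^esub>, \<zero>) \<in> G" and x: "x \<in> carrier M"
  obtains G' p where "linear_graph G'" "G \<subseteq> G'" "(x, p) \<in> G'"
proof -
  note D = linear_graphD[OF G]
  define J where "J = {r \<in> carrier R. \<exists>s. (r \<odot>\<^bsub>M\<^esub> x, s) \<in> G}"
  define g where "g r = (SOME s. (r \<odot>\<^bsub>M\<^esub> x, s) \<in> G)" for r
  have g: "(r \<odot>\<^bsub>M\<^esub> x, g r) \<in> G" if "r \<in> J" for r
    using that unfolding J_def g_def by (auto intro: someI)
  have "\<exists>p\<in>carrier R. \<forall>r\<in>J. g r = r \<otimes> p"
  proof (rule baer)
    fix c r assume c: "c \<in> carrier R" and r: "r \<in> J"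
    then have rR: "r \<in> carrier R" by (simp add: J_def)
    have cr: "((c \<otimes> r) \<odot>\<^bsub>M\<^esub> x, c \<otimes> g r) \<in> G"
      using D(4)[OF c g[OF r]] c rR x by (simp add: smult_assoc1)
    then show J': "c \<otimes> r \<in> J" unfolding J_def using c rR by auto
    show "g (c \<otimes> r) = c \<otimes> g r" by (rule linear_graph_unique[OF G g[OF J'] cr])
  next
    fix r assume "r \<in> J" "r = \<zero>"
    then show "g r = \<zero>" using g[of r] D(5)[of "g r"] x by simp
  next
    show "J \<subseteq> carrier R" by (auto simp: J_def)
    show "g r \<in> carrier R" if "r \<in> J" for r using D(2) g[OF that] by blast
  qed
  then obtain p where p: "p \<in> carrier R" "\<And>r. r \<in> J \<Longrightarrow> g r = r \<otimes> p" by blast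
  define G' where "G' = {(y \<oplus>\<^bsub>M\<^esub> c \<odot>\<^bsub>M\<^esub> x, s \<oplus> c \<otimes> p) |y s c. (y, s) \<in> G \<and> c \<in> carrier R}"
  have "linear_graph G'" unfolding linear_graph_def
  proof (intro conjI allI ballI impI)
    show "G' \<subseteq> carrier M \<times> carrier R" unfolding G'_def using D(1,2) x p by auto
  next
    fix a r b s assume "(a, r) \<in> G'" "(b, s) \<in> G'"
    then obtain y u c z v d where 1: "a = y \<oplus>\<^bsub>M\<^esub> c \<odot>\<^bsub>M\<^esub> x" "r = u \<oplus> c \<otimes> p" "(y, u) \<in> G" "c \<in> carrier R"
      "b = z \<oplus>\<^bsub>M\<^esub> d \<odot>\<^bsub>M\<^esub> x" "s = v \<oplus> d \<otimes> p" "(z, v) \<in> G" "d \<in> carrier R"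
      unfolding G'_def by blast
    then have cl: "y \<in> carrier M" "u \<in> carrier R" "z \<in> carrier M" "v \<in> carrier R" using D(1,2) by blast+
    have "a \<oplus>\<^bsub>M\<^esub> b = (y \<oplus>\<^bsub>M\<^esub> z) \<oplus>\<^bsub>M\<^esub> (c \<oplus> d) \<odot>\<^bsub>M\<^esub> x" "r \<oplus> s = (u \<oplus> v) \<oplus> (c \<oplus> d) \<otimes> p"
      using 1 cl x p by (simp_all add: smult_l_distr l_distr M.a_ac R.a_ac)
    then show "(a \<oplus>\<^bsub>M\<^esub> b, r \<oplus> s) \<in> G'"
      unfolding G'_def mem_Collect_eq using D(3)[OF 1(3,7)] 1(4,8) by blast
  next
    fix k a r assume k: "k \<in> carrier R" and "(a, r) \<in> G'"
    then obtain y u c where 1: "a = y \<oplus>\<^bsub>M\<^esub> c \<odot>\<^bsub>M\<^esub> x" "r = u \<oplus> c \<otimes> p" "(y, u) \<in> G" "c \<in> carrier R"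
      unfolding G'_def by blast
    then have cl: "y \<in> carrier M" "u \<in> carrier R" using D(1,2) by blast+
    have "k \<odot>\<^bsub>M\<^esub> a = k \<odot>\<^bsub>M\<^esub> y \<oplus>\<^bsub>M\<^esub> (k \<otimes> c) \<odot>\<^bsub>M\<^esub> x" "k \<otimes> r = k \<otimes> u \<oplus> (k \<otimes> c) \<otimes> p"
      using 1 cl x p k by (simp_all add: smult_r_distr r_distr smult_assoc1 m_assoc)
    then show "(k \<odot>\<^bsub>M\<^esub> a, k \<otimes> r) \<in> G'"
      unfolding G'_def mem_Collect_eq using D(4)[OF k 1(3)] 1(4) k by blast
  next
    fix r assume "(\<zero>\<^bsub>M\<^esub>, r) \<in> G'"
    then obtain y u c where 1: "\<zero>\<^bsub>M\<^esub> = y \<oplus>\<^bsub>M\<^esub> c \<odot>\<^bsub>M\<^esub> x" "r = u \<oplus> c \<otimes> p" "(y, u) \<in> G" "c \<in> carrier R"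
      unfolding G'_def by blast
    then have cl: "y \<in> carrier M" "u \<in> carrier R" using D(1,2) by blast+
    \<comment> \<open>A relation y + c x = 0 puts c into the ideal, so that c p is already the old
      value at c x, namely -u.\<close>
    have cx: "c \<odot>\<^bsub>M\<^esub> x = \<ominus>\<^bsub>M\<^esub> y"
      using M.minus_equality[of "c \<odot>\<^bsub>M\<^esub> x" y] 1 cl x by (simp add: M.a_comm)
    have "((\<ominus> \<one>) \<odot>\<^bsub>M\<^esub> y, (\<ominus> \<one>) \<otimes> u) \<in> G" using D(4)[OF _ 1(3)] by simp
    then have "(c \<odot>\<^bsub>M\<^esub> x, \<ominus> u) \<in> G" using cl cx by (simp add: smult_l_minus l_minus)
    moreover from this have "c \<in> J" unfolding J_def using 1 by blast
    ultimately have "\<ominus> u = c \<otimes> p" using g[of c] linear_graph_unique[OF G] p by metis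
    then show "r = \<zero>" using 1 cl by (metis R.r_neg)
  qed
  moreover have "G \<subseteq> G'"
  proof
    fix w assume "w \<in> G"
    moreover obtain y s where w: "w = (y, s)" by fastforce
    ultimately have "w = (y \<oplus>\<^bsub>M\<^esub> \<zero> \<odot>\<^bsub>M\<^esub> x, s \<oplus> \<zero> \<otimes> p)" using D(1,2) x p by simp
    then show "w \<in> G'" unfolding G'_def mem_Collect_eq using \<open>w \<in> G\<close> w
      by (intro exI[of _ y] exI[of _ s] exI[of _ \<zero>]) simp
  qed
  moreover have "(x, p) \<in> G'"
  proof -
    have "(x, p) = (\<zero>\<^bsub>M\<^esub> \<oplus>\<^bsub>M\<^esub> \<one> \<odot>\<^bsub>M\<^esub> x, \<zero> \<oplus> \<one> \<otimes> p)" using x p by simp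
    then show ?thesis unfolding G'_def mem_Collect_eq using ne
      by (intro exI[of _ "\<zero>\<^bsub>M\<^esub>"] exI[of _ \<zero>] exI[of _ \<one>]) simp
  qed
  ultimately show ?thesis by (rule that)
qed

text \<open>By Zorn's lemma there is a maximal graph; the one-element extension shows that it is
  defined everywhere.\<close>

lemma linear_graph_total:
  assumes "linear_graph G" "(\<zero>\<^bsub>M\<^esub>, \<zero>) \<in> G"
  obtains H where "linear_graph H" "G \<subseteq> H" "\<And>x. x \<in> carrier M \<Longrightarrow> \<exists>r. (x, r) \<in> H"
proof -
  let ?A = "{H. linear_graph H \<and> G \<subseteq> H}"
  have "\<exists>H\<in>?A. \<forall>X\<in>?A. H \<subseteq> X \<longrightarrow> X = H"
  proof (rule subset_Zorn_nonempty)
    show "?A \<noteq> {}" using assms by blast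
    fix C assume C: "C \<noteq> {}" "subset.chain ?A C"
    have lg: "\<And>H. H \<in> C \<Longrightarrow> linear_graph H" using C unfolding subset_chain_def by blast
    have ch: "\<And>H K. H \<in> C \<Longrightarrow> K \<in> C \<Longrightarrow> H \<subseteq> K \<or> K \<subseteq> H" using C unfolding subset_chain_def by blast
    have "linear_graph (\<Union>C)" unfolding linear_graph_def
    proof (intro conjI allI ballI impI)
      show "\<Union>C \<subseteq> carrier M \<times> carrier R" using lg unfolding linear_graph_def by blast
    next
      fix x r y s assume "(x, r) \<in> \<Union>C" "(y, s) \<in> \<Union>C"
      then obtain H K where "H \<in> C" "(x, r) \<in> H" "K \<in> C" "(y, s) \<in> K" by blast
      with ch[of H K] show "(x \<oplus>\<^bsub>M\<^esub> y, r \<oplus> s) \<in> \<Union>C" by (meson UnionI linear_graphD(3) lg subsetD)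
    next
      fix c x r assume "c \<in> carrier R" "(x, r) \<in> \<Union>C"
      then show "(c \<odot>\<^bsub>M\<^esub> x, c \<otimes> r) \<in> \<Union>C" by (meson UnionE UnionI linear_graphD(4) lg)
    next
      fix r assume "(\<zero>\<^bsub>M\<^esub>, r) \<in> \<Union>C"
      then show "r = \<zero>" by (meson UnionE linear_graphD(5) lg)
    qed
    moreover have "G \<subseteq> \<Union>C" using C unfolding subset_chain_def by blast
    ultimately show "\<Union>C \<in> ?A" by blast
  qed
  then obtain H where HA: "H \<in> ?A" and max: "\<forall>X\<in>?A. H \<subseteq> X \<longrightarrow> X = H" ..
  have H: "linear_graph H" "G \<subseteq> H" using HA by auto
  have "\<exists>r. (x, r) \<in> H" if x: "x \<in> carrier M" for x
  proof -
    have "(\<zero>\<^bsub>M\<^esub>, \<zero>) \<in> H" using H assms by blast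
    from linear_graph_extend[OF H(1) this x] obtain H' p
      where "linear_graph H'" "H \<subseteq> H'" "(x, p) \<in> H'" .
    then have "H' = H" using max H(2) by blast
    with \<open>(x, p) \<in> H'\<close> show ?thesis by blast
  qed
  from that[OF H this] show ?thesis .
qed

text \<open>Injectivity of P over itself, applied to the graph of \<open>h\<close>.\<close>

lemma extend_functional:
  assumes K: "submodule K R M"
    and h: "\<And>x. x \<in> K \<Longrightarrow> h x \<in> carrier R" "\<And>x y. x \<in> K \<Longrightarrow> y \<in> K \<Longrightarrow> h (x \<oplus>\<^bsub>M\<^esub> y) = h x \<oplus> h y"
      "\<And>c x. c \<in> carrier R \<Longrightarrow> x \<in> K \<Longrightarrow> h (c \<odot>\<^bsub>M\<^esub> x) = c \<otimes> h x"
  obtains \<alpha> where "\<alpha> \<in> carrier (dual_module R M)" "\<And>x. x \<in> K \<Longrightarrow> \<alpha> x = h x"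
proof -
  note S = submodule_simps[OF K]
  have h0: "h \<zero>\<^bsub>M\<^esub> = \<zero>" using h(3)[of \<zero> "\<zero>\<^bsub>M\<^esub>"] S h(1) by simp
  let ?G = "{(x, h x) |x. x \<in> K}"
  have "linear_graph ?G" unfolding linear_graph_def
    using S h h0 by auto
  moreover have "(\<zero>\<^bsub>M\<^esub>, \<zero>) \<in> ?G" using h0 S by force
  ultimately obtain H where H: "linear_graph H" "?G \<subseteq> H" "\<And>x. x \<in> carrier M \<Longrightarrow> \<exists>r. (x, r) \<in> H"
    by (rule linear_graph_total) blast
  note D = linear_graphD[OF H(1)] and U = linear_graph_unique[OF H(1)]
  define \<alpha> where "\<alpha> = (\<lambda>x\<in>carrier M. THE r. (x, r) \<in> H)"
  have the: "\<alpha> x = r" if "(x, r) \<in> H" for x r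
    using that D(1) U unfolding \<alpha>_def by (auto intro!: the_equality)
  have mem: "(x, \<alpha> x) \<in> H" if "x \<in> carrier M" for x
    using H(3)[OF that] the by auto
  have "\<alpha> \<in> carrier (dual_module R M)"
    unfolding dual_module_def module_hom_def
  proof (simp, intro conjI ballI)
    have "\<alpha> \<in> extensional (carrier M)" unfolding \<alpha>_def by simp
    then show "\<alpha> \<in> carrier M \<rightarrow>\<^sub>E carrier R" using mem D(2) by (auto simp: PiE_def)
  next
    fix x y assume "x \<in> carrier M" "y \<in> carrier M"
    then show "\<alpha> (x \<oplus>\<^bsub>M\<^esub> y) = \<alpha> x \<oplus> \<alpha> y" using D(3) mem the by blast
  next
    fix r x assume "r \<in> carrier R" "x \<in> carrier M"
    then show "\<alpha> (r \<odot>\<^bsub>M\<^esub> x) = r \<otimes> \<alpha> x" using D(4) mem the by blast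
  qed
  moreover have "\<alpha> x = h x" if "x \<in> K" for x
    using H(2) the that by blast
  ultimately show ?thesis by (rule that)
qed

text \<open>Cogenerator property. Sending x to \<open>T 1\<close> and N to 0 is well defined on N +
  P x: if c x lies in N, then c is no unit, and nonunits kill \<open>T 1\<close>.\<close>

lemma separating_functional:
  assumes N: "submodule N R M" and x: "x \<in> carrier M" "x \<notin> N"
  obtains \<alpha> where "\<alpha> \<in> carrier (dual_module R M)" "\<And>y. y \<in> N \<Longrightarrow> \<alpha> y = \<zero>" "\<alpha> x \<noteq> \<zero>"
proof -
  note S = submodule_simps[OF N]
  let ?G = "{(y \<oplus>\<^bsub>M\<^esub> c \<odot>\<^bsub>M\<^esub> x, c \<otimes> T 1) |y c. y \<in> N \<and> c \<in> carrier R}"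
  have "linear_graph ?G" unfolding linear_graph_def
  proof (intro conjI allI ballI impI)
    show "?G \<subseteq> carrier M \<times> carrier R" using S x by auto
  next
    fix a r b s assume "(a, r) \<in> ?G" "(b, s) \<in> ?G"
    then obtain y c z d where 1: "a = y \<oplus>\<^bsub>M\<^esub> c \<odot>\<^bsub>M\<^esub> x" "r = c \<otimes> T 1" "y \<in> N" "c \<in> carrier R"
      "b = z \<oplus>\<^bsub>M\<^esub> d \<odot>\<^bsub>M\<^esub> x" "s = d \<otimes> T 1" "z \<in> N" "d \<in> carrier R" by blast
    then have "a \<oplus>\<^bsub>M\<^esub> b = (y \<oplus>\<^bsub>M\<^esub> z) \<oplus>\<^bsub>M\<^esub> (c \<oplus> d) \<odot>\<^bsub>M\<^esub> x" "r \<oplus> s = (c \<oplus> d) \<otimes> T 1"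
      using S x by (simp_all add: smult_l_distr l_distr M.a_ac)
    then show "(a \<oplus>\<^bsub>M\<^esub> b, r \<oplus> s) \<in> ?G"
      unfolding mem_Collect_eq using S(3)[OF 1(3,7)] 1(4,8) by blast
  next
    fix k a r assume k: "k \<in> carrier R" and "(a, r) \<in> ?G"
    then obtain y c where 1: "a = y \<oplus>\<^bsub>M\<^esub> c \<odot>\<^bsub>M\<^esub> x" "r = c \<otimes> T 1" "y \<in> N" "c \<in> carrier R" by blast
    then have "k \<odot>\<^bsub>M\<^esub> a = k \<odot>\<^bsub>M\<^esub> y \<oplus>\<^bsub>M\<^esub> (k \<otimes> c) \<odot>\<^bsub>M\<^esub> x" "k \<otimes> r = (k \<otimes> c) \<otimes> T 1"
      using S x k by (simp_all add: smult_r_distr smult_assoc1 m_assoc)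
    then show "(k \<odot>\<^bsub>M\<^esub> a, k \<otimes> r) \<in> ?G"
      unfolding mem_Collect_eq using S(6)[OF k 1(3)] 1(4) k by blast
  next
    fix r assume "(\<zero>\<^bsub>M\<^esub>, r) \<in> ?G"
    then obtain y c where 1: "\<zero>\<^bsub>M\<^esub> = y \<oplus>\<^bsub>M\<^esub> c \<odot>\<^bsub>M\<^esub> x" "r = c \<otimes> T 1" "y \<in> N" "c \<in> carrier R" by blast
    have "c \<odot>\<^bsub>M\<^esub> x = \<ominus>\<^bsub>M\<^esub> y"
      using M.minus_equality[of "c \<odot>\<^bsub>M\<^esub> x" y] 1 S(1)[OF 1(3)] x by (simp add: M.a_comm)
    then have cx: "c \<odot>\<^bsub>M\<^esub> x \<in> N" using S 1 by simp
    have "c \<notin> Units R"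
    proof
      assume c: "c \<in> Units R"
      have "inv c \<odot>\<^bsub>M\<^esub> (c \<odot>\<^bsub>M\<^esub> x) \<in> N" by (rule S(6)[OF Units_inv_closed[OF c] cx])
      moreover have "inv c \<odot>\<^bsub>M\<^esub> (c \<odot>\<^bsub>M\<^esub> x) = x"
        using smult_assoc1[of "inv c" c x] c x(1) 1(4) by simp
      ultimately show False using x(2) by simp
    qed
    then obtain a d where d: "0 < a" "d \<in> carrier R" "c = T a \<otimes> d" by (rule nonunit_T[OF 1(4)])
    then have "c \<otimes> T 1 = d \<otimes> (T a \<otimes> T 1)" by (simp add: m_ac)
    also have "\<dots> = \<zero>" using d T_add[of a 1] T_eq_zero_iff[of "a + 1"] by simp
    finally show "r = \<zero>" using 1 by simp
  qed
  moreover have memN: "(y, \<zero>) \<in> ?G" if "y \<in> N" for y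
  proof -
    have "(y, \<zero>) = (y \<oplus>\<^bsub>M\<^esub> \<zero> \<odot>\<^bsub>M\<^esub> x, \<zero> \<otimes> T 1)" using S that x by simp
    then show ?thesis unfolding mem_Collect_eq using that
      by (intro exI[of _ y] exI[of _ \<zero>]) simp
  qed
  ultimately obtain H where H: "linear_graph H" "?G \<subseteq> H" "\<And>x. x \<in> carrier M \<Longrightarrow> \<exists>r. (x, r) \<in> H"
    by (rule linear_graph_total) (use S in blast)+
  note D = linear_graphD[OF H(1)] and U = linear_graph_unique[OF H(1)]
  \<comment> \<open>The total graph is turned into an extensional function by applying the extension
    lemma to the whole module.\<close>
  define h where "h x = (SOME r. (x, r) \<in> H)" for x
  have h: "(x, h x) \<in> H" if "x \<in> carrier M" for x using H(3)[OF that] unfolding h_def by (auto intro: someI)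
  obtain \<alpha> where \<alpha>: "\<alpha> \<in> carrier (dual_module R M)" "\<And>x. x \<in> carrier M \<Longrightarrow> \<alpha> x = h x"
  proof (rule extend_functional[OF carrier_is_submodule, of h])
    show "\<And>x. x \<in> carrier M \<Longrightarrow> h x \<in> carrier R" using h D(2) by blast
    show "\<And>x y. x \<in> carrier M \<Longrightarrow> y \<in> carrier M \<Longrightarrow> h (x \<oplus>\<^bsub>M\<^esub> y) = h x \<oplus> h y"
      using h U D(3) by (meson M.a_closed)
    show "\<And>c x. c \<in> carrier R \<Longrightarrow> x \<in> carrier M \<Longrightarrow> h (c \<odot>\<^bsub>M\<^esub> x) = c \<otimes> h x"
      using h U D(4) by (meson smult_closed)
  qed blast
  show ?thesis
  proof (rule that[OF \<alpha>(1)])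
    fix y assume "y \<in> N"
    then have "(y, \<zero>) \<in> H" "(y, h y) \<in> H" "y \<in> carrier M" using memN H(2) h S(1) by blast+
    then show "\<alpha> y = \<zero>" using \<alpha>(2) U by metis
  next
    have "(x, T 1) = (\<zero>\<^bsub>M\<^esub> \<oplus>\<^bsub>M\<^esub> \<one> \<odot>\<^bsub>M\<^esub> x, \<one> \<otimes> T 1)" using x by simp
    then have "(x, T 1) \<in> ?G" unfolding mem_Collect_eq using S(2)
      by (intro exI[of _ "\<zero>\<^bsub>M\<^esub>"] exI[of _ \<one>]) simp
    then have "(x, T 1) \<in> H" using H(2) by blast
    then have "\<alpha> x = T 1" using \<alpha>(2) U h x by metis
    then show "\<alpha> x \<noteq> \<zero>" using T_eq_zero_iff[of 1] by simp
  qed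
qed

end


section \<open>Reflexivity is linear compactness\<close>

context root_module
begin

abbreviation D where "D \<equiv> dual_module R M"

lemma carrier_dual:
  "\<alpha> \<in> carrier D \<longleftrightarrow> \<alpha> \<in> extensional (carrier M) \<and> (\<forall>x\<in>carrier M. \<alpha> x \<in> carrier R) \<and>
    (\<forall>x\<in>carrier M. \<forall>y\<in>carrier M. \<alpha> (x \<oplus>\<^bsub>M\<^esub> y) = \<alpha> x \<oplus> \<alpha> y) \<and>
    (\<forall>r\<in>carrier R. \<forall>x\<in>carrier M. \<alpha> (r \<odot>\<^bsub>M\<^esub> x) = r \<otimes> \<alpha> x)"
  by (auto simp: dual_module_def module_hom_def PiE_def)

lemma dualD:
  assumes "\<alpha> \<in> carrier D"
  shows "x \<in> carrier M \<Longrightarrow> \<alpha> x \<in> carrier R"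
    "x \<in> carrier M \<Longrightarrow> y \<in> carrier M \<Longrightarrow> \<alpha> (x \<oplus>\<^bsub>M\<^esub> y) = \<alpha> x \<oplus> \<alpha> y"
    "r \<in> carrier R \<Longrightarrow> x \<in> carrier M \<Longrightarrow> \<alpha> (r \<odot>\<^bsub>M\<^esub> x) = r \<otimes> \<alpha> x"
  using assms unfolding carrier_dual by auto

lemma dual_minus:
  assumes a: "\<alpha> \<in> carrier D" and "x \<in> carrier M" "y \<in> carrier M"
  shows "\<alpha> (x \<ominus>\<^bsub>M\<^esub> y) = \<alpha> x \<ominus> \<alpha> y"
proof -
  have "x \<ominus>\<^bsub>M\<^esub> y = x \<oplus>\<^bsub>M\<^esub> (\<ominus> \<one>) \<odot>\<^bsub>M\<^esub> y" using assms by (simp add: a_minus_def smult_l_minus)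
  then show ?thesis using assms dualD[OF a] by (simp add: a_minus_def R.l_minus)
qed

lemma dual_zero [simp]: "\<alpha> \<in> carrier D \<Longrightarrow> \<alpha> \<zero>\<^bsub>M\<^esub> = \<zero>"
  using dualD(3)[of \<alpha> \<zero> "\<zero>\<^bsub>M\<^esub>"] dualD(1)[of \<alpha> "\<zero>\<^bsub>M\<^esub>"] by simp

lemma dual_ops [simp]:
  "x \<in> carrier M \<Longrightarrow> (\<alpha> \<oplus>\<^bsub>D\<^esub> \<beta>) x = \<alpha> x \<oplus> \<beta> x"
  "x \<in> carrier M \<Longrightarrow> (r \<odot>\<^bsub>D\<^esub> \<alpha>) x = r \<otimes> \<alpha> x"
  "x \<in> carrier M \<Longrightarrow> \<zero>\<^bsub>D\<^esub> x = \<zero>"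
  by (simp_all add: dual_module_def)

lemma dual_ops_ext [simp]:
  "\<alpha> \<oplus>\<^bsub>D\<^esub> \<beta> \<in> extensional (carrier M)" "r \<odot>\<^bsub>D\<^esub> \<alpha> \<in> extensional (carrier M)"
  "\<zero>\<^bsub>D\<^esub> \<in> extensional (carrier M)"
  by (simp_all add: dual_module_def)

lemma dual_ops_closed:
  "\<alpha> \<in> carrier D \<Longrightarrow> \<beta> \<in> carrier D \<Longrightarrow> \<alpha> \<oplus>\<^bsub>D\<^esub> \<beta> \<in> carrier D"
  "r \<in> carrier R \<Longrightarrow> \<alpha> \<in> carrier D \<Longrightarrow> r \<odot>\<^bsub>D\<^esub> \<alpha> \<in> carrier D"
  "\<zero>\<^bsub>D\<^esub> \<in> carrier D"
  unfolding carrier_dual[of "\<alpha> \<oplus>\<^bsub>D\<^esub> \<beta>"] carrier_dual[of "r \<odot>\<^bsub>D\<^esub> \<alpha>"] carrier_dual[of "\<zero>\<^bsub>D\<^esub>"]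
  by (auto simp: dualD R.a_ac R.r_distr R.m_lcomm)

lemma dual_eqI:
  assumes "\<alpha> \<in> extensional (carrier M)" "\<beta> \<in> extensional (carrier M)"
    "\<And>x. x \<in> carrier M \<Longrightarrow> \<alpha> x = \<beta> x"
  shows "\<alpha> = \<beta>"
  using assms by (auto intro: extensionalityI)

lemma dual_ext: "\<alpha> \<in> carrier D \<Longrightarrow> \<alpha> \<in> extensional (carrier M)"
  by (simp add: carrier_dual)

lemma dual_module_module: "Module.module R D"
proof (rule Module.moduleI)
  show "cring R" ..
  show "abelian_group D"
  proof (rule abelian_groupI)
    fix \<alpha> \<beta> \<gamma> assume c: "\<alpha> \<in> carrier D" "\<beta> \<in> carrier D" "\<gamma> \<in> carrier D"
    show "\<alpha> \<oplus>\<^bsub>D\<^esub> \<beta> \<oplus>\<^bsub>D\<^esub> \<gamma> = \<alpha> \<oplus>\<^bsub>D\<^esub> (\<beta> \<oplus>\<^bsub>D\<^esub> \<gamma>)"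
      by (rule dual_eqI) (use c in \<open>simp_all add: dualD R.a_ac\<close>)
  next
    fix \<alpha> \<beta> assume c: "\<alpha> \<in> carrier D" "\<beta> \<in> carrier D"
    show "\<alpha> \<oplus>\<^bsub>D\<^esub> \<beta> = \<beta> \<oplus>\<^bsub>D\<^esub> \<alpha>"
      by (rule dual_eqI) (use c in \<open>simp_all add: dualD R.a_ac\<close>)
  next
    fix \<alpha> assume c: "\<alpha> \<in> carrier D"
    show "\<zero>\<^bsub>D\<^esub> \<oplus>\<^bsub>D\<^esub> \<alpha> = \<alpha>"
      by (rule dual_eqI) (use c in \<open>simp_all add: dualD dual_ext\<close>)
    have "(\<ominus> \<one>) \<odot>\<^bsub>D\<^esub> \<alpha> \<oplus>\<^bsub>D\<^esub> \<alpha> = \<zero>\<^bsub>D\<^esub>"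
      by (rule dual_eqI) (use c in \<open>simp_all add: dualD R.l_minus R.l_neg\<close>)
    moreover have "(\<ominus> \<one>) \<odot>\<^bsub>D\<^esub> \<alpha> \<in> carrier D" using c dual_ops_closed by simp
    ultimately show "\<exists>\<beta>\<in>carrier D. \<beta> \<oplus>\<^bsub>D\<^esub> \<alpha> = \<zero>\<^bsub>D\<^esub>" by blast
  qed (simp_all add: dual_ops_closed)
next
  fix r s \<alpha> \<beta> assume c: "r \<in> carrier R" "s \<in> carrier R" "\<alpha> \<in> carrier D"
  show "(r \<oplus> s) \<odot>\<^bsub>D\<^esub> \<alpha> = r \<odot>\<^bsub>D\<^esub> \<alpha> \<oplus>\<^bsub>D\<^esub> s \<odot>\<^bsub>D\<^esub> \<alpha>"
    by (rule dual_eqI) (use c in \<open>simp_all add: dualD R.l_distr\<close>)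
  show "(r \<otimes> s) \<odot>\<^bsub>D\<^esub> \<alpha> = r \<odot>\<^bsub>D\<^esub> (s \<odot>\<^bsub>D\<^esub> \<alpha>)"
    by (rule dual_eqI) (use c in \<open>simp_all add: dualD R.m_assoc\<close>)
next
  fix r \<alpha> \<beta> assume c: "r \<in> carrier R" "\<alpha> \<in> carrier D" "\<beta> \<in> carrier D"
  show "r \<odot>\<^bsub>D\<^esub> (\<alpha> \<oplus>\<^bsub>D\<^esub> \<beta>) = r \<odot>\<^bsub>D\<^esub> \<alpha> \<oplus>\<^bsub>D\<^esub> r \<odot>\<^bsub>D\<^esub> \<beta>"
    by (rule dual_eqI) (use c in \<open>simp_all add: dualD R.r_distr\<close>)
next
  fix \<alpha> assume c: "\<alpha> \<in> carrier D"
  show "\<one> \<odot>\<^bsub>D\<^esub> \<alpha> = \<alpha>"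
    by (rule dual_eqI) (use c in \<open>simp_all add: dualD dual_ext\<close>)
qed (simp_all add: dual_ops_closed)

lemma dual_root_module: "root_module R T D"
  by (rule root_module.intro[OF dual_module_module root_ring_axioms])

text \<open>The coset absorbs translations by r (y - z), so sums and multiples of differences can be
  rewritten as single differences.\<close>

lemma affine_directions:
  assumes C: "C \<subseteq> carrier M" "affine_subset R M C"
  shows "submodule {y \<ominus>\<^bsub>M\<^esub> z |y z. y \<in> C \<and> z \<in> C} R M" (is "submodule ?N R M")
proof (rule submoduleI')
  have aff: "x \<oplus>\<^bsub>M\<^esub> r \<odot>\<^bsub>M\<^esub> (y \<ominus>\<^bsub>M\<^esub> z) \<in> C" if "x \<in> C" "y \<in> C" "z \<in> C" "r \<in> carrier R" for x y z r
    using that C(2) unfolding affine_subset_iff[OF C(1)] by blast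
  obtain x where x: "x \<in> C" using C(2) unfolding affine_subset_def by blast
  have cl: "y \<in> carrier M" if "y \<in> C" for y using that C by blast
  show "?N \<subseteq> carrier M" using cl by auto
  have "\<zero>\<^bsub>M\<^esub> = x \<ominus>\<^bsub>M\<^esub> x" using cl[OF x] by (simp add: a_minus_def M.r_neg)
  then show "\<zero>\<^bsub>M\<^esub> \<in> ?N" using x by blast
  fix a assume "a \<in> ?N"
  then obtain y z where yz: "a = y \<ominus>\<^bsub>M\<^esub> z" "y \<in> C" "z \<in> C" by blast
  {
    fix b assume "b \<in> ?N"
    then obtain v w where vw: "b = v \<ominus>\<^bsub>M\<^esub> w" "v \<in> C" "w \<in> C" by blast
    have "a \<oplus>\<^bsub>M\<^esub> b = (y \<oplus>\<^bsub>M\<^esub> \<one> \<odot>\<^bsub>M\<^esub> (v \<ominus>\<^bsub>M\<^esub> w)) \<ominus>\<^bsub>M\<^esub> z"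
      using yz vw cl by (simp add: a_minus_def M.a_ac)
    moreover have "y \<oplus>\<^bsub>M\<^esub> \<one> \<odot>\<^bsub>M\<^esub> (v \<ominus>\<^bsub>M\<^esub> w) \<in> C" using aff yz vw by blast
    ultimately show "a \<oplus>\<^bsub>M\<^esub> b \<in> ?N" using yz by blast
  }
  fix r assume r: "r \<in> carrier R"
  have "r \<odot>\<^bsub>M\<^esub> a = (x \<oplus>\<^bsub>M\<^esub> r \<odot>\<^bsub>M\<^esub> (y \<ominus>\<^bsub>M\<^esub> z)) \<ominus>\<^bsub>M\<^esub> x"
    using yz cl x r by (simp add: a_minus_def M.a_ac M.r_neg1 M.r_neg2 M.r_neg M.l_neg)
  moreover have "x \<oplus>\<^bsub>M\<^esub> r \<odot>\<^bsub>M\<^esub> (y \<ominus>\<^bsub>M\<^esub> z) \<in> C" using aff yz x r by blast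
  ultimately show "r \<odot>\<^bsub>M\<^esub> a \<in> ?N" using x by blast
qed

lemma evaluation_hom: "evaluation R M \<in> module_hom R M (dual_module R D)"
proof -
  interpret D: root_module R T D by (rule dual_root_module)
  have ev: "(\<lambda>\<alpha>\<in>carrier D. \<alpha> m) \<in> carrier D.D" if "m \<in> carrier M" for m
    unfolding D.carrier_dual using that by (auto simp: dual_ops_closed dualD)
  show ?thesis unfolding module_hom_def
  proof (intro CollectI conjI ballI)
    show "evaluation R M \<in> carrier M \<rightarrow>\<^sub>E carrier D.D"
      unfolding evaluation_def using ev by auto
    fix x assume x: "x \<in> carrier M"
    {
      fix y assume "y \<in> carrier M"
      then show "evaluation R M (x \<oplus>\<^bsub>M\<^esub> y) = evaluation R M x \<oplus>\<^bsub>D.D\<^esub> evaluation R M y"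
        using x by (intro D.dual_eqI) (auto simp: evaluation_def dualD)
    }
    fix r assume "r \<in> carrier R"
    then show "evaluation R M (r \<odot>\<^bsub>M\<^esub> x) = r \<odot>\<^bsub>D.D\<^esub> evaluation R M x"
      using x by (intro D.dual_eqI) (auto simp: evaluation_def dualD)
  qed
qed

text \<open>The difference of two distinct elements is separated from the zero submodule by a
  functional.\<close>

lemma evaluation_inj: "inj_on (evaluation R M) (carrier M)"
proof (rule inj_onI, rule ccontr)
  fix x y assume xy: "x \<in> carrier M" "y \<in> carrier M" "evaluation R M x = evaluation R M y" "x \<noteq> y"
  then have "x \<ominus>\<^bsub>M\<^esub> y \<notin> {\<zero>\<^bsub>M\<^esub>}" by (simp add: minus_eq_zero_iff)
  then obtain \<alpha> where \<alpha>: "\<alpha> \<in> carrier D" "\<alpha> (x \<ominus>\<^bsub>M\<^esub> y) \<noteq> \<zero>"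
    using separating_functional[OF zero_submodule, of "x \<ominus>\<^bsub>M\<^esub> y"] xy by blast
  have "evaluation R M x \<alpha> = evaluation R M y \<alpha>" using xy by simp
  then have "\<alpha> x = \<alpha> y" using xy \<alpha> by (simp add: evaluation_def)
  then show False using \<alpha> xy dualD(1)[OF \<alpha>(1)] by (simp add: dual_minus)
qed

lemma theta_reflexive_iff_surj:
  "theta_reflexive R M \<longleftrightarrow>
    (\<forall>\<phi>\<in>carrier (dual_module R D). \<exists>m\<in>carrier M. \<forall>\<alpha>\<in>carrier D. \<phi> \<alpha> = \<alpha> m)"
proof -
  interpret D: root_module R T D by (rule dual_root_module)
  have "theta_reflexive R M \<longleftrightarrow> carrier D.D \<subseteq> evaluation R M ` carrier M"
    using evaluation_hom evaluation_inj
    unfolding theta_reflexive_def module_iso_def bij_betw_def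
    by (auto simp: module_hom_def)
  also have "\<dots> \<longleftrightarrow> (\<forall>\<phi>\<in>carrier D.D. \<exists>m\<in>carrier M. \<phi> = evaluation R M m)" by blast
  also have "\<dots> \<longleftrightarrow> (\<forall>\<phi>\<in>carrier D.D. \<exists>m\<in>carrier M. \<forall>\<alpha>\<in>carrier D. \<phi> \<alpha> = \<alpha> m)"
  proof -
    have "\<phi> = evaluation R M m \<longleftrightarrow> (\<forall>\<alpha>\<in>carrier D. \<phi> \<alpha> = \<alpha> m)"
      if "\<phi> \<in> carrier D.D" "m \<in> carrier M" for \<phi> m
      using that D.dual_ext[OF that(1)] by (auto simp: evaluation_def intro: D.dual_eqI)
    then show ?thesis by auto
  qed
  finally show ?thesis .
qed

text \<open>A directed family of cosets defines an element of the bidual: the functionals constant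
  on some member form a submodule, their eventual value is linear there, and it extends. The point
  representing this element lies in every member, because a coset is cut out by the functionals
  constant on it.\<close>

lemma reflexive_imp_linearly_compact:
  assumes refl: "theta_reflexive R M"
  shows "linearly_compact R M (carrier M)"
  unfolding linearly_compact_def
proof (intro allI impI)
  interpret D: root_module R T D by (rule dual_root_module)
  fix F assume F: "(\<forall>C\<in>F. C \<subseteq> carrier M \<and> affine_subset R M C) \<and> down_directed F"
  have Fc: "x \<in> carrier M" if "C \<in> F" "x \<in> C" for C x using F that by blast
  have Fne: "\<exists>x. x \<in> C" if "C \<in> F" for C
  proof -
    have "affine_subset R M C" using F that by blast
    then have "C \<noteq> {}" by (simp add: affine_subset_def)
    then show ?thesis by blast
  qed
  have Fdir: "\<exists>E\<in>F. E \<subseteq> C \<inter> C'" if "C \<in> F" "C' \<in> F" for C C'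
    using F that unfolding down_directed_def by blast
  show "\<exists>x\<in>carrier M. \<forall>C\<in>F. x \<in> C"
  proof (cases "F = {}")
    case True then show ?thesis by blast
  next
    case False
    \<comment> \<open>Directedness makes the constant value independent of the chosen member;
      \<open>h\<close> below is this value.\<close>
    define const where "const \<alpha> C v \<longleftrightarrow> C \<in> F \<and> (\<forall>x\<in>C. \<alpha> x = v)" for \<alpha> :: "'c \<Rightarrow> 'a" and C v
    define L where "L = {\<alpha> \<in> carrier D. \<exists>C v. const \<alpha> C v}"
    define h where "h \<alpha> = (SOME v. \<exists>C. const \<alpha> C v)" for \<alpha>
    have h_eq: "h \<alpha> = v" if "const \<alpha> C v" for \<alpha> C v
      unfolding h_def
    proof (rule some_equality)
      show "\<exists>C. const \<alpha> C v" using that by blast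
      fix w assume "\<exists>C. const \<alpha> C w"
      then obtain C' where C': "const \<alpha> C' w" ..
      with that Fdir[of C C'] obtain E where E: "E \<in> F" "E \<subseteq> C \<inter> C'" unfolding const_def by blast
      with Fne obtain x where "x \<in> E" by blast
      then have "\<alpha> x = v" "\<alpha> x = w" using that C' E unfolding const_def by auto
      then show "w = v" by simp
    qed
    have vR: "v \<in> carrier R" if "const \<alpha> C v" "\<alpha> \<in> carrier D" for \<alpha> C v
    proof -
      have "C \<in> F" using that by (simp add: const_def)
      with Fne obtain x where x: "x \<in> C" by blast
      have "\<alpha> x = v" using x that by (simp add: const_def)
      moreover have "x \<in> carrier M" using Fc[OF \<open>C \<in> F\<close> x] .
      ultimately show ?thesis using dualD(1)[OF that(2)] by blast
    qed
    have add: "\<exists>E. const (\<alpha> \<oplus>\<^bsub>D\<^esub> \<beta>) E (v \<oplus> w)" if "const \<alpha> C v" "const \<beta> C' w" for \<alpha> \<beta> C C' v w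
    proof -
      have "C \<in> F" "C' \<in> F" using that by (simp_all add: const_def)
      then obtain E where E: "E \<in> F" "E \<subseteq> C \<inter> C'" using Fdir by blast
      have "(\<alpha> \<oplus>\<^bsub>D\<^esub> \<beta>) x = v \<oplus> w" if x: "x \<in> E" for x
      proof -
        have "x \<in> carrier M" using Fc[OF E(1) x] .
        moreover have "\<alpha> x = v" "\<beta> x = w"
          using \<open>const \<alpha> C v\<close> \<open>const \<beta> C' w\<close> E x unfolding const_def by auto
        ultimately show ?thesis by simp
      qed
      with E show ?thesis unfolding const_def by blast
    qed
    have sm: "const (r \<odot>\<^bsub>D\<^esub> \<alpha>) C (r \<otimes> v)" if "const \<alpha> C v" for r \<alpha> C v
      using that Fc[of C] by (auto simp: const_def)
    obtain C0 where C0: "C0 \<in> F" using False by blast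
    have "submodule L R D"
    proof (rule D.submoduleI')
      have "const \<zero>\<^bsub>D\<^esub> C0 \<zero>" using C0 Fc by (auto simp: const_def)
      then show "\<zero>\<^bsub>D\<^esub> \<in> L" unfolding L_def by auto
      show "L \<subseteq> carrier D" by (auto simp: L_def)
      show "\<And>a b. a \<in> L \<Longrightarrow> b \<in> L \<Longrightarrow> a \<oplus>\<^bsub>D\<^esub> b \<in> L" unfolding L_def using add by blast
      show "\<And>a x. a \<in> carrier R \<Longrightarrow> x \<in> L \<Longrightarrow> a \<odot>\<^bsub>D\<^esub> x \<in> L" unfolding L_def using sm by blast
    qed
    then obtain \<phi> where \<phi>: "\<phi> \<in> carrier D.D" "\<And>\<alpha>. \<alpha> \<in> L \<Longrightarrow> \<phi> \<alpha> = h \<alpha>"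
    proof (rule D.extend_functional[of L h])
      fix \<alpha> assume "\<alpha> \<in> L"
      then obtain C v where a: "\<alpha> \<in> carrier D" "const \<alpha> C v" unfolding L_def by blast
      then show "h \<alpha> \<in> carrier R" using vR h_eq by simp
      show "h (c \<odot>\<^bsub>D\<^esub> \<alpha>) = c \<otimes> h \<alpha>" for c using h_eq[OF a(2)] h_eq[OF sm[OF a(2)]] by simp
      fix \<beta> assume "\<beta> \<in> L"
      then obtain C' w where b: "const \<beta> C' w" unfolding L_def by blast
      from add[OF a(2) b] obtain E where "const (\<alpha> \<oplus>\<^bsub>D\<^esub> \<beta>) E (v \<oplus> w)" ..
      then show "h (\<alpha> \<oplus>\<^bsub>D\<^esub> \<beta>) = h \<alpha> \<oplus> h \<beta>" using h_eq a(2) b by simp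
    qed blast
    then obtain m where m: "m \<in> carrier M" "\<And>\<alpha>. \<alpha> \<in> carrier D \<Longrightarrow> \<phi> \<alpha> = \<alpha> m"
      using refl unfolding theta_reflexive_iff_surj by blast
    have "m \<in> C" if C: "C \<in> F" for C
    proof (rule ccontr)
      assume mC: "m \<notin> C"
      have CM: "C \<subseteq> carrier M" and aff: "affine_subset R M C" using F C by auto
      obtain x where x: "x \<in> C" using Fne[OF C] ..
      then have xM: "x \<in> carrier M" using CM by blast
      let ?N = "{y \<ominus>\<^bsub>M\<^esub> z |y z. y \<in> C \<and> z \<in> C}"
      have "m \<ominus>\<^bsub>M\<^esub> x \<notin> ?N"
      proof
        assume "m \<ominus>\<^bsub>M\<^esub> x \<in> ?N"
        then obtain y z where yz: "m \<ominus>\<^bsub>M\<^esub> x = y \<ominus>\<^bsub>M\<^esub> z" "y \<in> C" "z \<in> C" by blast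
        have "x \<oplus>\<^bsub>M\<^esub> \<one> \<odot>\<^bsub>M\<^esub> (y \<ominus>\<^bsub>M\<^esub> z) \<in> C"
          using aff x yz unfolding affine_subset_iff[OF CM] by blast
        moreover have "x \<oplus>\<^bsub>M\<^esub> \<one> \<odot>\<^bsub>M\<^esub> (y \<ominus>\<^bsub>M\<^esub> z) = m"
          unfolding yz(1)[symmetric] using m(1) xM by (simp add: a_minus_def M.a_lcomm M.r_neg)
        ultimately show False using mC by simp
      qed
      then obtain \<alpha> where \<alpha>: "\<alpha> \<in> carrier D" "\<And>y. y \<in> ?N \<Longrightarrow> \<alpha> y = \<zero>" "\<alpha> (m \<ominus>\<^bsub>M\<^esub> x) \<noteq> \<zero>"
        using separating_functional[OF affine_directions[OF CM aff], of "m \<ominus>\<^bsub>M\<^esub> x"] m(1) xM by blast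
      \<comment> \<open>\<alpha> vanishes on differences within C and so is constant there. Hence it
        takes the same value at m and x, although it was chosen not to vanish at their
        difference.\<close>
      have "const \<alpha> C (\<alpha> x)" unfolding const_def
      proof (intro conjI ballI C)
        fix y assume y: "y \<in> C"
        then have "\<alpha> (y \<ominus>\<^bsub>M\<^esub> x) = \<zero>" using \<alpha>(2) x by blast
        then show "\<alpha> y = \<alpha> x" using \<alpha>(1) subsetD[OF CM y] xM dualD(1)[OF \<alpha>(1)] by (simp add: dual_minus)
      qed
      moreover from this have "\<alpha> \<in> L" using \<alpha>(1) by (auto simp: L_def)
      ultimately have "\<alpha> m = \<alpha> x" using m(2)[OF \<alpha>(1)] \<phi>(2) h_eq by metis
      then show False using \<alpha>(1,3) m(1) xM dualD(1)[OF \<alpha>(1)] by (simp add: dual_minus)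
    qed
    with m(1) show ?thesis by blast
  qed
qed

text \<open>Induction on the set of functionals, with K free because each step passes to the kernel
  of the functional just treated. The last hypothesis says that \<open>\<phi>\<close> depends only
  on restrictions to K; the heart of the induction is that the corrected \<open>\<phi>'\<close>
  inherits this for the smaller kernel.\<close>

lemma finite_interpolation:
  assumes "finite S" "S \<subseteq> carrier D" "submodule K R M"
    and "\<And>\<alpha>. \<alpha> \<in> carrier D \<Longrightarrow> \<phi> \<alpha> \<in> carrier R"
    and "\<And>\<alpha> \<beta>. \<alpha> \<in> carrier D \<Longrightarrow> \<beta> \<in> carrier D \<Longrightarrow> \<phi> (\<alpha> \<oplus>\<^bsub>D\<^esub> \<beta>) = \<phi> \<alpha> \<oplus> \<phi> \<beta>"
    and "\<And>r \<alpha>. r \<in> carrier R \<Longrightarrow> \<alpha> \<in> carrier D \<Longrightarrow> \<phi> (r \<odot>\<^bsub>D\<^esub> \<alpha>) = r \<otimes> \<phi> \<alpha>"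
    and "\<And>\<alpha>. \<alpha> \<in> carrier D \<Longrightarrow> (\<And>x. x \<in> K \<Longrightarrow> \<alpha> x = \<zero>) \<Longrightarrow> \<phi> \<alpha> = \<zero>"
  shows "\<exists>m\<in>K. \<forall>\<alpha>\<in>S. \<alpha> m = \<phi> \<alpha>"
  using assms
proof (induction S arbitrary: K \<phi>)
  case empty
  then show ?case using submodule_zero by blast
next
  case (insert \<alpha> S)
  note \<phi> = insert.prems(3,4,5) and kills = insert.prems(6)
  note KS = submodule_simps[OF insert.prems(2)]
  have \<alpha>: "\<alpha> \<in> carrier D" using insert.prems by blast
  note \<alpha>D = dualD[OF \<alpha>]
  \<comment> \<open>If the value were missed, every value of \<alpha> on K would be a nonunit
    multiple of it. A socle multiplier c of \<open>\<phi> \<alpha>\<close> then makes c \<alpha>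
    vanish on K without annihilating \<open>\<phi> \<alpha>\<close>.\<close>
  have "\<exists>m\<in>K. \<alpha> m = \<phi> \<alpha>"
  proof (rule ccontr)
    assume n: "\<not> ?thesis"
    have n': "\<phi> \<alpha> \<noteq> p \<otimes> \<alpha> x" if "x \<in> K" "p \<in> carrier R" for x p
    proof
      assume "\<phi> \<alpha> = p \<otimes> \<alpha> x"
      then have "\<alpha> (p \<odot>\<^bsub>M\<^esub> x) = \<phi> \<alpha>" using \<alpha>D that KS(1) by simp
      with n KS(6)[OF that(2,1)] show False by blast
    qed
    have "\<phi> \<alpha> \<noteq> \<zero>"
    proof
      assume "\<phi> \<alpha> = \<zero>"
      then have "\<alpha> \<zero>\<^bsub>M\<^esub> = \<phi> \<alpha>" using \<alpha> by simp
      with n KS(2) show False by blast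
    qed
    then obtain c where c: "c \<in> carrier R" "c \<otimes> \<phi> \<alpha> \<noteq> \<zero>"
      "\<And>d. d \<in> carrier R \<Longrightarrow> d \<notin> Units R \<Longrightarrow> c \<otimes> (d \<otimes> \<phi> \<alpha>) = \<zero>"
      by (rule socle_multiplier[OF \<phi>(1)[OF \<alpha>]]) blast
    have "\<phi> (c \<odot>\<^bsub>D\<^esub> \<alpha>) = \<zero>"
    proof (rule kills)
      show "c \<odot>\<^bsub>D\<^esub> \<alpha> \<in> carrier D" by (rule dual_ops_closed(2)[OF c(1) \<alpha>])
      fix x assume x: "x \<in> K"
      then have xM: "x \<in> carrier M" by (rule KS(1))
      obtain d where "d \<in> carrier R" "d \<notin> Units R" "\<alpha> x = d \<otimes> \<phi> \<alpha>"
        by (rule proper_multiple[OF \<alpha>D(1)[OF xM] \<phi>(1)[OF \<alpha>] n'[OF x]])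
      then show "(c \<odot>\<^bsub>D\<^esub> \<alpha>) x = \<zero>" using c(3) xM by simp
    qed
    with c \<phi>(3)[OF c(1) \<alpha>] show False by simp
  qed
  then obtain m1 where m1: "m1 \<in> K" "\<alpha> m1 = \<phi> \<alpha>" by blast
  have m1M: "m1 \<in> carrier M" using m1 KS(1) by blast
  define K' where "K' = {x \<in> K. \<alpha> x = \<zero>}"
  define \<phi>' where "\<phi>' \<beta> = \<phi> \<beta> \<ominus> \<beta> m1" for \<beta>
  have K': "submodule K' R M" unfolding K'_def
    by (rule submoduleI') (use KS \<alpha>D \<alpha> in auto)
  have "\<exists>m\<in>K'. \<forall>\<beta>\<in>S. \<beta> m = \<phi>' \<beta>"
  proof (rule insert.IH[OF _ K'])
    show "S \<subseteq> carrier D" using insert.prems by blast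
    fix \<beta> assume \<beta>: "\<beta> \<in> carrier D"
    show "\<phi>' \<beta> \<in> carrier R" unfolding \<phi>'_def using \<phi>(1) \<beta> dualD(1)[OF \<beta> m1M] by simp
    show "\<phi>' (r \<odot>\<^bsub>D\<^esub> \<beta>) = r \<otimes> \<phi>' \<beta>" if "r \<in> carrier R" for r
      unfolding \<phi>'_def using \<phi> \<beta> that dualD(1)[OF \<beta> m1M] m1M
      by (simp add: a_minus_def R.r_distr R.r_minus)
    show "\<phi>' (\<beta> \<oplus>\<^bsub>D\<^esub> \<gamma>) = \<phi>' \<beta> \<oplus> \<phi>' \<gamma>" if \<gamma>: "\<gamma> \<in> carrier D" for \<gamma>
      unfolding \<phi>'_def using \<phi> \<beta> \<gamma> dualD(1)[OF \<beta> m1M] dualD(1)[OF \<gamma> m1M] m1M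
      by (simp add: a_minus_def R.minus_add R.a_ac)
    assume b0: "\<And>x. x \<in> K' \<Longrightarrow> \<beta> x = \<zero>"
    note \<beta>D = dualD[OF \<beta>]
    \<comment> \<open>On K the value of \<beta> depends only on that of \<alpha>, because \<beta>
      vanishes on the kernel. So \<open>g\<close> is a map on the ideal of values of \<alpha>, and
      Baer's criterion gives \<beta> = p \<alpha> on K.\<close>
    define g where "g r = \<beta> (SOME x. x \<in> K \<and> \<alpha> x = r)" for r
    have g: "g (\<alpha> x) = \<beta> x" if x: "x \<in> K" for x
    proof -
      let ?y = "SOME y. y \<in> K \<and> \<alpha> y = \<alpha> x"
      have y: "?y \<in> K" "\<alpha> ?y = \<alpha> x" using someI[of "\<lambda>y. y \<in> K \<and> \<alpha> y = \<alpha> x" x] x by auto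
      have cl: "?y \<in> carrier M" "x \<in> carrier M" using KS(1) y x by auto
      have "?y \<ominus>\<^bsub>M\<^esub> x \<in> K'" unfolding K'_def using KS(5)[OF y(1) x] y(2) cl \<alpha>D(1)[OF cl(2)]
        by (simp add: dual_minus[OF \<alpha>])
      then have "\<beta> (?y \<ominus>\<^bsub>M\<^esub> x) = \<zero>" by (rule b0)
      then show ?thesis unfolding g_def using cl \<beta>D(1) by (simp add: dual_minus[OF \<beta>])
    qed
    have "\<exists>p\<in>carrier R. \<forall>r\<in>\<alpha> ` K. g r = r \<otimes> p"
    proof (rule baer)
      show "\<alpha> ` K \<subseteq> carrier R" using \<alpha>D KS by blast
      fix r assume "r \<in> \<alpha> ` K"
      then obtain x where x: "x \<in> K" "r = \<alpha> x" by blast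
      then have xM: "x \<in> carrier M" using KS(1) by blast
      show "g r \<in> carrier R" using g x \<beta>D(1)[OF xM] by simp
      show "g r = \<zero>" if "r = \<zero>" using that x b0[of x] g[of x] by (simp add: K'_def)
      fix c assume c: "c \<in> carrier R"
      have cx: "c \<odot>\<^bsub>M\<^esub> x \<in> K" using KS(6)[OF c x(1)] .
      have cr: "c \<otimes> r = \<alpha> (c \<odot>\<^bsub>M\<^esub> x)" using \<alpha>D(3)[OF c xM] x by simp
      show "c \<otimes> r \<in> \<alpha> ` K" unfolding cr using cx by blast
      show "g (c \<otimes> r) = c \<otimes> g r" unfolding cr g[OF cx] using \<beta>D(3)[OF c xM] g[OF x(1)] x by simp
    qed
    then obtain p where p: "p \<in> carrier R" "\<And>x. x \<in> K \<Longrightarrow> \<beta> x = \<alpha> x \<otimes> p" using g by auto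
    have mp: "(\<ominus> p) \<odot>\<^bsub>D\<^esub> \<alpha> \<in> carrier D" using dual_ops_closed(2)[OF _ \<alpha>] p(1) by simp
    \<comment> \<open>Since \<beta> - p \<alpha> vanishes on K, \<open>\<phi> \<beta>\<close> is p
      times \<open>\<phi> \<alpha>\<close>, which is the value of \<beta> at \<open>m1\<close>; the
      correction therefore cancels it.\<close>
    have "\<phi> (\<beta> \<oplus>\<^bsub>D\<^esub> (\<ominus> p) \<odot>\<^bsub>D\<^esub> \<alpha>) = \<zero>"
    proof (rule kills)
      show "\<beta> \<oplus>\<^bsub>D\<^esub> (\<ominus> p) \<odot>\<^bsub>D\<^esub> \<alpha> \<in> carrier D" by (rule dual_ops_closed(1)[OF \<beta> mp])
      fix x assume x: "x \<in> K"
      then have "x \<in> carrier M" by (rule KS(1))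
      then show "(\<beta> \<oplus>\<^bsub>D\<^esub> (\<ominus> p) \<odot>\<^bsub>D\<^esub> \<alpha>) x = \<zero>"
        using p x \<alpha>D(1) by (simp add: R.l_minus R.r_neg R.m_comm[of _ p])
    qed
    then have "\<phi> \<beta> \<oplus> (\<ominus> p) \<otimes> \<phi> \<alpha> = \<zero>" using \<phi>(2)[OF \<beta> mp] \<phi>(3)[OF _ \<alpha>] p(1) by simp
    then have "\<phi> \<beta> \<ominus> p \<otimes> \<phi> \<alpha> = \<zero>" using p(1) \<phi>(1)[OF \<alpha>] by (simp add: a_minus_def R.l_minus)
    moreover have "\<beta> m1 = p \<otimes> \<phi> \<alpha>" using p m1 \<phi>(1)[OF \<alpha>] by (simp add: R.m_comm)
    ultimately show "\<phi>' \<beta> = \<zero>" unfolding \<phi>'_def by simp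
  qed
  then obtain m2 where m2: "m2 \<in> K'" "\<And>\<beta>. \<beta> \<in> S \<Longrightarrow> \<beta> m2 = \<phi>' \<beta>" by blast
  have m2K: "m2 \<in> K" "\<alpha> m2 = \<zero>" "m2 \<in> carrier M" using m2 KS(1) by (auto simp: K'_def)
  show ?case
  proof (intro bexI ballI)
    show "m1 \<oplus>\<^bsub>M\<^esub> m2 \<in> K" using KS m1 m2K by blast
    fix \<beta> assume "\<beta> \<in> insert \<alpha> S"
    then consider "\<beta> = \<alpha>" | "\<beta> \<in> S" by blast
    then show "\<beta> (m1 \<oplus>\<^bsub>M\<^esub> m2) = \<phi> \<beta>"
    proof cases
      case 1 then show ?thesis using \<alpha>D m1 m1M m2K \<phi>(1)[OF \<alpha>] by simp
    next
      case 2
      then have \<beta>: "\<beta> \<in> carrier D" using insert.prems by blast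
      have cl: "\<phi> \<beta> \<in> carrier R" "\<beta> m1 \<in> carrier R" using \<phi>(1)[OF \<beta>] dualD(1)[OF \<beta> m1M] by auto
      have "\<beta> (m1 \<oplus>\<^bsub>M\<^esub> m2) = \<beta> m1 \<oplus> (\<phi> \<beta> \<ominus> \<beta> m1)"
        using dualD(2)[OF \<beta> m1M m2K(3)] m2(2)[OF 2] by (simp add: \<phi>'_def)
      also have "\<dots> = \<phi> \<beta>" using cl by (simp add: a_minus_def R.a_comm[of "\<phi> \<beta>"] R.r_neg2)
      finally show ?thesis .
    qed
  qed
qed

text \<open>The points with the prescribed values on finitely many functionals form a nonempty coset
  by interpolation. Unions of finite sets make these cosets directed, and a common point represents
  the given element of the bidual on all functionals.\<close>

lemma linearly_compact_imp_reflexive: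
  assumes lc: "linearly_compact R M (carrier M)"
  shows "theta_reflexive R M"
  unfolding theta_reflexive_iff_surj
proof
  interpret D: root_module R T D by (rule dual_root_module)
  fix \<phi> assume \<phi>: "\<phi> \<in> carrier D.D"
  note \<phi>D = D.dualD[OF \<phi>]
  define C where "C S = {m \<in> carrier M. \<forall>\<alpha>\<in>S. \<alpha> m = \<phi> \<alpha>}" for S
  define F where "F = {C S |S. finite S \<and> S \<subseteq> carrier D}"
  have "\<exists>x\<in>carrier M. \<forall>X\<in>F. x \<in> X"
  proof (rule lc[unfolded linearly_compact_def, rule_format], intro conjI ballI)
    show "down_directed F" unfolding down_directed_def
    proof (intro ballI)
      fix X Y assume "X \<in> F" "Y \<in> F"
      then obtain S S' where S: "X = C S" "Y = C S'" "finite S" "finite S'" "S \<subseteq> carrier D" "S' \<subseteq> carrier D"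
        unfolding F_def by blast
      then have "C (S \<union> S') \<in> F" unfolding F_def by blast
      moreover have "C (S \<union> S') \<subseteq> X \<inter> Y" using S by (auto simp: C_def)
      ultimately show "\<exists>E\<in>F. E \<subseteq> X \<inter> Y" by blast
    qed
    fix X assume "X \<in> F"
    then obtain S where S: "X = C S" "finite S" "S \<subseteq> carrier D" unfolding F_def by blast
    show XM: "X \<subseteq> carrier M" using S by (auto simp: C_def)
    have "\<exists>m\<in>carrier M. \<forall>\<alpha>\<in>S. \<alpha> m = \<phi> \<alpha>"
    proof (rule finite_interpolation[OF S(2,3) carrier_is_submodule])
      fix \<alpha> assume \<alpha>: "\<alpha> \<in> carrier D" "\<And>x. x \<in> carrier M \<Longrightarrow> \<alpha> x = \<zero>"
      then have "\<alpha> = \<zero>\<^bsub>D\<^esub>" by (intro dual_eqI) (auto simp: dual_ext)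
      then show "\<phi> \<alpha> = \<zero>" using \<phi> by simp
    qed (use \<phi>D in auto)
    then have "X \<noteq> {}" unfolding S C_def by blast
    moreover have "x \<oplus>\<^bsub>M\<^esub> r \<odot>\<^bsub>M\<^esub> (y \<ominus>\<^bsub>M\<^esub> z) \<in> X"
      if "x \<in> X" "y \<in> X" "z \<in> X" "r \<in> carrier R" for x y z r
    proof -
      have cl: "x \<in> carrier M" "y \<in> carrier M" "z \<in> carrier M" using that XM by auto
      have "\<alpha> (x \<oplus>\<^bsub>M\<^esub> r \<odot>\<^bsub>M\<^esub> (y \<ominus>\<^bsub>M\<^esub> z)) = \<phi> \<alpha>" if \<alpha>: "\<alpha> \<in> S" for \<alpha>
      proof -
        have \<alpha>D: "\<alpha> \<in> carrier D" using \<alpha> S by blast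
        have "\<alpha> x = \<phi> \<alpha>" "\<alpha> y = \<phi> \<alpha>" "\<alpha> z = \<phi> \<alpha>"
          using \<open>x \<in> X\<close> \<open>y \<in> X\<close> \<open>z \<in> X\<close> \<alpha> by (auto simp: S C_def)
        then show ?thesis
          using cl that \<open>r \<in> carrier R\<close> \<phi>D(1)[OF \<alpha>D]
          by (simp add: dualD(2,3)[OF \<alpha>D] dual_minus[OF \<alpha>D])
      qed
      then show ?thesis unfolding S C_def using cl \<open>r \<in> carrier R\<close> by simp
    qed
    ultimately show "affine_subset R M X" unfolding affine_subset_iff[OF XM] by blast
  qed
  then obtain m where m: "m \<in> carrier M" "\<And>X. X \<in> F \<Longrightarrow> m \<in> X" by blast
  have "\<phi> \<alpha> = \<alpha> m" if "\<alpha> \<in> carrier D" for \<alpha>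
  proof -
    have "C {\<alpha>} \<in> F" unfolding F_def using that by blast
    then have "m \<in> C {\<alpha>}" by (rule m(2))
    then show ?thesis by (simp add: C_def)
  qed
  with m(1) show "\<exists>m\<in>carrier M. \<forall>\<alpha>\<in>carrier D. \<phi> \<alpha> = \<alpha> m" by blast
qed

theorem theta_reflexive_iff_linearly_compact:
  "theta_reflexive R M \<longleftrightarrow> linearly_compact R M (carrier M)"
  using reflexive_imp_linearly_compact linearly_compact_imp_reflexive by blast

end


section \<open>Multibasic modules are linearly compact\<close>

context Module.module
begin

section \<open>Cyclic submodules, sums and direct sums\<close>

definition cyclic :: "'c \<Rightarrow> 'c set" where
  "cyclic x = {r \<odot>\<^bsub>M\<^esub> x |r. r \<in> carrier R}"

lemma cyclic_submodule: assumes x: "x \<in> carrier M" shows "submodule (cyclic x) R M"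
proof (rule submoduleI')
  show "cyclic x \<subseteq> carrier M" using x by (auto simp: cyclic_def)
  have "\<zero>\<^bsub>M\<^esub> = \<zero> \<odot>\<^bsub>M\<^esub> x" using x by simp
  then show "\<zero>\<^bsub>M\<^esub> \<in> cyclic x" unfolding cyclic_def by blast
  fix a assume "a \<in> cyclic x"
  then obtain r where r: "r \<in> carrier R" "a = r \<odot>\<^bsub>M\<^esub> x" by (auto simp: cyclic_def)
  show "c \<odot>\<^bsub>M\<^esub> a \<in> cyclic x" if "c \<in> carrier R" for c
    using r that x smult_assoc1[of c r x] by (auto simp: cyclic_def intro!: exI[of _ "c \<otimes> r"])
  fix b assume "b \<in> cyclic x"
  then obtain s where s: "s \<in> carrier R" "b = s \<odot>\<^bsub>M\<^esub> x" by (auto simp: cyclic_def)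
  show "a \<oplus>\<^bsub>M\<^esub> b \<in> cyclic x"
    using r s x smult_l_distr[of r s x] by (auto simp: cyclic_def intro!: exI[of _ "r \<oplus> s"])
qed

lemma cyclic_self: "x \<in> carrier M \<Longrightarrow> x \<in> cyclic x"
  unfolding cyclic_def mem_Collect_eq by (intro exI[of _ \<one>]) simp

lemma cyclic_subset: "submodule N R M \<Longrightarrow> x \<in> N \<Longrightarrow> cyclic x \<subseteq> N"
  by (auto simp: cyclic_def submodule_smult)

lemma basic_iff:
  "basic R (M\<lparr>carrier := N\<rparr>) \<longleftrightarrow> N \<noteq> {\<zero>\<^bsub>M\<^esub>} \<and> (\<forall>x\<in>N. \<forall>y\<in>N. x \<in> cyclic y \<or> y \<in> cyclic x)"
proof -
  have "x \<in> cyclic y \<longleftrightarrow> (\<exists>r\<in>carrier R. x = r \<odot>\<^bsub>M\<^esub> y)" for x y by (auto simp: cyclic_def)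
  then show ?thesis by (simp add: basic_def)
qed

definition sumset :: "'c set \<Rightarrow> 'c set \<Rightarrow> 'c set" where
  "sumset A B = {a \<oplus>\<^bsub>M\<^esub> b |a b. a \<in> A \<and> b \<in> B}"

lemma sumsetI: "a \<in> A \<Longrightarrow> b \<in> B \<Longrightarrow> a \<oplus>\<^bsub>M\<^esub> b \<in> sumset A B"
  unfolding sumset_def by blast

lemma sumsetE:
  assumes "x \<in> sumset A B" obtains a b where "a \<in> A" "b \<in> B" "x = a \<oplus>\<^bsub>M\<^esub> b"
  using assms unfolding sumset_def by blast

lemma sumset_submodule:
  assumes A: "submodule A R M" and B: "submodule B R M" shows "submodule (sumset A B) R M"
proof (rule submoduleI')
  note SA = submodule_simps[OF A] and SB = submodule_simps[OF B]
  show "sumset A B \<subseteq> carrier M" using SA SB by (auto simp: sumset_def)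
  show "\<zero>\<^bsub>M\<^esub> \<in> sumset A B" using sumsetI[OF SA(2) SB(2)] by simp
  fix x assume "x \<in> sumset A B"
  then obtain a b where x: "a \<in> A" "b \<in> B" "x = a \<oplus>\<^bsub>M\<^esub> b" by (rule sumsetE)
  show "r \<odot>\<^bsub>M\<^esub> x \<in> sumset A B" if "r \<in> carrier R" for r
    using sumsetI[OF SA(6)[OF that x(1)] SB(6)[OF that x(2)]] SA(1) SB(1) x that by (simp add: smult_r_distr)
  fix y assume "y \<in> sumset A B"
  then obtain a' b' where y: "a' \<in> A" "b' \<in> B" "y = a' \<oplus>\<^bsub>M\<^esub> b'" by (rule sumsetE)
  have "x \<oplus>\<^bsub>M\<^esub> y = (a \<oplus>\<^bsub>M\<^esub> a') \<oplus>\<^bsub>M\<^esub> (b \<oplus>\<^bsub>M\<^esub> b')"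
    using x y SA(1) SB(1) by (simp add: M.a_ac)
  then show "x \<oplus>\<^bsub>M\<^esub> y \<in> sumset A B" using sumsetI SA(3)[OF x(1) y(1)] SB(3)[OF x(2) y(2)] by simp
qed

lemma sumset_left: "submodule A R M \<Longrightarrow> submodule B R M \<Longrightarrow> A \<subseteq> sumset A B"
proof
  fix a assume "submodule A R M" "submodule B R M" "a \<in> A"
  then show "a \<in> sumset A B" using sumsetI[of a A "\<zero>\<^bsub>M\<^esub>" B] submodule_simps by simp
qed

lemma sumset_comm:
  assumes "submodule A R M" "submodule B R M" shows "sumset A B = sumset B A"
proof -
  have "sumset X Y \<subseteq> sumset Y X" if X: "submodule X R M" and Y: "submodule Y R M" for X Y
  proof
    fix x assume "x \<in> sumset X Y"
    then obtain a b where ab: "a \<in> X" "b \<in> Y" "x = a \<oplus>\<^bsub>M\<^esub> b" by (rule sumsetE)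
    then have "x = b \<oplus>\<^bsub>M\<^esub> a"
      using M.a_comm submodule_carrier[OF X ab(1)] submodule_carrier[OF Y ab(2)] by simp
    then show "x \<in> sumset Y X" using sumsetI ab by simp
  qed
  then show ?thesis using assms by blast
qed

lemma sumset_right: "submodule A R M \<Longrightarrow> submodule B R M \<Longrightarrow> B \<subseteq> sumset A B"
  using sumset_left sumset_comm by metis

lemma sumset_assoc:
  assumes "submodule A R M" "submodule B R M" "submodule C R M"
  shows "sumset (sumset A B) C = sumset A (sumset B C)"
proof -
  have "(a \<oplus>\<^bsub>M\<^esub> b) \<oplus>\<^bsub>M\<^esub> c = a \<oplus>\<^bsub>M\<^esub> (b \<oplus>\<^bsub>M\<^esub> c)" if "a \<in> A" "b \<in> B" "c \<in> C" for a b c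
    using that assms by (simp add: M.a_assoc submodule_carrier)
  note assoc = this
  show ?thesis
  proof (intro equalityI subsetI)
    fix x assume "x \<in> sumset (sumset A B) C"
    then obtain a b c where "a \<in> A" "b \<in> B" "c \<in> C" "x = (a \<oplus>\<^bsub>M\<^esub> b) \<oplus>\<^bsub>M\<^esub> c" by (elim sumsetE) simp
    then show "x \<in> sumset A (sumset B C)" by (simp add: assoc sumsetI)
  next
    fix x assume "x \<in> sumset A (sumset B C)"
    then obtain a b c where "a \<in> A" "b \<in> B" "c \<in> C" "x = a \<oplus>\<^bsub>M\<^esub> (b \<oplus>\<^bsub>M\<^esub> c)" by (elim sumsetE) simp
    then show "x \<in> sumset (sumset A B) C" by (simp add: assoc[symmetric] sumsetI)
  qed
qed

definition is_dsum :: "'c set \<Rightarrow> 'c set \<Rightarrow> 'c set \<Rightarrow> bool" where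
  "is_dsum N A B \<longleftrightarrow> submodule A R M \<and> submodule B R M \<and> A \<inter> B = {\<zero>\<^bsub>M\<^esub>} \<and> N = sumset A B"

text \<open>Splitting off the head lets inductions peel one summand and rebracket. The product form
  in \<open>is_direct_sum\<close> is compared with this one only at the end.\<close>

primrec dsum :: "'c set \<Rightarrow> 'c set list \<Rightarrow> bool" where
  "dsum N [] \<longleftrightarrow> N = {\<zero>\<^bsub>M\<^esub>}"
| "dsum N (U # Us) \<longleftrightarrow> (\<exists>V. dsum V Us \<and> is_dsum N U V)"

lemma dsum_submodule: "dsum N Us \<Longrightarrow> submodule N R M"
  by (induction Us arbitrary: N) (auto simp: zero_submodule is_dsum_def sumset_submodule)

section \<open>Cosets and linear compactness inside a module\<close>

lemma affineD:
  assumes "affine_subset R M C" "C \<subseteq> carrier M" "x \<in> C" "y \<in> C" "z \<in> C" "r \<in> carrier R"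
  shows "x \<oplus>\<^bsub>M\<^esub> r \<odot>\<^bsub>M\<^esub> (y \<ominus>\<^bsub>M\<^esub> z) \<in> C"
  using assms(1,3-) unfolding affine_subset_iff[OF assms(2)] by blast

lemma affineI:
  assumes "C \<subseteq> carrier M" "C \<noteq> {}"
    "\<And>x y z r. x \<in> C \<Longrightarrow> y \<in> C \<Longrightarrow> z \<in> C \<Longrightarrow> r \<in> carrier R \<Longrightarrow> x \<oplus>\<^bsub>M\<^esub> r \<odot>\<^bsub>M\<^esub> (y \<ominus>\<^bsub>M\<^esub> z) \<in> C"
  shows "affine_subset R M C"
  using assms(2,3) unfolding affine_subset_iff[OF assms(1)] by blast

lemma affine_nonempty: "affine_subset R M C \<Longrightarrow> \<exists>x. x \<in> C"
  by (auto simp: affine_subset_def)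

lemma linearly_compactD:
  assumes "linearly_compact R M N" "\<And>C. C \<in> F \<Longrightarrow> C \<subseteq> N" "\<And>C. C \<in> F \<Longrightarrow> affine_subset R M C"
    "\<And>C C'. C \<in> F \<Longrightarrow> C' \<in> F \<Longrightarrow> \<exists>E\<in>F. E \<subseteq> C \<and> E \<subseteq> C'"
  obtains x where "x \<in> N" "\<And>C. C \<in> F \<Longrightarrow> x \<in> C"
proof -
  have dd: "down_directed F" unfolding down_directed_def
  proof (intro ballI)
    fix C C' assume "C \<in> F" "C' \<in> F"
    from assms(4)[OF this] show "\<exists>E\<in>F. E \<subseteq> C \<inter> C'" by simp
  qed
  have "\<exists>x\<in>N. \<forall>C\<in>F. x \<in> C"
    by (rule assms(1)[unfolded linearly_compact_def, rule_format]) (simp add: assms(2,3) dd)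
  then show ?thesis using that by blast
qed

lemma affine_smult:
  assumes "r \<in> carrier R" "s \<in> carrier R" "x \<in> carrier M" "y \<in> carrier M" "z \<in> carrier M"
  shows "s \<odot>\<^bsub>M\<^esub> (x \<oplus>\<^bsub>M\<^esub> r \<odot>\<^bsub>M\<^esub> (y \<ominus>\<^bsub>M\<^esub> z)) =
    s \<odot>\<^bsub>M\<^esub> x \<oplus>\<^bsub>M\<^esub> r \<odot>\<^bsub>M\<^esub> (s \<odot>\<^bsub>M\<^esub> y \<ominus>\<^bsub>M\<^esub> s \<odot>\<^bsub>M\<^esub> z)"
  using assms by (simp add: smult_r_distr smult_minus_distr smult_assoc1[symmetric] m_comm)

lemma affine_add:
  assumes "r \<in> carrier R" "x \<in> carrier M" "y \<in> carrier M" "z \<in> carrier M"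
    "x' \<in> carrier M" "y' \<in> carrier M" "z' \<in> carrier M"
  shows "(x \<oplus>\<^bsub>M\<^esub> x') \<oplus>\<^bsub>M\<^esub> r \<odot>\<^bsub>M\<^esub> ((y \<oplus>\<^bsub>M\<^esub> y') \<ominus>\<^bsub>M\<^esub> (z \<oplus>\<^bsub>M\<^esub> z')) =
    (x \<oplus>\<^bsub>M\<^esub> r \<odot>\<^bsub>M\<^esub> (y \<ominus>\<^bsub>M\<^esub> z)) \<oplus>\<^bsub>M\<^esub> (x' \<oplus>\<^bsub>M\<^esub> r \<odot>\<^bsub>M\<^esub> (y' \<ominus>\<^bsub>M\<^esub> z'))"
  using assms by (simp add: a_minus_def smult_r_distr M.minus_add M.a_ac)

text \<open>Cosets through a common point p are translates of submodules, and submodules of a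
  uniserial module form a chain. Concretely, one of y - p and y' - p is a multiple of the
  other.\<close>

lemma uniserial_affine_chain:
  assumes U: "submodule U R M" "\<And>x y. x \<in> U \<Longrightarrow> y \<in> U \<Longrightarrow> x \<in> cyclic y \<or> y \<in> cyclic x"
    and C: "C \<subseteq> U" "affine_subset R M C" and C': "C' \<subseteq> U" "affine_subset R M C'"
    and p: "p \<in> C" "p \<in> C'"
  shows "C \<subseteq> C' \<or> C' \<subseteq> C"
proof (rule ccontr)
  assume "\<not> ?thesis"
  then obtain y y' where y: "y \<in> C" "y \<notin> C'" and y': "y' \<in> C'" "y' \<notin> C" by blast
  have *: False if H: "C1 \<subseteq> U" "affine_subset R M C1" "p \<in> C1" "a \<in> C1" "b \<in> U" "b \<notin> C1"
    "b \<ominus>\<^bsub>M\<^esub> p \<in> cyclic (a \<ominus>\<^bsub>M\<^esub> p)" for C1 a b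
  proof -
    obtain c where c: "c \<in> carrier R" "b \<ominus>\<^bsub>M\<^esub> p = c \<odot>\<^bsub>M\<^esub> (a \<ominus>\<^bsub>M\<^esub> p)"
      using H(7) unfolding cyclic_def by blast
    have cl: "b \<in> carrier M" "p \<in> carrier M" "C1 \<subseteq> carrier M" using H U(1) submodule_carrier by blast+
    have "p \<oplus>\<^bsub>M\<^esub> c \<odot>\<^bsub>M\<^esub> (a \<ominus>\<^bsub>M\<^esub> p) \<in> C1" by (rule affineD[OF H(2) cl(3) H(3,4,3) c(1)])
    also have "p \<oplus>\<^bsub>M\<^esub> c \<odot>\<^bsub>M\<^esub> (a \<ominus>\<^bsub>M\<^esub> p) = b"
      unfolding c(2)[symmetric] using cl by (simp add: a_minus_def M.a_comm[of b] M.r_neg2)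
    finally show False using H by simp
  qed
  have "y \<ominus>\<^bsub>M\<^esub> p \<in> U" "y' \<ominus>\<^bsub>M\<^esub> p \<in> U" using C(1) C'(1) p y y' U(1) by (auto intro!: submodule_minus)
  from U(2)[OF this] show False
  proof
    assume "y \<ominus>\<^bsub>M\<^esub> p \<in> cyclic (y' \<ominus>\<^bsub>M\<^esub> p)"
    with *[OF C'(1,2) p(2) y'(1) _ y(2)] y C show False by blast
  next
    assume "y' \<ominus>\<^bsub>M\<^esub> p \<in> cyclic (y \<ominus>\<^bsub>M\<^esub> p)"
    with *[OF C(1,2) p(1) y(1) _ y'(2)] y' C' show False by blast
  qed
qed

lemma linearly_compact_zero: "linearly_compact R M {\<zero>\<^bsub>M\<^esub>}"
  unfolding linearly_compact_def
proof (intro allI impI bexI ballI)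
  fix F C assume "(\<forall>C\<in>F. C \<subseteq> {\<zero>\<^bsub>M\<^esub>} \<and> affine_subset R M C) \<and> down_directed F" "C \<in> F"
  then have "C \<subseteq> {\<zero>\<^bsub>M\<^esub>}" "affine_subset R M C" by auto
  then show "\<zero>\<^bsub>M\<^esub> \<in> C" using affine_nonempty by blast
qed simp

text \<open>The L-components of each member form a coset; these cosets have a common point l. The
  fibres over this fixed l are cosets in N, and a common point n of the fibres completes the
  solution n + l.\<close>

lemma linearly_compact_sumset:
  assumes N: "submodule N R M" "linearly_compact R M N" and L: "submodule L R M" "linearly_compact R M L"
  shows "linearly_compact R M (sumset N L)"
  unfolding linearly_compact_def
proof (intro allI impI)
  fix F assume F: "(\<forall>C\<in>F. C \<subseteq> sumset N L \<and> affine_subset R M C) \<and> down_directed F"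
  have sub: "C \<subseteq> sumset N L" and aff: "affine_subset R M C" if "C \<in> F" for C using F that by auto
  have dir: "\<exists>E\<in>F. E \<subseteq> C \<and> E \<subseteq> C'" if "C \<in> F" "C' \<in> F" for C C'
    using F that unfolding down_directed_def by auto
  have subM: "C \<subseteq> carrier M" if "C \<in> F" for C
    using sub[OF that] submodule_carrier[OF sumset_submodule[OF N(1) L(1)]] by blast
  note SN = submodule_simps[OF N(1)] and SL = submodule_simps[OF L(1)]
  define Q where "Q C = {l \<in> L. \<exists>n\<in>N. n \<oplus>\<^bsub>M\<^esub> l \<in> C}" for C
  obtain l where l: "l \<in> L" "\<And>X. X \<in> Q ` F \<Longrightarrow> l \<in> X"
  proof (rule linearly_compactD[OF L(2), of "Q ` F"])
    show "\<And>X. X \<in> Q ` F \<Longrightarrow> X \<subseteq> L" by (auto simp: Q_def)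
    fix X assume "X \<in> Q ` F"
    then obtain C where C: "C \<in> F" "X = Q C" by blast
    show "affine_subset R M X"
    proof (rule affineI)
      show "X \<subseteq> carrier M" using SL(1) by (auto simp: C Q_def)
      obtain x where x: "x \<in> C" using affine_nonempty[OF aff[OF C(1)]] ..
      with sub[OF C(1)] obtain a b where "a \<in> N" "b \<in> L" "x = a \<oplus>\<^bsub>M\<^esub> b" by (meson subsetD sumsetE)
      with x show "X \<noteq> {}" by (auto simp: C Q_def)
      fix x y z r assume "x \<in> X" "y \<in> X" "z \<in> X" and r: "r \<in> carrier R"
      then obtain a b c where
        x: "x \<in> L" "a \<in> N" "a \<oplus>\<^bsub>M\<^esub> x \<in> C" and y: "y \<in> L" "b \<in> N" "b \<oplus>\<^bsub>M\<^esub> y \<in> C"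
        and z: "z \<in> L" "c \<in> N" "c \<oplus>\<^bsub>M\<^esub> z \<in> C"
        by (auto simp: C Q_def)
      have "(a \<oplus>\<^bsub>M\<^esub> r \<odot>\<^bsub>M\<^esub> (b \<ominus>\<^bsub>M\<^esub> c)) \<oplus>\<^bsub>M\<^esub> (x \<oplus>\<^bsub>M\<^esub> r \<odot>\<^bsub>M\<^esub> (y \<ominus>\<^bsub>M\<^esub> z)) \<in> C"
        using affineD[OF aff[OF C(1)] subM[OF C(1)] x(3) y(3) z(3) r] x y z r SN(1) SL(1)
        by (simp add: affine_add)
      moreover have "a \<oplus>\<^bsub>M\<^esub> r \<odot>\<^bsub>M\<^esub> (b \<ominus>\<^bsub>M\<^esub> c) \<in> N" "x \<oplus>\<^bsub>M\<^esub> r \<odot>\<^bsub>M\<^esub> (y \<ominus>\<^bsub>M\<^esub> z) \<in> L"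
        using x y z r SN(3,5,6) SL(3,5,6) by auto
      ultimately show "x \<oplus>\<^bsub>M\<^esub> r \<odot>\<^bsub>M\<^esub> (y \<ominus>\<^bsub>M\<^esub> z) \<in> X" unfolding C Q_def by blast
    qed
  next
    fix X Y assume "X \<in> Q ` F" "Y \<in> Q ` F"
    then obtain C C' where C: "C \<in> F" "C' \<in> F" "X = Q C" "Y = Q C'" by blast
    from dir[OF C(1,2)] obtain E where E: "E \<in> F" "E \<subseteq> C" "E \<subseteq> C'" by blast
    then show "\<exists>E\<in>Q ` F. E \<subseteq> X \<and> E \<subseteq> Y" by (intro bexI[of _ "Q E"]) (auto simp: C Q_def)
  qed blast
  then have lM: "l \<in> carrier M" using SL(1) by blast
  define Q' where "Q' C = {n \<in> N. n \<oplus>\<^bsub>M\<^esub> l \<in> C}" for C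
  obtain n where n: "n \<in> N" "\<And>X. X \<in> Q' ` F \<Longrightarrow> n \<in> X"
  proof (rule linearly_compactD[OF N(2), of "Q' ` F"])
    show "\<And>X. X \<in> Q' ` F \<Longrightarrow> X \<subseteq> N" by (auto simp: Q'_def)
    fix X assume "X \<in> Q' ` F"
    then obtain C where C: "C \<in> F" "X = Q' C" by blast
    show "affine_subset R M X"
    proof (rule affineI)
      show "X \<subseteq> carrier M" using SN(1) by (auto simp: C Q'_def)
      have "l \<in> Q C" using l(2) C(1) by blast
      then show "X \<noteq> {}" by (auto simp: C Q_def Q'_def)
      fix x y z r assume "x \<in> X" "y \<in> X" "z \<in> X" and r: "r \<in> carrier R"
      then have x: "x \<in> N" "x \<oplus>\<^bsub>M\<^esub> l \<in> C" and y: "y \<in> N" "y \<oplus>\<^bsub>M\<^esub> l \<in> C"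
        and z: "z \<in> N" "z \<oplus>\<^bsub>M\<^esub> l \<in> C" by (auto simp: C Q'_def)
      \<comment> \<open>The zero difference l - l brings the expression into the shape of
        \<open>affine_add\<close>.\<close>
      have "(x \<oplus>\<^bsub>M\<^esub> r \<odot>\<^bsub>M\<^esub> (y \<ominus>\<^bsub>M\<^esub> z)) \<oplus>\<^bsub>M\<^esub> (l \<oplus>\<^bsub>M\<^esub> r \<odot>\<^bsub>M\<^esub> (l \<ominus>\<^bsub>M\<^esub> l)) \<in> C"
        using affineD[OF aff[OF C(1)] subM[OF C(1)] x(2) y(2) z(2) r] x y z r SN(1) lM
        by (simp add: affine_add)
      then have "(x \<oplus>\<^bsub>M\<^esub> r \<odot>\<^bsub>M\<^esub> (y \<ominus>\<^bsub>M\<^esub> z)) \<oplus>\<^bsub>M\<^esub> l \<in> C" using lM r by simp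
      moreover have "x \<oplus>\<^bsub>M\<^esub> r \<odot>\<^bsub>M\<^esub> (y \<ominus>\<^bsub>M\<^esub> z) \<in> N" using x y z r SN(3,5,6) by auto
      ultimately show "x \<oplus>\<^bsub>M\<^esub> r \<odot>\<^bsub>M\<^esub> (y \<ominus>\<^bsub>M\<^esub> z) \<in> X" unfolding C Q'_def by blast
    qed
  next
    fix X Y assume "X \<in> Q' ` F" "Y \<in> Q' ` F"
    then obtain C C' where C: "C \<in> F" "C' \<in> F" "X = Q' C" "Y = Q' C'" by blast
    from dir[OF C(1,2)] obtain E where E: "E \<in> F" "E \<subseteq> C" "E \<subseteq> C'" by blast
    then show "\<exists>E\<in>Q' ` F. E \<subseteq> X \<and> E \<subseteq> Y" by (intro bexI[of _ "Q' E"]) (auto simp: C Q'_def)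
  qed blast
  show "\<exists>x\<in>sumset N L. \<forall>C\<in>F. x \<in> C"
  proof (intro bexI ballI)
    show "n \<oplus>\<^bsub>M\<^esub> l \<in> sumset N L" by (rule sumsetI[OF n(1) l(1)])
    fix C assume "C \<in> F"
    then have "n \<in> Q' C" using n(2) by blast
    then show "n \<oplus>\<^bsub>M\<^esub> l \<in> C" by (simp add: Q'_def)
  qed
qed

section \<open>Independent sequences\<close>

primrec psum :: "(nat \<Rightarrow> 'c) \<Rightarrow> nat \<Rightarrow> 'c" where
  "psum f 0 = \<zero>\<^bsub>M\<^esub>"
| "psum f (Suc n) = psum f n \<oplus>\<^bsub>M\<^esub> f n"

lemma psum_closed: "(\<And>k. f k \<in> carrier M) \<Longrightarrow> psum f n \<in> carrier M"
  by (induction n) auto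

lemma psum_affine:
  assumes "\<And>k. f k \<in> carrier M" "\<And>k. g k \<in> carrier M" "\<And>k. h k \<in> carrier M" "r \<in> carrier R"
  shows "psum (\<lambda>k. f k \<oplus>\<^bsub>M\<^esub> r \<odot>\<^bsub>M\<^esub> (g k \<ominus>\<^bsub>M\<^esub> h k)) n =
    psum f n \<oplus>\<^bsub>M\<^esub> r \<odot>\<^bsub>M\<^esub> (psum g n \<ominus>\<^bsub>M\<^esub> psum h n)"
  by (induction n) (use assms in \<open>simp_all add: affine_add psum_closed\<close>)

lemma psum_pad: "n \<le> n' \<Longrightarrow> (\<And>k. f k \<in> carrier M) \<Longrightarrow> (\<And>k. n \<le> k \<Longrightarrow> f k = \<zero>\<^bsub>M\<^esub>) \<Longrightarrow> psum f n' = psum f n"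
  by (induction n' rule: dec_induct) (auto simp: psum_closed)

lemma psum_cong: "(\<And>k. k < n \<Longrightarrow> f k = g k) \<Longrightarrow> psum f n = psum g n"
  by (induction n) auto

text \<open>Solve the vanishing sum for its first remaining term. In the applications B contains all
  later terms, and membership of this one in B is the contradiction that proves
  independence.\<close>

lemma psum_isolate:
  assumes B: "submodule B R M" and f: "\<And>k. f k \<in> carrier M"
    and low: "\<And>j. j < k \<Longrightarrow> f j = \<zero>\<^bsub>M\<^esub>" and high: "\<And>j. k < j \<Longrightarrow> j < n \<Longrightarrow> f j \<in> B"
    and k: "k < n" and s: "psum f n = \<zero>\<^bsub>M\<^esub>"
  shows "f k \<in> B"
proof -
  note SB = submodule_simps[OF B]
  have "psum f k = \<zero>\<^bsub>M\<^esub>" using low by (induction k) auto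
  then have start: "psum f (Suc k) = f k" using f by simp
  have "\<exists>b\<in>B. psum f m = f k \<oplus>\<^bsub>M\<^esub> b" if "Suc k \<le> m" "m \<le> n" for m
    using that
  proof (induction m rule: dec_induct)
    case base
    then show ?case using start f SB(2) by (intro bexI[of _ "\<zero>\<^bsub>M\<^esub>"]) auto
  next
    case (step m)
    then obtain b where b: "b \<in> B" "psum f m = f k \<oplus>\<^bsub>M\<^esub> b" by auto
    have fm: "f m \<in> B" using high[of m] step by simp
    have "psum f (Suc m) = f k \<oplus>\<^bsub>M\<^esub> (b \<oplus>\<^bsub>M\<^esub> f m)"
      using b(2) f SB(1)[OF b(1)] by (simp add: M.a_assoc)
    then show ?case using SB(3)[OF b(1) fm] by blast
  qed
  from this[of n] k obtain b where b: "b \<in> B" "f k \<oplus>\<^bsub>M\<^esub> b = \<zero>\<^bsub>M\<^esub>" using s by auto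
  then have "f k = \<ominus>\<^bsub>M\<^esub> b" using M.minus_equality[of "f k" b] f SB(1)[OF b(1)] by simp
  then show ?thesis using SB(4)[OF b(1)] by simp
qed

text \<open>The sum of the cyclic submodules is direct. Terms instead of coefficients are
  quantified, since coefficients are determined only modulo annihilators.\<close>

definition independent :: "(nat \<Rightarrow> 'c) \<Rightarrow> bool" where
  "independent w \<longleftrightarrow> (\<forall>n f. (\<forall>k. f k \<in> cyclic (w k)) \<longrightarrow> psum f n = \<zero>\<^bsub>M\<^esub> \<longrightarrow> (\<forall>k<n. f k = \<zero>\<^bsub>M\<^esub>))"

lemma independentD:
  "independent w \<Longrightarrow> \<forall>k. f k \<in> cyclic (w k) \<Longrightarrow> psum f n = \<zero>\<^bsub>M\<^esub> \<Longrightarrow> k < n \<Longrightarrow> f k = \<zero>\<^bsub>M\<^esub>"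
  unfolding independent_def by simp

text \<open>A common element of the members of the family below would be the infinite sum of the
  sequence, yet it lies in the span of finitely many terms.\<close>

lemma linearly_compact_no_independent:
  assumes lc: "linearly_compact R M (carrier M)" and w: "\<And>k. w k \<in> carrier M" "\<And>k. w k \<noteq> \<zero>\<^bsub>M\<^esub>"
  shows "\<not> independent w"
proof
  assume ind: "independent w"
  \<comment> \<open>The finite sums that follow \<open>w\<close> in the first m places: a coset of
    the span of the remaining terms.\<close>
  define C where "C m = {psum f n |n f. m \<le> n \<and> (\<forall>k. f k \<in> cyclic (w k)) \<and> (\<forall>k<m. f k = w k)}" for m
  have sub: "submodule (cyclic (w k)) R M" for k by (rule cyclic_submodule[OF w(1)])
  have fM: "f k \<in> carrier M" if "\<forall>k. f k \<in> cyclic (w k)" for f k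
    using that submodule_carrier[OF sub] by blast
  \<comment> \<open>Sums of different lengths are filled up with zeros so that they can be combined
    term by term.\<close>
  define pad where "pad f n k = (if k < n then f k else \<zero>\<^bsub>M\<^esub>)" for f :: "nat \<Rightarrow> 'c" and n k :: nat
  have pad: "\<forall>k. pad f n k \<in> cyclic (w k)" "\<And>n'. n \<le> n' \<Longrightarrow> psum (pad f n) n' = psum f n"
    if "\<forall>k. f k \<in> cyclic (w k)" for f n
  proof -
    show 1: "\<forall>k. pad f n k \<in> cyclic (w k)" using that submodule_zero[OF sub] by (simp add: pad_def)
    fix n' assume "n \<le> n'"
    then have "psum (pad f n) n' = psum (pad f n) n"
      by (rule psum_pad[OF _ fM[OF 1]]) (simp add: pad_def)
    also have "\<dots> = psum f n" by (rule psum_cong) (simp add: pad_def)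
    finally show "psum (pad f n) n' = psum f n" .
  qed
  obtain x where x: "\<And>X. X \<in> range C \<Longrightarrow> x \<in> X"
  proof (rule linearly_compactD[OF lc, of "range C"])
    have CM: "C m \<subseteq> carrier M" for m unfolding C_def using psum_closed fM by auto
    then show "\<And>X. X \<in> range C \<Longrightarrow> X \<subseteq> carrier M" by blast
    fix X assume "X \<in> range C"
    then obtain m where m: "X = C m" by blast
    show "affine_subset R M X" unfolding m
    proof (rule affineI[OF CM])
      have "psum w m \<in> C m" unfolding C_def using cyclic_self[OF w(1)] by blast
      then show "C m \<noteq> {}" by blast
      fix x y z r assume "x \<in> C m" "y \<in> C m" "z \<in> C m" and r: "r \<in> carrier R"
      then obtain nx ny nz f g h where
        x: "x = psum f nx" "m \<le> nx" "\<forall>k. f k \<in> cyclic (w k)" "\<forall>k<m. f k = w k" and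
        y: "y = psum g ny" "m \<le> ny" "\<forall>k. g k \<in> cyclic (w k)" "\<forall>k<m. g k = w k" and
        z: "z = psum h nz" "m \<le> nz" "\<forall>k. h k \<in> cyclic (w k)" "\<forall>k<m. h k = w k"
        unfolding C_def by blast
      let ?n = "nx + ny + nz" and ?f = "pad f nx" and ?g = "pad g ny" and ?h = "pad h nz"
      let ?e = "\<lambda>k. ?f k \<oplus>\<^bsub>M\<^esub> r \<odot>\<^bsub>M\<^esub> (?g k \<ominus>\<^bsub>M\<^esub> ?h k)"
      have "psum ?e ?n = x \<oplus>\<^bsub>M\<^esub> r \<odot>\<^bsub>M\<^esub> (y \<ominus>\<^bsub>M\<^esub> z)"
        unfolding psum_affine[OF fM[OF pad(1)[OF x(3)]] fM[OF pad(1)[OF y(3)]] fM[OF pad(1)[OF z(3)]] r]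
        using pad(2)[OF x(3), of nx ?n] pad(2)[OF y(3), of ny ?n] pad(2)[OF z(3), of nz ?n] x y z by simp
      moreover have "\<forall>k. ?e k \<in> cyclic (w k)"
        by (intro allI submodule_add[OF sub] submodule_smult[OF sub r] submodule_minus[OF sub]
            pad(1)[OF x(3), rule_format] pad(1)[OF y(3), rule_format] pad(1)[OF z(3), rule_format])
      moreover have "\<forall>k<m. ?e k = w k"
        using x y z r w(1) by (simp add: pad_def)
      moreover have "m \<le> ?n" using x by simp
      ultimately show "x \<oplus>\<^bsub>M\<^esub> r \<odot>\<^bsub>M\<^esub> (y \<ominus>\<^bsub>M\<^esub> z) \<in> C m"
        unfolding C_def mem_Collect_eq by (intro exI[of _ ?n] exI[of _ ?e]) simp
    qed
  next
    fix X Y assume "X \<in> range C" "Y \<in> range C"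
    then obtain m m' where m: "X = C m" "Y = C m'" by blast
    have "C (max m m') \<subseteq> C m" "C (max m m') \<subseteq> C m'" unfolding C_def by fastforce+
    then show "\<exists>E\<in>range C. E \<subseteq> X \<and> E \<subseteq> Y" unfolding m by blast
  qed blast
  have "x \<in> C 0" using x by blast
  then obtain n f where f: "x = psum f n" "\<forall>k. f k \<in> cyclic (w k)" unfolding C_def by blast
  have "x \<in> C (Suc n)" using x by blast
  then obtain n' g where g: "x = psum g n'" "Suc n \<le> n'" "\<forall>k. g k \<in> cyclic (w k)" "g n = w n"
    unfolding C_def by blast
  let ?f = "pad f n"
  \<comment> \<open>The two expressions for x have n-th terms 0 and \<open>w n\<close>. The added
    zero and the scalar 1 only match the form of \<open>psum_affine\<close>.\<close>
  let ?d = "\<lambda>k. \<zero>\<^bsub>M\<^esub> \<oplus>\<^bsub>M\<^esub> \<one> \<odot>\<^bsub>M\<^esub> (?f k \<ominus>\<^bsub>M\<^esub> g k)"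
  have cl: "?f k \<in> carrier M" "g k \<in> carrier M" for k using fM[OF pad(1)[OF f(2)]] fM[OF g(3)] by auto
  have "psum (\<lambda>k. \<zero>\<^bsub>M\<^esub>) n' = \<zero>\<^bsub>M\<^esub>" by (induction n') auto
  then have d1: "psum ?d n' = \<zero>\<^bsub>M\<^esub>"
    using psum_affine[of "\<lambda>k. \<zero>\<^bsub>M\<^esub>" ?f g \<one> n'] cl pad(2)[OF f(2), of n n'] f(1) g(1,2) psum_closed[of f n, OF fM[OF f(2)]]
    by simp
  have d2: "\<forall>k. ?d k \<in> cyclic (w k)"
    by (intro allI submodule_add[OF sub] submodule_zero[OF sub] submodule_smult[OF sub] submodule_minus[OF sub]
        pad(1)[OF f(2), rule_format] g(3)[rule_format] one_closed)
  have "n < n'" using g(2) by simp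
  from independentD[OF ind d2 d1 this] have "?d n = \<zero>\<^bsub>M\<^esub>" .
  then have "?f n = g n" using cl by simp
  then show False using g(4) w(2)[of n] by (simp add: pad_def)
qed

end

context root_module
begin

text \<open>Either some member lies in a cyclic submodule P y, and it and the members inside it pull
  back along r |-> r y to cosets of the linearly compact ring; or no member does, and then every
  member contains 0.\<close>

lemma basic_linearly_compact:
  assumes U: "submodule U R M" and b: "basic R (M\<lparr>carrier := U\<rparr>)"
  shows "linearly_compact R M U"
  unfolding linearly_compact_def
proof (intro allI impI)
  fix F assume F: "(\<forall>C\<in>F. C \<subseteq> U \<and> affine_subset R M C) \<and> down_directed F"
  have sub: "C \<subseteq> U" and aff: "affine_subset R M C" if "C \<in> F" for C using F that by auto
  have dir: "\<exists>E\<in>F. E \<subseteq> C \<inter> C'" if "C \<in> F" "C' \<in> F" for C C'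
    using F that unfolding down_directed_def by blast
  note SU = submodule_simps[OF U]
  have subM: "C \<subseteq> carrier M" if "C \<in> F" for C using sub[OF that] SU(1) by blast
  have uni: "x \<in> cyclic y \<or> y \<in> cyclic x" if "x \<in> U" "y \<in> U" for x y
    using b that unfolding basic_iff by blast
  show "\<exists>x\<in>U. \<forall>C\<in>F. x \<in> C"
  proof (cases "\<exists>C\<in>F. \<exists>y\<in>U. C \<subseteq> cyclic y")
    case True
    then obtain C1 y where C1: "C1 \<in> F" "y \<in> U" "C1 \<subseteq> cyclic y" by blast
    have y: "y \<in> carrier M" using SU(1) C1 by blast
    define Q where "Q C = {r \<in> carrier R. r \<odot>\<^bsub>M\<^esub> y \<in> C}" for C
    let ?G = "Q ` {C \<in> F. C \<subseteq> C1}"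
    have "\<exists>r\<in>carrier R. \<forall>X\<in>?G. r \<in> X"
    proof (rule ring_linearly_compact[unfolded linearly_compact_def, rule_format], intro conjI ballI)
      show "down_directed ?G" unfolding down_directed_def
      proof (intro ballI)
        fix X Y assume "X \<in> ?G" "Y \<in> ?G"
        then obtain C C' where C: "C \<in> F" "C' \<in> F" "C \<subseteq> C1" "X = Q C" "Y = Q C'" by blast
        from dir[OF C(1,2)] obtain E where E: "E \<in> F" "E \<subseteq> C \<inter> C'" by blast
        then have "Q E \<in> ?G" using C by blast
        moreover have "Q E \<subseteq> X \<inter> Y" using E by (auto simp: C Q_def)
        ultimately show "\<exists>E\<in>?G. E \<subseteq> X \<inter> Y" by blast
      qed
      fix X assume "X \<in> ?G"
      then obtain C where C: "C \<in> F" "C \<subseteq> C1" "X = Q C" by blast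
      show "X \<subseteq> carrier R" by (auto simp: C Q_def)
      obtain x where x: "x \<in> C" using affine_nonempty[OF aff[OF C(1)]] ..
      then obtain r where "r \<in> carrier R" "x = r \<odot>\<^bsub>M\<^esub> y" using C C1 unfolding cyclic_def by blast
      then have "r \<in> X" using x by (simp add: C Q_def)
      moreover have "a \<oplus> (r \<otimes> b \<oplus> (\<ominus> r) \<otimes> c) \<in> X"
        if abc: "a \<in> X" "b \<in> X" "c \<in> X" and r: "r \<in> carrier R" for a b c r
      proof -
        have cl: "a \<in> carrier R" "b \<in> carrier R" "c \<in> carrier R"
          "a \<odot>\<^bsub>M\<^esub> y \<in> C" "b \<odot>\<^bsub>M\<^esub> y \<in> C" "c \<odot>\<^bsub>M\<^esub> y \<in> C" using abc by (auto simp: C Q_def)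
        have "a \<odot>\<^bsub>M\<^esub> y \<oplus>\<^bsub>M\<^esub> r \<odot>\<^bsub>M\<^esub> (b \<odot>\<^bsub>M\<^esub> y \<ominus>\<^bsub>M\<^esub> c \<odot>\<^bsub>M\<^esub> y) \<in> C"
          by (rule affineD[OF aff[OF C(1)] subM[OF C(1)] cl(4,5,6) r])
        also have "a \<odot>\<^bsub>M\<^esub> y \<oplus>\<^bsub>M\<^esub> r \<odot>\<^bsub>M\<^esub> (b \<odot>\<^bsub>M\<^esub> y \<ominus>\<^bsub>M\<^esub> c \<odot>\<^bsub>M\<^esub> y) = (a \<oplus> (r \<otimes> b \<oplus> (\<ominus> r) \<otimes> c)) \<odot>\<^bsub>M\<^esub> y"
          using cl(1-3) r y
          by (simp add: a_minus_def smult_l_distr smult_r_distr smult_l_minus smult_r_minus smult_assoc1 R.l_minus)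
        finally show ?thesis using cl r by (simp add: C Q_def)
      qed
      ultimately show "affine_subset R (regular_module R) X"
        unfolding affine_subset_def by auto
    qed
    then obtain r where r: "r \<in> carrier R" "\<And>C. C \<in> F \<Longrightarrow> C \<subseteq> C1 \<Longrightarrow> r \<odot>\<^bsub>M\<^esub> y \<in> C"
      unfolding Q_def by auto
    show ?thesis
    proof (intro bexI ballI)
      show "r \<odot>\<^bsub>M\<^esub> y \<in> U" by (rule SU(6)[OF r(1) C1(2)])
      fix C assume "C \<in> F"
      from dir[OF this C1(1)] obtain E where "E \<in> F" "E \<subseteq> C \<inter> C1" by blast
      then show "r \<odot>\<^bsub>M\<^esub> y \<in> C" using r(2)[of E] by blast
    qed
  next
    case False
    have "\<zero>\<^bsub>M\<^esub> \<in> C" if C: "C \<in> F" for C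
    proof -
      obtain x where x: "x \<in> C" using affine_nonempty[OF aff[OF C]] ..
      then have xU: "x \<in> U" using sub[OF C] by blast
      \<comment> \<open>C is not inside P x, so it has a point z with x = c z and c a nonunit. Then
        1 - c is a unit and z - x = (1 - c) z, so x is a multiple of a difference within C;
        subtracting it from x stays in C and gives 0.\<close>
      with False C obtain z where z: "z \<in> C" "z \<notin> cyclic x" by blast
      then have zU: "z \<in> U" using sub[OF C] by blast
      have cl: "x \<in> carrier M" "z \<in> carrier M" using xU zU SU(1) by auto
      from uni[OF xU zU] z obtain c where c: "c \<in> carrier R" "x = c \<odot>\<^bsub>M\<^esub> z" unfolding cyclic_def by blast
      have "c \<notin> Units R"
      proof
        assume u: "c \<in> Units R"
        then have "z = inv c \<odot>\<^bsub>M\<^esub> x" using c cl by (simp add: smult_assoc1[symmetric])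
        then show False using z(2) u unfolding cyclic_def by blast
      qed
      then have d: "\<one> \<ominus> c \<in> Units R"
      proof -
        have "c \<oplus> (\<one> \<ominus> c) = \<one>" using c(1) by (simp add: a_minus_def R.a_comm[of \<one>] R.r_neg2)
        then show ?thesis using nonunit_add[of c "\<one> \<ominus> c"] c(1) \<open>c \<notin> Units R\<close> by auto
      qed
      define r where "r = c \<otimes> inv (\<one> \<ominus> c)"
      have r: "r \<in> carrier R" using c d by (simp add: r_def)
      have "r \<odot>\<^bsub>M\<^esub> (z \<ominus>\<^bsub>M\<^esub> x) = r \<odot>\<^bsub>M\<^esub> ((\<one> \<ominus> c) \<odot>\<^bsub>M\<^esub> z)"
        using c cl by (simp add: smult_minus_l_distr)
      also have "\<dots> = (c \<otimes> (inv (\<one> \<ominus> c) \<otimes> (\<one> \<ominus> c))) \<odot>\<^bsub>M\<^esub> z"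
        using c cl d r by (simp add: smult_assoc1[symmetric] r_def R.m_assoc)
      also have "\<dots> = x" using c d by simp
      finally have rx: "r \<odot>\<^bsub>M\<^esub> (z \<ominus>\<^bsub>M\<^esub> x) = x" .
      have "x \<oplus>\<^bsub>M\<^esub> (\<ominus> r) \<odot>\<^bsub>M\<^esub> (z \<ominus>\<^bsub>M\<^esub> x) \<in> C"
        by (rule affineD[OF aff[OF C] subM[OF C] x z(1) x]) (use r in simp)
      then show ?thesis using rx r cl by (simp add: smult_l_minus M.r_neg)
    qed
    then show ?thesis using SU(2) by blast
  qed
qed

lemma dsum_basic_linearly_compact:
  "dsum N Us \<Longrightarrow> (\<And>U. U \<in> set Us \<Longrightarrow> basic R (M\<lparr>carrier := U\<rparr>)) \<Longrightarrow> linearly_compact R M N"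
proof (induction Us arbitrary: N)
  case Nil then show ?case by (simp add: linearly_compact_zero)
next
  case (Cons U Us)
  then obtain V where "dsum V Us" "is_dsum N U V" by auto
  moreover from this have "linearly_compact R M V" using Cons by simp
  ultimately show ?case using Cons.prems(2)[of U]
    by (simp add: is_dsum_def linearly_compact_sumset basic_linearly_compact)
qed

end


section \<open>Pure basic submodules\<close>

lemma (in Module.module) psum_smult:
  assumes "\<And>k. f k \<in> carrier M" "r \<in> carrier R"
  shows "psum (\<lambda>k. r \<odot>\<^bsub>M\<^esub> f k) n = r \<odot>\<^bsub>M\<^esub> psum f n"
  by (induction n) (use assms in \<open>simp_all add: smult_r_distr psum_closed\<close>)

context root_module
begin

section \<open>Heights and elements of predictable divisibility\<close>

definition tmul :: "real \<Rightarrow> 'c set" where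
  "tmul h = {T h \<odot>\<^bsub>M\<^esub> m |m. m \<in> carrier M}"

lemma T_smult_add:
  "0 \<le> a \<Longrightarrow> 0 \<le> b \<Longrightarrow> x \<in> carrier M \<Longrightarrow> T (a + b) \<odot>\<^bsub>M\<^esub> x = T a \<odot>\<^bsub>M\<^esub> (T b \<odot>\<^bsub>M\<^esub> x)"
  by (simp add: T_add smult_assoc1)

lemma T_smult_diff:
  "0 \<le> a \<Longrightarrow> a \<le> b \<Longrightarrow> x \<in> carrier M \<Longrightarrow> T b \<odot>\<^bsub>M\<^esub> x = T a \<odot>\<^bsub>M\<^esub> (T (b - a) \<odot>\<^bsub>M\<^esub> x)"
  using T_smult_add[of a "b - a" x] by simp

lemma T_smult_diff':
  "0 \<le> a \<Longrightarrow> a \<le> b \<Longrightarrow> x \<in> carrier M \<Longrightarrow> T b \<odot>\<^bsub>M\<^esub> x = T (b - a) \<odot>\<^bsub>M\<^esub> (T a \<odot>\<^bsub>M\<^esub> x)"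
  using T_smult_add[of "b - a" a x] by simp

lemma tmul_submodule: assumes "0 \<le> h" shows "submodule (tmul h) R M"
proof (rule submoduleI')
  have Th: "T h \<in> carrier R" using assms by simp
  show "tmul h \<subseteq> carrier M" using Th by (auto simp: tmul_def)
  have "\<zero>\<^bsub>M\<^esub> = T h \<odot>\<^bsub>M\<^esub> \<zero>\<^bsub>M\<^esub>" using Th by simp
  then show "\<zero>\<^bsub>M\<^esub> \<in> tmul h" unfolding tmul_def by blast
  fix a assume "a \<in> tmul h"
  then obtain m where m: "m \<in> carrier M" "a = T h \<odot>\<^bsub>M\<^esub> m" unfolding tmul_def by blast
  show "c \<odot>\<^bsub>M\<^esub> a \<in> tmul h" if c: "c \<in> carrier R" for c
  proof -
    have "c \<odot>\<^bsub>M\<^esub> a = T h \<odot>\<^bsub>M\<^esub> (c \<odot>\<^bsub>M\<^esub> m)"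
      using m c Th by (simp add: smult_assoc1[symmetric] R.m_comm)
    then show ?thesis unfolding tmul_def using m c by blast
  qed
  fix b assume "b \<in> tmul h"
  then obtain n where n: "n \<in> carrier M" "b = T h \<odot>\<^bsub>M\<^esub> n" unfolding tmul_def by blast
  have "a \<oplus>\<^bsub>M\<^esub> b = T h \<odot>\<^bsub>M\<^esub> (m \<oplus>\<^bsub>M\<^esub> n)" using m n Th by (simp add: smult_r_distr)
  then show "a \<oplus>\<^bsub>M\<^esub> b \<in> tmul h" unfolding tmul_def using m n by blast
qed

lemma tmulI: "m \<in> carrier M \<Longrightarrow> x = T h \<odot>\<^bsub>M\<^esub> m \<Longrightarrow> x \<in> tmul h"
  unfolding tmul_def by blast

lemma tmulE: assumes "x \<in> tmul h" obtains m where "m \<in> carrier M" "x = T h \<odot>\<^bsub>M\<^esub> m"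
  using assms unfolding tmul_def by blast

lemma tmul_antimono:
  assumes "0 \<le> h" "h \<le> h'" shows "tmul h' \<subseteq> tmul h"
proof
  fix x assume "x \<in> tmul h'"
  then obtain m where m: "m \<in> carrier M" "x = T h' \<odot>\<^bsub>M\<^esub> m" by (rule tmulE)
  then show "x \<in> tmul h" using assms T_smult_diff[of h h' m] by (intro tmulI[of "T (h' - h) \<odot>\<^bsub>M\<^esub> m"]) auto
qed

lemma tmul_smult:
  assumes "0 \<le> b" "0 \<le> h" "x \<in> tmul h" shows "T b \<odot>\<^bsub>M\<^esub> x \<in> tmul (b + h)"
proof -
  obtain m where "m \<in> carrier M" "x = T h \<odot>\<^bsub>M\<^esub> m" using assms(3) by (rule tmulE)
  then show ?thesis using T_smult_add[of b h m] assms(1,2) by (intro tmulI[of m]) auto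
qed

lemma tmul_carrier: "0 \<le> h \<Longrightarrow> x \<in> tmul h \<Longrightarrow> x \<in> carrier M"
  using submodule_carrier[OF tmul_submodule] .

lemma unit_smult_mem:
  assumes N: "submodule N R M" and u: "u \<in> Units R" and x: "x \<in> carrier M" "u \<odot>\<^bsub>M\<^esub> x \<in> N"
  shows "x \<in> N"
proof -
  have "inv u \<odot>\<^bsub>M\<^esub> (u \<odot>\<^bsub>M\<^esub> x) \<in> N" by (rule submodule_smult[OF N Units_inv_closed[OF u] x(2)])
  moreover have "inv u \<odot>\<^bsub>M\<^esub> (u \<odot>\<^bsub>M\<^esub> x) = x"
    using smult_assoc1[of "inv u" u x] u Units_closed[OF u] x(1) by simp
  ultimately show ?thesis by simp
qed

text \<open>The height of a stable element grows no faster than forced when it is multiplied by a power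
  of the root, as long as the product does not vanish.\<close>

definition stable :: "'c \<Rightarrow> bool" where
  "stable x \<longleftrightarrow> x \<in> carrier M \<and> x \<noteq> \<zero>\<^bsub>M\<^esub> \<and>
    (\<forall>b\<ge>0. \<forall>h\<ge>0. T b \<odot>\<^bsub>M\<^esub> x \<noteq> \<zero>\<^bsub>M\<^esub> \<longrightarrow> T b \<odot>\<^bsub>M\<^esub> x \<in> tmul (b + h) \<longrightarrow> x \<in> tmul h)"

text \<open>The exponents b at which the height of T b x exceeds the forced gain b by at least h.
  For x in M and h \<ge> 0 it is an up-set containing every nonnegative b that kills x; it shrinks
  as h grows, so the jump sets of x form a chain.\<close>

definition jump :: "'c \<Rightarrow> real \<Rightarrow> real set" where
  "jump x h = {b. 0 \<le> b \<and> T b \<odot>\<^bsub>M\<^esub> x \<in> tmul (b + h)}"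

lemma jump_up:
  assumes "b \<in> jump x h" "b \<le> b'" "0 \<le> h" "x \<in> carrier M" shows "b' \<in> jump x h"
proof -
  have b: "0 \<le> b" "T b \<odot>\<^bsub>M\<^esub> x \<in> tmul (b + h)" using assms(1) by (auto simp: jump_def)
  have "T (b' - b) \<odot>\<^bsub>M\<^esub> (T b \<odot>\<^bsub>M\<^esub> x) \<in> tmul ((b' - b) + (b + h))"
    by (rule tmul_smult) (use b assms in auto)
  then show ?thesis using T_smult_diff'[of b b' x] b assms by (simp add: jump_def)
qed

lemma jump_antimono: assumes "0 \<le> h" "h \<le> h'" shows "jump x h' \<subseteq> jump x h"
proof
  fix b assume "b \<in> jump x h'"
  moreover from this have "tmul (b + h') \<subseteq> tmul (b + h)" using assms by (intro tmul_antimono) (auto simp: jump_def)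
  ultimately show "b \<in> jump x h" by (auto simp: jump_def)
qed

text \<open>For one pair b, h' a solution is T h' m, where T b x = T (b + h') m. The infimum of the
  exponents and the supremum of the heights need not be attained, so all pairs are imposed at once
  and linear compactness solves the system.\<close>

lemma replace_on_jump:
  assumes lc: "linearly_compact R M (carrier M)" and x: "x \<in> carrier M"
    and h: "0 \<le> h" and ne: "jump x h \<noteq> {}"
  shows "\<exists>z. z \<in> carrier M \<and> (\<forall>b\<in>jump x h. T b \<odot>\<^bsub>M\<^esub> z = T b \<odot>\<^bsub>M\<^esub> x) \<and>
    (\<forall>h'\<ge>0. jump x h \<subseteq> jump x h' \<longrightarrow> z \<in> tmul h')"
proof -
  define C where "C b h' = {z \<in> tmul h'. T b \<odot>\<^bsub>M\<^esub> z = T b \<odot>\<^bsub>M\<^esub> x}" for b h'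
  let ?F = "{C b h' |b h'. b \<in> jump x h \<and> 0 \<le> h' \<and> jump x h \<subseteq> jump x h'}"
  have b0: "0 \<le> b" if "b \<in> jump x h" for b h using that by (simp add: jump_def)
  obtain z where z: "z \<in> carrier M" "\<And>X. X \<in> ?F \<Longrightarrow> z \<in> X"
  proof (rule linearly_compactD[OF lc, of ?F])
    fix X assume "X \<in> ?F"
    then obtain b h' where bh: "X = C b h'" "b \<in> jump x h" "0 \<le> h'" "jump x h \<subseteq> jump x h'" by blast
    show XM: "X \<subseteq> carrier M" using tmul_carrier[OF bh(3)] by (auto simp: bh C_def)
    show "affine_subset R M X"
    proof (rule affineI[OF XM])
      have "T b \<odot>\<^bsub>M\<^esub> x \<in> tmul (b + h')" using bh by (auto simp: jump_def)
      then obtain m where m: "m \<in> carrier M" "T b \<odot>\<^bsub>M\<^esub> x = T (b + h') \<odot>\<^bsub>M\<^esub> m" by (rule tmulE)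
      then have "T h' \<odot>\<^bsub>M\<^esub> m \<in> X"
        using T_smult_add[OF b0[OF bh(2)] bh(3) m(1)] by (auto simp: bh C_def intro: tmulI)
      then show "X \<noteq> {}" by blast
      fix y1 y2 y3 r assume y: "y1 \<in> X" "y2 \<in> X" "y3 \<in> X" and r: "r \<in> carrier R"
      have cl: "y1 \<in> carrier M" "y2 \<in> carrier M" "y3 \<in> carrier M" using y XM by auto
      have "y1 \<oplus>\<^bsub>M\<^esub> r \<odot>\<^bsub>M\<^esub> (y2 \<ominus>\<^bsub>M\<^esub> y3) \<in> tmul h'"
        using y submodule_simps(3,5,6)[OF tmul_submodule[OF bh(3)]] r by (auto simp: bh C_def)
      moreover have "T b \<odot>\<^bsub>M\<^esub> (y1 \<oplus>\<^bsub>M\<^esub> r \<odot>\<^bsub>M\<^esub> (y2 \<ominus>\<^bsub>M\<^esub> y3)) = T b \<odot>\<^bsub>M\<^esub> x"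
        using y cl r x b0[OF bh(2)] by (simp add: affine_smult bh C_def)
      ultimately show "y1 \<oplus>\<^bsub>M\<^esub> r \<odot>\<^bsub>M\<^esub> (y2 \<ominus>\<^bsub>M\<^esub> y3) \<in> X" by (simp add: bh C_def)
    qed
  next
    \<comment> \<open>A smaller exponent and a larger height each strengthen the condition, so
      minimum and maximum give a common refinement.\<close>
    have mono: "C (min b b') (max k k') \<subseteq> C b k"
      if "0 \<le> b" "0 \<le> b'" "0 \<le> k" for b b' k k'
    proof
      fix z assume z: "z \<in> C (min b b') (max k k')"
      then have zt: "z \<in> tmul k" using tmul_antimono[of k "max k k'"] that by (auto simp: C_def)
      have zM: "z \<in> carrier M" using tmul_carrier[OF that(3) zt] .
      have "T b \<odot>\<^bsub>M\<^esub> z = T b \<odot>\<^bsub>M\<^esub> x"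
        using z T_smult_diff'[of "min b b'" b z] T_smult_diff'[of "min b b'" b x] that zM x
        by (simp add: C_def)
      then show "z \<in> C b k" using zt by (simp add: C_def)
    qed
    fix X Y assume "X \<in> ?F" "Y \<in> ?F"
    then obtain b k b' k' where bk: "X = C b k" "b \<in> jump x h" "0 \<le> k" "jump x h \<subseteq> jump x k"
      "Y = C b' k'" "b' \<in> jump x h" "0 \<le> k'" "jump x h \<subseteq> jump x k'" by blast
    have "min b b' \<in> jump x h" using bk by (simp add: min_def)
    moreover have "jump x h \<subseteq> jump x (max k k')" "0 \<le> max k k'" using bk by (auto simp: max_def)
    ultimately have "C (min b b') (max k k') \<in> ?F" by blast
    moreover have "C (min b b') (max k k') \<subseteq> X" "C (min b b') (max k k') \<subseteq> Y"
      using mono[of b b' k k'] mono[of b' b k' k] bk b0 by (auto simp: min.commute max.commute)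
    ultimately show "\<exists>E\<in>?F. E \<subseteq> X \<and> E \<subseteq> Y" by blast
  qed blast
  show ?thesis
  proof (intro exI[of _ z] conjI ballI allI impI z(1))
    fix b assume "b \<in> jump x h"
    then have "C b h \<in> ?F" using h by blast
    then show "T b \<odot>\<^bsub>M\<^esub> z = T b \<odot>\<^bsub>M\<^esub> x" using z(2)[of "C b h"] by (simp add: C_def)
  next
    fix h' assume "0 \<le> h'" "jump x h \<subseteq> jump x h'"
    moreover obtain b where "b \<in> jump x h" using ne by blast
    ultimately have "C b h' \<in> ?F" by blast
    then show "z \<in> tmul h'" using z(2)[of "C b h'"] by (simp add: C_def)
  qed
qed

text \<open>Without stable elements, \<open>x\<close> can be replaced again and again by an element with the same multiples
  on the current jump set but with a smaller jump set. The differences of consecutive elements have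
  annihilators and heights so far apart that they are independent.\<close>

lemma exists_stable:
  assumes lc: "linearly_compact R M (carrier M)" and nz: "carrier M \<noteq> {\<zero>\<^bsub>M\<^esub>}"
  shows "\<exists>x. stable x"
proof (rule ccontr)
  assume ns: "\<not> ?thesis"
  obtain x where x: "x \<in> carrier M" "x \<noteq> \<zero>\<^bsub>M\<^esub>" using nz M.zero_closed by blast
  \<comment> \<open>The nonzero multiple of x at an exponent of the jump set guarantees that the
    element replacing x is nonzero, and hence unstable by assumption.\<close>
  define I where "I h \<longleftrightarrow> 0 \<le> h \<and> (\<exists>b\<in>jump x h. T b \<odot>\<^bsub>M\<^esub> x \<noteq> \<zero>\<^bsub>M\<^esub>)" for h
  have step: "\<exists>h'. I h' \<and> jump x h' \<subset> jump x h" if Ih: "I h" for h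
  proof -
    have h: "0 \<le> h" using Ih by (simp add: I_def)
    obtain b2 where b2: "b2 \<in> jump x h" "T b2 \<odot>\<^bsub>M\<^esub> x \<noteq> \<zero>\<^bsub>M\<^esub>" using Ih by (auto simp: I_def)
    have b20: "0 \<le> b2" using b2 by (simp add: jump_def)
    have jne: "jump x h \<noteq> {}" using b2 by blast
    obtain z where z: "z \<in> carrier M" "\<And>b. b \<in> jump x h \<Longrightarrow> T b \<odot>\<^bsub>M\<^esub> z = T b \<odot>\<^bsub>M\<^esub> x"
      "\<And>h'. 0 \<le> h' \<Longrightarrow> jump x h \<subseteq> jump x h' \<Longrightarrow> z \<in> tmul h'"
      using replace_on_jump[OF lc x(1) h jne] by blast
    have "z \<noteq> \<zero>\<^bsub>M\<^esub>" using z(2)[OF b2(1)] b2(2) b20 by auto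
    with ns z(1) obtain b1 h' where b1: "0 \<le> b1" "0 \<le> h'" "T b1 \<odot>\<^bsub>M\<^esub> z \<noteq> \<zero>\<^bsub>M\<^esub>"
      "T b1 \<odot>\<^bsub>M\<^esub> z \<in> tmul (b1 + h')" "z \<notin> tmul h'" unfolding stable_def by blast
    \<comment> \<open>The instability of z is moved into the jump set: an exponent outside it lies
      below \<open>b2\<close> and can be raised to \<open>b2\<close>, where the multiple is still
      nonzero.\<close>
    have "\<exists>b. b \<in> jump x h \<and> T b \<odot>\<^bsub>M\<^esub> z \<noteq> \<zero>\<^bsub>M\<^esub> \<and> T b \<odot>\<^bsub>M\<^esub> z \<in> tmul (b + h')"
    proof (cases "b1 \<in> jump x h")
      case True with b1 show ?thesis by blast
    next
      case False
      then have "b1 \<le> b2" using jump_up[OF b2(1) _ h x(1), of b1] by force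
      then have "T b2 \<odot>\<^bsub>M\<^esub> z = T (b2 - b1) \<odot>\<^bsub>M\<^esub> (T b1 \<odot>\<^bsub>M\<^esub> z)" using T_smult_diff' b1 z(1) by blast
      moreover have "T (b2 - b1) \<odot>\<^bsub>M\<^esub> (T b1 \<odot>\<^bsub>M\<^esub> z) \<in> tmul ((b2 - b1) + (b1 + h'))"
        by (rule tmul_smult) (use b1 \<open>b1 \<le> b2\<close> in auto)
      ultimately have "T b2 \<odot>\<^bsub>M\<^esub> z \<in> tmul (b2 + h')" by simp
      then show ?thesis using b2 z(2)[OF b2(1)] by auto
    qed
    then obtain b where b: "b \<in> jump x h" "T b \<odot>\<^bsub>M\<^esub> z \<noteq> \<zero>\<^bsub>M\<^esub>" "T b \<odot>\<^bsub>M\<^esub> z \<in> tmul (b + h')" by blast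
    then have bx: "T b \<odot>\<^bsub>M\<^esub> x \<noteq> \<zero>\<^bsub>M\<^esub>" "T b \<odot>\<^bsub>M\<^esub> x \<in> tmul (b + h')" "0 \<le> b"
      using z(2)[OF b(1)] by (auto simp: jump_def)
    then have "b \<in> jump x h'" by (simp add: jump_def)
    then have "I h'" using bx(1) b1(2) by (auto simp: I_def)
    \<comment> \<open>An inclusion would give z the height h' by its choice. As jump sets form a
      chain, the new one is strictly smaller.\<close>
    moreover have "\<not> jump x h \<subseteq> jump x h'" using z(3) b1 by blast
    moreover from this have "jump x h' \<subseteq> jump x h"
      using jump_antimono[of h' h x] jump_antimono[of h h' x] b1 h by linarith
    ultimately show ?thesis by blast
  qed
  have "I 0"
  proof -
    have "x \<in> tmul 0" using x by (intro tmulI[of x]) (simp_all add: T_0)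
    then have "0 \<in> jump x 0" using x by (simp add: jump_def T_0)
    moreover have "T 0 \<odot>\<^bsub>M\<^esub> x \<noteq> \<zero>\<^bsub>M\<^esub>" using x by (simp add: T_0)
    ultimately show ?thesis unfolding I_def by auto
  qed
  have "\<exists>hs. \<forall>n::nat. I (hs n) \<and> jump x (hs (Suc n)) \<subset> jump x (hs n)"
    by (rule dependent_nat_choice[of "\<lambda>_. I" "\<lambda>_ h h'. jump x h' \<subset> jump x h"])
      (use \<open>I 0\<close> step in blast)+
  then obtain hs where hs: "\<And>n::nat. I (hs n)" "\<And>n. jump x (hs (Suc n)) \<subset> jump x (hs n)" by blast
  have h0: "0 \<le> hs n" for n using hs(1)[of n] by (simp add: I_def)
  have jdec: "jump x (hs n) \<subseteq> jump x (hs m)" if "m \<le> n" for m n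
    using lift_Suc_antimono_le[of "\<lambda>n. jump x (hs n)" m n] hs(2) that by blast
  have jne: "jump x (hs n) \<noteq> {}" for n using hs(1)[of n] by (auto simp: I_def)
  have "\<forall>n. \<exists>z. z \<in> carrier M \<and> (\<forall>b\<in>jump x (hs n). T b \<odot>\<^bsub>M\<^esub> z = T b \<odot>\<^bsub>M\<^esub> x) \<and>
    (\<forall>h'\<ge>0. jump x (hs n) \<subseteq> jump x h' \<longrightarrow> z \<in> tmul h')"
    using replace_on_jump[OF lc x(1) h0 jne] by simp
  from choice[OF this] obtain z where z: "\<And>n. z n \<in> carrier M"
    "\<And>n b. b \<in> jump x (hs n) \<Longrightarrow> T b \<odot>\<^bsub>M\<^esub> z n = T b \<odot>\<^bsub>M\<^esub> x"
    "\<And>n h'. 0 \<le> h' \<Longrightarrow> jump x (hs n) \<subseteq> jump x h' \<Longrightarrow> z n \<in> tmul h'" by blast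
  have zt: "z j \<in> tmul (hs k)" if "k \<le> j" for j k using z(3)[OF h0 jdec[OF that]] .
  \<comment> \<open>\<open>w k\<close> is killed by the exponents of the smaller jump set, while at
    exponents in the gap between the two sets its multiple misses the height that all later terms
    reach.\<close>
  define w where "w k = z k \<ominus>\<^bsub>M\<^esub> z (Suc k)" for k
  have wM: "w k \<in> carrier M" for k using z(1) by (simp add: w_def)
  have kill: "T b \<odot>\<^bsub>M\<^esub> w k = \<zero>\<^bsub>M\<^esub>" if b: "b \<in> jump x (hs (Suc k))" for b k
  proof -
    have "b \<in> jump x (hs k)" using b hs(2) by blast
    then have "T b \<odot>\<^bsub>M\<^esub> z k = T b \<odot>\<^bsub>M\<^esub> x" "T b \<odot>\<^bsub>M\<^esub> z (Suc k) = T b \<odot>\<^bsub>M\<^esub> x" using z(2) b by auto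
    moreover have "0 \<le> b" using b by (simp add: jump_def)
    ultimately show ?thesis using z(1) x by (simp add: w_def smult_minus_distr)
  qed
  have high: "T b \<odot>\<^bsub>M\<^esub> w k \<notin> tmul (b + hs (Suc k))"
    if b: "b \<in> jump x (hs k)" "b \<notin> jump x (hs (Suc k))" for b k
  proof
    assume a: "T b \<odot>\<^bsub>M\<^esub> w k \<in> tmul (b + hs (Suc k))"
    have b0: "0 \<le> b" using b by (simp add: jump_def)
    have sub: "submodule (tmul (b + hs (Suc k))) R M" by (rule tmul_submodule) (use b0 h0 in auto)
    have "T b \<odot>\<^bsub>M\<^esub> z (Suc k) \<in> tmul (b + hs (Suc k))" by (rule tmul_smult[OF b0 h0 zt]) simp
    from submodule_add[OF sub a this]
    have "T b \<odot>\<^bsub>M\<^esub> (w k \<oplus>\<^bsub>M\<^esub> z (Suc k)) \<in> tmul (b + hs (Suc k))"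
      using b0 wM z(1) by (simp add: smult_r_distr)
    moreover have "w k \<oplus>\<^bsub>M\<^esub> z (Suc k) = z k" using z(1) by (simp add: w_def a_minus_def M.a_assoc M.l_neg)
    ultimately have "T b \<odot>\<^bsub>M\<^esub> x \<in> tmul (b + hs (Suc k))" using z(2)[OF b(1)] by simp
    then show False using b b0 by (simp add: jump_def)
  qed
  have gap: "\<exists>b. b \<in> jump x (hs k) \<and> b \<notin> jump x (hs (Suc k))" for k using hs(2)[of k] by blast
  have w0: "w k \<noteq> \<zero>\<^bsub>M\<^esub>" for k
  proof
    assume "w k = \<zero>\<^bsub>M\<^esub>"
    moreover obtain b where b: "b \<in> jump x (hs k)" "b \<notin> jump x (hs (Suc k))" using gap by blast
    moreover have "0 \<le> b" using b by (simp add: jump_def)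
    ultimately show False using high[OF b] submodule_zero[OF tmul_submodule] h0 by simp
  qed
  have "independent w" unfolding independent_def
  proof (intro allI impI, rule ccontr)
    fix n f i assume f: "\<forall>k. f k \<in> cyclic (w k)" and s: "psum f n = \<zero>\<^bsub>M\<^esub>"
      and i: "i < n" "f i \<noteq> \<zero>\<^bsub>M\<^esub>"
    have fM: "f k \<in> carrier M" for k using f submodule_carrier[OF cyclic_submodule[OF wM]] by blast
    have "\<forall>k. \<exists>b u. f k \<noteq> \<zero>\<^bsub>M\<^esub> \<longrightarrow> u \<in> Units R \<and> 0 \<le> b \<and> f k = u \<odot>\<^bsub>M\<^esub> (T b \<odot>\<^bsub>M\<^esub> w k)"
    proof
      fix k
      obtain r where r: "r \<in> carrier R" "f k = r \<odot>\<^bsub>M\<^esub> w k" using f unfolding cyclic_def by blast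
      show "\<exists>b u. f k \<noteq> \<zero>\<^bsub>M\<^esub> \<longrightarrow> u \<in> Units R \<and> 0 \<le> b \<and> f k = u \<odot>\<^bsub>M\<^esub> (T b \<odot>\<^bsub>M\<^esub> w k)"
      proof (cases "r = \<zero>")
        case True then show ?thesis using r wM by simp
      next
        case False
        then obtain u b where ub: "u \<in> Units R" "0 \<le> b" "r = u \<otimes> T b" using unit_T_decomp r by blast
        then have "f k = u \<odot>\<^bsub>M\<^esub> (T b \<odot>\<^bsub>M\<^esub> w k)" using r wM Units_closed[OF ub(1)] by (simp add: smult_assoc1)
        with ub show ?thesis by blast
      qed
    qed
    from choice[OF this] obtain B where B: "\<forall>k. \<exists>u. f k \<noteq> \<zero>\<^bsub>M\<^esub> \<longrightarrow> u \<in> Units R \<and> 0 \<le> B k \<and> f k = u \<odot>\<^bsub>M\<^esub> (T (B k) \<odot>\<^bsub>M\<^esub> w k)"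
      by blast
    from choice[OF B] obtain u where ub: "\<And>k. f k \<noteq> \<zero>\<^bsub>M\<^esub> \<Longrightarrow> u k \<in> Units R \<and> 0 \<le> B k \<and> f k = u k \<odot>\<^bsub>M\<^esub> (T (B k) \<odot>\<^bsub>M\<^esub> w k)"
      by blast
    let ?K = "{k. k < n \<and> f k \<noteq> \<zero>\<^bsub>M\<^esub>}"
    have fin: "finite ?K" "?K \<noteq> {}" using i by auto
    \<comment> \<open>Among the nonzero terms take one with the smallest exponent and multiply the
      relation by \<open>T c\<close>, which moves this exponent to some e in the gap of its term.
      Earlier terms then vanish and later ones lie in \<open>tmul (e + hs (Suc k))\<close>, so the
      chosen term lies there too, against \<open>high\<close>.\<close>
    define k where "k = arg_min_on B ?K"
    have k: "k \<in> ?K" unfolding k_def by (rule arg_min_if_finite(1)[OF fin])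
    have kmin: "B k \<le> B j" if "j \<in> ?K" for j
      using arg_min_if_finite(2)[OF fin, of B] that unfolding k_def[symmetric] by (meson not_less)
    have kn: "k < n" "f k \<noteq> \<zero>\<^bsub>M\<^esub>" using k by auto
    note ubk = ub[OF kn(2)]
    have uk: "u k \<in> carrier R" using ubk by auto
    have Bk: "B k \<notin> jump x (hs (Suc k))"
      using kill[of "B k" k] ubk kn(2) uk by auto
    \<comment> \<open>If \<open>B k\<close> is outside the larger jump set, it lies below every
      exponent of that up-set, in particular below those in the gap.\<close>
    obtain e where e: "e \<in> jump x (hs k)" "e \<notin> jump x (hs (Suc k))" "B k \<le> e"
    proof (cases "B k \<in> jump x (hs k)")
      case True with Bk that[of "B k"] show ?thesis by simp
    next
      case False
      obtain b where b: "b \<in> jump x (hs k)" "b \<notin> jump x (hs (Suc k))" using gap by blast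
      then have "B k \<le> b" using False jump_up[OF b(1) _ h0 x(1), of "B k"] by force
      with b that[of b] show ?thesis by simp
    qed
    define c where "c = e - B k"
    have c0: "0 \<le> c" using e by (simp add: c_def)
    have e0: "0 \<le> e" using e by (simp add: jump_def)
    define g where "g j = T c \<odot>\<^bsub>M\<^esub> f j" for j
    have gM: "g j \<in> carrier M" for j using fM c0 by (simp add: g_def)
    have g_eq: "g j = u j \<odot>\<^bsub>M\<^esub> (T (c + B j) \<odot>\<^bsub>M\<^esub> w j)" if "f j \<noteq> \<zero>\<^bsub>M\<^esub>" for j
    proof -
      have u: "u j \<in> carrier R" "0 \<le> B j" "f j = u j \<odot>\<^bsub>M\<^esub> (T (B j) \<odot>\<^bsub>M\<^esub> w j)" using ub[OF that] by auto
      have "g j = u j \<odot>\<^bsub>M\<^esub> (T c \<odot>\<^bsub>M\<^esub> (T (B j) \<odot>\<^bsub>M\<^esub> w j))"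
        unfolding g_def u(3) using u c0 wM by (simp add: smult_assoc1[symmetric] R.m_lcomm R.m_assoc)
      then show ?thesis using T_smult_add[OF c0 u(2) wM] by simp
    qed
    have sub: "submodule (tmul (e + hs (Suc k))) R M" by (rule tmul_submodule) (use e0 h0 in auto)
    have "g k \<in> tmul (e + hs (Suc k))"
    proof (rule psum_isolate[OF sub gM _ _ kn(1)])
      show "psum g n = \<zero>\<^bsub>M\<^esub>" unfolding g_def using psum_smult[of f "T c" n, OF fM] s c0 by simp
      fix j
      show "g j = \<zero>\<^bsub>M\<^esub>" if j: "j < k"
      proof (cases "f j = \<zero>\<^bsub>M\<^esub>")
        case True then show ?thesis using c0 by (simp add: g_def)
      next
        case False
        then have "B k \<le> B j" using kmin j kn by simp
        then have "e \<le> c + B j" by (simp add: c_def)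
        then have "c + B j \<in> jump x (hs k)" by (rule jump_up[OF e(1) _ h0 x(1)])
        then have "c + B j \<in> jump x (hs (Suc j))" using jdec[of "Suc j" k] j by auto
        then show ?thesis using g_eq[OF False] kill ub[OF False] by auto
      qed
      show "g j \<in> tmul (e + hs (Suc k))" if j: "k < j" "j < n"
      proof (cases "f j = \<zero>\<^bsub>M\<^esub>")
        case True then show ?thesis using c0 submodule_zero[OF sub] by (simp add: g_def)
      next
        case False
        then have "B k \<le> B j" using kmin j kn by simp
        then have ecB: "e \<le> c + B j" by (simp add: c_def)
        have "w j \<in> tmul (hs (Suc k))" unfolding w_def
          by (rule submodule_minus[OF tmul_submodule[OF h0] zt zt]) (use j in auto)
        then have "T (c + B j) \<odot>\<^bsub>M\<^esub> w j \<in> tmul (c + B j + hs (Suc k))"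
          using tmul_smult[of "c + B j" "hs (Suc k)" "w j"] ecB e0 h0 by simp
        then have "T (c + B j) \<odot>\<^bsub>M\<^esub> w j \<in> tmul (e + hs (Suc k))"
          using tmul_antimono[of "e + hs (Suc k)" "c + B j + hs (Suc k)"] ecB e0 h0[of "Suc k"] by auto
        moreover have "u j \<in> carrier R" using ub[OF False] by auto
        ultimately show ?thesis unfolding g_eq[OF False] by (rule submodule_smult[OF sub, rotated])
      qed
    qed
    then have "u k \<odot>\<^bsub>M\<^esub> (T e \<odot>\<^bsub>M\<^esub> w k) \<in> tmul (e + hs (Suc k))"
      using g_eq[OF kn(2)] by (simp add: c_def)
    then have "T e \<odot>\<^bsub>M\<^esub> w k \<in> tmul (e + hs (Suc k))"
      using unit_smult_mem[OF sub conjunct1[OF ubk], of "T e \<odot>\<^bsub>M\<^esub> w k"] wM e0 by simp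
    with high[OF e(1,2)] show False ..
  qed
  with linearly_compact_no_independent[OF lc wM w0] show False ..
qed

text \<open>Relative divisibility: U meets sM exactly in sU for every scalar s.\<close>

definition pure :: "'c set \<Rightarrow> bool" where
  "pure U \<longleftrightarrow> (\<forall>u\<in>U. \<forall>s\<in>carrier R. \<forall>m\<in>carrier M. u = s \<odot>\<^bsub>M\<^esub> m \<longrightarrow> (\<exists>v\<in>U. u = s \<odot>\<^bsub>M\<^esub> v))"

text \<open>A nonzero scalar is a unit times some \<open>T h\<close>, and units do not affect
  divisibility.\<close>

lemma pureI:
  assumes U: "submodule U R M"
    and p: "\<And>u h. u \<in> U \<Longrightarrow> u \<noteq> \<zero>\<^bsub>M\<^esub> \<Longrightarrow> 0 \<le> h \<Longrightarrow> u \<in> tmul h \<Longrightarrow> \<exists>v\<in>U. u = T h \<odot>\<^bsub>M\<^esub> v"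
  shows "pure U"
  unfolding pure_def
proof (intro ballI impI)
  fix u s m assume u: "u \<in> U" and s: "s \<in> carrier R" and m: "m \<in> carrier M" "u = s \<odot>\<^bsub>M\<^esub> m"
  show "\<exists>v\<in>U. u = s \<odot>\<^bsub>M\<^esub> v"
  proof (cases "u = \<zero>\<^bsub>M\<^esub>")
    case True
    then show ?thesis using s submodule_zero[OF U] by (intro bexI[of _ "\<zero>\<^bsub>M\<^esub>"]) auto
  next
    case False
    then have "s \<noteq> \<zero>" using m by auto
    then obtain w h where w: "w \<in> Units R" "0 \<le> h" "s = w \<otimes> T h" using unit_T_decomp s by blast
    have wc: "w \<in> carrier R" "inv w \<in> carrier R" "T h \<in> carrier R" using w by auto
    have "u = T h \<odot>\<^bsub>M\<^esub> (w \<odot>\<^bsub>M\<^esub> m)" using m wc w(3) by (simp add: smult_assoc1[symmetric] R.m_comm)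
    then have "u \<in> tmul h" using m wc by (intro tmulI[of "w \<odot>\<^bsub>M\<^esub> m"]) auto
    from p[OF u False w(2) this] obtain v where v: "v \<in> U" "u = T h \<odot>\<^bsub>M\<^esub> v" ..
    have vM: "v \<in> carrier M" using submodule_carrier[OF U v(1)] .
    have "s \<odot>\<^bsub>M\<^esub> (inv w \<odot>\<^bsub>M\<^esub> v) = (w \<otimes> T h \<otimes> inv w) \<odot>\<^bsub>M\<^esub> v"
      using w(3) wc vM by (simp add: smult_assoc1)
    also have "w \<otimes> T h \<otimes> inv w = T h \<otimes> (w \<otimes> inv w)"
      using wc by (simp add: R.m_ac del: Units_l_inv Units_r_inv)
    finally have "s \<odot>\<^bsub>M\<^esub> (inv w \<odot>\<^bsub>M\<^esub> v) = u" using w(1) wc v(2) by simp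
    moreover have "inv w \<odot>\<^bsub>M\<^esub> v \<in> U" by (rule submodule_smult[OF U wc(2) v(1)])
    ultimately show ?thesis by metis
  qed
qed

end


section \<open>Dividing a stable element as far as possible\<close>

context root_module
begin

text \<open>For each p a candidate is \<open>T (p - q') m\<close> with y = T (p - q) m, and larger p
  give smaller cosets. Linear compactness yields one quotient that retains all divisibility still
  ahead, even when H has no maximum; H will be the set of heights of x.\<close>

lemma stable_divide_step:
  assumes lc: "linearly_compact R M (carrier M)"
    and y: "y \<in> carrier M" "T q \<odot>\<^bsub>M\<^esub> y = x" "\<And>p. p \<in> H \<Longrightarrow> q \<le> p \<Longrightarrow> y \<in> tmul (p - q)"
    and q: "0 \<le> q" "q \<le> q'" "q' \<in> H"
  shows "\<exists>y'. y' \<in> carrier M \<and> T q' \<odot>\<^bsub>M\<^esub> y' = x \<and> (\<forall>p\<in>H. q' \<le> p \<longrightarrow> y' \<in> tmul (p - q')) \<and>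
    y = T (q' - q) \<odot>\<^bsub>M\<^esub> y'"
proof -
  define C where "C p = {y' \<in> tmul (p - q'). T (q' - q) \<odot>\<^bsub>M\<^esub> y' = y}" for p
  let ?F = "{C p |p. p \<in> H \<and> q' \<le> p}"
  obtain y' where y': "y' \<in> carrier M" "\<And>X. X \<in> ?F \<Longrightarrow> y' \<in> X"
  proof (rule linearly_compactD[OF lc, of ?F])
    fix X assume "X \<in> ?F"
    then obtain p where p: "X = C p" "p \<in> H" "q' \<le> p" by blast
    have sub: "submodule (tmul (p - q')) R M" by (rule tmul_submodule) (use p in auto)
    show XM: "X \<subseteq> carrier M" using submodule_carrier[OF sub] by (auto simp: p C_def)
    show "affine_subset R M X"
    proof (rule affineI[OF XM])
      have "y \<in> tmul (p - q)" using y(3) p q by auto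
      then obtain m where m: "m \<in> carrier M" "y = T (p - q) \<odot>\<^bsub>M\<^esub> m" by (rule tmulE)
      then have "y = T (q' - q) \<odot>\<^bsub>M\<^esub> (T (p - q') \<odot>\<^bsub>M\<^esub> m)"
        using T_smult_diff[of "q' - q" "p - q" m] q p by simp
      then have "T (p - q') \<odot>\<^bsub>M\<^esub> m \<in> X" using m by (auto simp: p C_def intro: tmulI)
      then show "X \<noteq> {}" by blast
      fix y1 y2 y3 r assume ys: "y1 \<in> X" "y2 \<in> X" "y3 \<in> X" and r: "r \<in> carrier R"
      have cl: "y1 \<in> carrier M" "y2 \<in> carrier M" "y3 \<in> carrier M" using ys XM by auto
      have "y1 \<oplus>\<^bsub>M\<^esub> r \<odot>\<^bsub>M\<^esub> (y2 \<ominus>\<^bsub>M\<^esub> y3) \<in> tmul (p - q')"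
        using ys submodule_simps(3,5,6)[OF sub] r by (auto simp: p C_def)
      moreover have "T (q' - q) \<odot>\<^bsub>M\<^esub> (y1 \<oplus>\<^bsub>M\<^esub> r \<odot>\<^bsub>M\<^esub> (y2 \<ominus>\<^bsub>M\<^esub> y3)) = y"
        using ys cl r y(1) q by (simp add: affine_smult p C_def)
      ultimately show "y1 \<oplus>\<^bsub>M\<^esub> r \<odot>\<^bsub>M\<^esub> (y2 \<ominus>\<^bsub>M\<^esub> y3) \<in> X" by (simp add: p C_def)
    qed
  next
    fix X Y assume "X \<in> ?F" "Y \<in> ?F"
    then obtain p p' where p: "X = C p" "p \<in> H" "q' \<le> p" "Y = C p'" "p' \<in> H" "q' \<le> p'" by blast
    have "C (max p p') \<in> ?F" using p by (auto simp: max_def)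
    moreover have "C (max p p') \<subseteq> C p" "C (max p p') \<subseteq> C p'"
      using tmul_antimono[of "p - q'" "max p p' - q'"] tmul_antimono[of "p' - q'" "max p p' - q'"] p
      by (auto simp: C_def)
    ultimately show "\<exists>E\<in>?F. E \<subseteq> X \<and> E \<subseteq> Y" using p by blast
  qed blast
  have "C q' \<in> ?F" using q by blast
  then have yq: "y = T (q' - q) \<odot>\<^bsub>M\<^esub> y'" using y'(2)[of "C q'"] by (simp add: C_def)
  show ?thesis
  proof (intro exI[of _ y'] conjI ballI impI y'(1) yq)
    show "T q' \<odot>\<^bsub>M\<^esub> y' = x" using yq y(2) T_smult_diff[OF q(1,2) y'(1)] by simp
    fix p assume "p \<in> H" "q' \<le> p"
    then have "C p \<in> ?F" by blast
    then show "y' \<in> tmul (p - q')" using y'(2)[of "C p"] by (simp add: C_def)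
  qed
qed

text \<open>Countable cofinality of bounded sets of reals lets the tower of quotients be indexed by
  the naturals. An attained supremum is taken at once, since approximations from below need not
  reach it.\<close>

lemma cofinal_sequence_step:
  fixes H :: "real set"
  assumes "H \<noteq> {}" "bdd_above H"
  shows "\<exists>q\<in>H. (Sup H \<in> H \<longrightarrow> q = Sup H) \<and> Sup H - inverse (real (Suc n)) < q"
proof (cases "Sup H \<in> H")
  case True then show ?thesis by (intro bexI[of _ "Sup H"]) auto
next
  case False
  have "Sup H - inverse (real (Suc n)) < Sup H" by simp
  then obtain q where "q \<in> H" "Sup H - inverse (real (Suc n)) < q"
    using less_cSup_iff[OF assms] by blast
  with False show ?thesis by blast
qed

text \<open>x is divided along a sequence cofinal in its heights, and U is the union of the cyclic
  modules of the quotients. A union of a chain of cyclic modules over a uniserial ring is basic;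
  cofinality together with stability gives purity.\<close>

lemma pure_basic_submodule:
  assumes lc: "linearly_compact R M (carrier M)" and st: "stable x"
  obtains U where "submodule U R M" "basic R (M\<lparr>carrier := U\<rparr>)" "pure U"
proof -
  have x: "x \<in> carrier M" "x \<noteq> \<zero>\<^bsub>M\<^esub>" using st by (auto simp: stable_def)
  define H where "H = {q. 0 \<le> q \<and> x \<in> tmul q}"
  have H0: "0 \<in> H" using x by (auto simp: H_def T_0 intro: tmulI[of x])
  have H1: "q \<le> 1" if "q \<in> H" for q
  proof (rule ccontr)
    assume "\<not> q \<le> 1"
    then have "T q = \<zero>" using that T_eq_zero_iff[of q] by (auto simp: H_def)
    then show False using that x by (auto simp: H_def elim: tmulE)
  qed
  have Hne: "H \<noteq> {}" "bdd_above H" using H0 H1 by (blast, metis bdd_aboveI)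
  define P where "P n q \<longleftrightarrow> q \<in> H \<and> (Sup H \<in> H \<longrightarrow> q = Sup H) \<and> Sup H - inverse (real (Suc n)) < q" for n q
  have Hge: "0 \<le> q" if "q \<in> H" for q using that by (simp add: H_def)
  define J where "J y q \<longleftrightarrow> y \<in> carrier M \<and> T q \<odot>\<^bsub>M\<^esub> y = x \<and> (\<forall>p\<in>H. q \<le> p \<longrightarrow> y \<in> tmul (p - q))" for y q
  have step: "\<exists>y'. J y' q' \<and> y = T (q' - q) \<odot>\<^bsub>M\<^esub> y'" if J: "J y q" and q: "0 \<le> q" "q \<le> q'" "q' \<in> H" for y q q'
    using stable_divide_step[OF lc _ _ _ q, of y x] J unfolding J_def by blast
  have J0: "J x 0" unfolding J_def using x by (auto simp: T_0 H_def)
  have "\<exists>f. \<forall>n. (P n (fst (f n)) \<and> J (snd (f n)) (fst (f n))) \<and>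
    (fst (f n) \<le> fst (f (Suc n)) \<and> snd (f n) = T (fst (f (Suc n)) - fst (f n)) \<odot>\<^bsub>M\<^esub> snd (f (Suc n)))"
  proof (rule dependent_nat_choice)
    obtain q where q: "P 0 q" using cofinal_sequence_step[OF Hne, of 0] unfolding P_def by blast
    then have "q \<in> H" by (simp add: P_def)
    then obtain y where "J y q" using step[OF J0, of q] Hge by auto
    then show "\<exists>qy. P 0 (fst qy) \<and> J (snd qy) (fst qy)" using q by (intro exI[of _ "(q, y)"]) simp
  next
    fix qy n assume a: "P n (fst qy) \<and> J (snd qy) (fst qy)"
    obtain q1 where q1: "P (Suc n) q1" using cofinal_sequence_step[OF Hne, of "Suc n"] unfolding P_def by blast
    \<comment> \<open>The maximum keeps the sequence monotone without losing the
      approximation.\<close>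
    define q' where "q' = max q1 (fst qy)"
    have q': "P (Suc n) q'" using q1 a unfolding P_def q'_def by (auto simp: max_def)
    then have "q' \<in> H" by (simp add: P_def)
    moreover have "fst qy \<le> q'" by (simp add: q'_def)
    moreover have "0 \<le> fst qy" using a Hge by (simp add: P_def)
    ultimately obtain y' where "J y' q'" "snd qy = T (q' - fst qy) \<odot>\<^bsub>M\<^esub> y'" using step a by blast
    then show "\<exists>qy'. (P (Suc n) (fst qy') \<and> J (snd qy') (fst qy')) \<and>
        (fst qy \<le> fst qy' \<and> snd qy = T (fst qy' - fst qy) \<odot>\<^bsub>M\<^esub> snd qy')"
      using q' \<open>fst qy \<le> q'\<close> by (intro exI[of _ "(q', y')"]) simp
  qed
  then obtain f where f: "\<And>n. P n (fst (f n))" "\<And>n. J (snd (f n)) (fst (f n))" "\<And>n. fst (f n) \<le> fst (f (Suc n))"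
    "\<And>n. snd (f n) = T (fst (f (Suc n)) - fst (f n)) \<odot>\<^bsub>M\<^esub> snd (f (Suc n))" by blast
  define q where "q n = fst (f n)" for n
  define y where "y n = snd (f n)" for n
  have qH: "q n \<in> H" for n using f(1)[of n] by (simp add: P_def q_def)
  have q0: "0 \<le> q n" for n using Hge[OF qH] .
  have yM: "y n \<in> carrier M" and yx: "T (q n) \<odot>\<^bsub>M\<^esub> y n = x" for n
    using f(2)[of n] by (auto simp: J_def y_def q_def)
  have qmono: "q m \<le> q n" if "m \<le> n" for m n
    using lift_Suc_mono_le[of q m n] f(3) that by (simp add: q_def)
  have yy: "y m = T (q n - q m) \<odot>\<^bsub>M\<^esub> y n" if "m \<le> n" for m n
    using that
  proof (induction n rule: dec_induct)
    case base show ?case using yM by (simp add: T_0)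
  next
    case (step n)
    have "y n = T (q (Suc n) - q n) \<odot>\<^bsub>M\<^esub> y (Suc n)" using f(4)[of n] by (simp add: y_def q_def)
    then show ?case
      using step T_smult_add[of "q n - q m" "q (Suc n) - q n" "y (Suc n)"] qmono[of m n] qmono[of n "Suc n"] yM by simp
  qed
  have cof: "\<exists>n. p \<le> q n" if p: "p \<in> H" for p
  proof (cases "Sup H \<in> H")
    case True
    then have "q 0 = Sup H" using f(1)[of 0] by (simp add: P_def q_def)
    then show ?thesis using cSup_upper[OF p Hne(2)] by metis
  next
    case False
    then have "p < Sup H" using cSup_upper[OF p Hne(2)] p by (cases "p = Sup H") auto
    then obtain n where "inverse (real (Suc n)) < Sup H - p" using reals_Archimedean[of "Sup H - p"] by auto
    then have "p \<le> q n" using f(1)[of n] by (simp add: P_def q_def)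
    then show ?thesis by blast
  qed
  define U where "U = (\<Union>n. cyclic (y n))"
  have cyc: "submodule (cyclic (y n)) R M" for n by (rule cyclic_submodule[OF yM])
  have cmono: "cyclic (y m) \<subseteq> cyclic (y n)" if mn: "m \<le> n" for m n
  proof (rule cyclic_subset[OF cyc])
    show "y m \<in> cyclic (y n)" unfolding yy[OF mn]
      using qmono[OF mn] cyclic_self[OF yM] by (intro submodule_smult[OF cyc]) auto
  qed
  have two: "\<exists>n. u \<in> cyclic (y n) \<and> v \<in> cyclic (y n)" if uv: "u \<in> U" "v \<in> U" for u v
  proof -
    obtain m n where "u \<in> cyclic (y m)" "v \<in> cyclic (y n)" using uv unfolding U_def by blast
    then show ?thesis using cmono[of m "max m n"] cmono[of n "max m n"] by (intro exI[of _ "max m n"]) auto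
  qed
  have yU: "y n \<in> U" for n using cyclic_self[OF yM] unfolding U_def by blast
  have U: "submodule U R M"
  proof (rule submoduleI')
    show "U \<subseteq> carrier M" using submodule_carrier[OF cyc] unfolding U_def by blast
    show "\<zero>\<^bsub>M\<^esub> \<in> U" using submodule_zero[OF cyc] unfolding U_def by blast
    show "u \<oplus>\<^bsub>M\<^esub> v \<in> U" if "u \<in> U" "v \<in> U" for u v
      using two[OF that] submodule_add[OF cyc] unfolding U_def by blast
    show "r \<odot>\<^bsub>M\<^esub> u \<in> U" if "r \<in> carrier R" "u \<in> U" for r u
      using that submodule_smult[OF cyc] unfolding U_def by blast
  qed
  have "basic R (M\<lparr>carrier := U\<rparr>)" unfolding basic_iff
  proof (intro conjI ballI)
    have "y 0 \<noteq> \<zero>\<^bsub>M\<^esub>" using yx[of 0] x q0[of 0] by auto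
    then show "U \<noteq> {\<zero>\<^bsub>M\<^esub>}" using yU[of 0] by blast
    fix u v assume "u \<in> U" "v \<in> U"
    then obtain n where "u \<in> cyclic (y n)" "v \<in> cyclic (y n)" using two by blast
    then obtain r s where rs: "r \<in> carrier R" "u = r \<odot>\<^bsub>M\<^esub> y n" "s \<in> carrier R" "v = s \<odot>\<^bsub>M\<^esub> y n"
      unfolding cyclic_def by blast
    from dvd_total[OF rs(1,3)] show "u \<in> cyclic v \<or> v \<in> cyclic u"
    proof (elim disjE bexE)
      fix c assume "c \<in> carrier R" "r = c \<otimes> s"
      then have "u = c \<odot>\<^bsub>M\<^esub> v" using rs yM by (simp add: smult_assoc1)
      with \<open>c \<in> carrier R\<close> show ?thesis unfolding cyclic_def by blast
    next
      fix c assume "c \<in> carrier R" "s = c \<otimes> r"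
      then have "v = c \<odot>\<^bsub>M\<^esub> u" using rs yM by (simp add: smult_assoc1)
      with \<open>c \<in> carrier R\<close> show ?thesis unfolding cyclic_def by blast
    qed
  qed
  moreover have "pure U"
  proof (rule pureI[OF U])
    fix u h assume u: "u \<in> U" "u \<noteq> \<zero>\<^bsub>M\<^esub>" and h: "0 \<le> h" and uh: "u \<in> tmul h"
    obtain n r where r: "r \<in> carrier R" "u = r \<odot>\<^bsub>M\<^esub> y n" using u(1) unfolding U_def cyclic_def by blast
    have "r \<noteq> \<zero>" using u r yM by auto
    then obtain w b where w: "w \<in> Units R" "0 \<le> b" "r = w \<otimes> T b" using unit_T_decomp r by blast
    have wR: "w \<in> carrier R" using w(1) by (rule Units_closed)
    define u0 where "u0 = T b \<odot>\<^bsub>M\<^esub> y n"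
    have u0: "u = w \<odot>\<^bsub>M\<^esub> u0" "u0 \<in> carrier M" using r w wR yM by (simp_all add: u0_def smult_assoc1)
    have u0h: "u0 \<in> tmul h" using unit_smult_mem[OF tmul_submodule[OF h] w(1) u0(2)] uh u0(1) by simp
    have u00: "u0 \<noteq> \<zero>\<^bsub>M\<^esub>" using u(2) u0 wR by auto
    have "\<exists>v\<in>U. u0 = T h \<odot>\<^bsub>M\<^esub> v"
    proof (cases "h \<le> b")
      case True
      then have "u0 = T h \<odot>\<^bsub>M\<^esub> (T (b - h) \<odot>\<^bsub>M\<^esub> y n)" unfolding u0_def using T_smult_diff h yM by blast
      moreover have "T (b - h) \<odot>\<^bsub>M\<^esub> y n \<in> U" using submodule_smult[OF U _ yU] True by simp
      ultimately show ?thesis by blast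
    next
      case False
      define g where "g = h - b"
      have g: "0 < g" "h = b + g" using False by (auto simp: g_def)
      \<comment> \<open>The missing division by \<open>T g\<close> is turned into a height of x. For
        b at most \<open>q n\<close>, multiply \<open>u0\<close> on to x; for larger b,
        \<open>u0\<close> is a nonzero multiple of x and stability brings the height back to x. A
        later quotient \<open>y m\<close> then supplies the division.\<close>
      have "q n + g \<in> H"
      proof (cases "b \<le> q n")
        case True
        then have "x = T (q n - b) \<odot>\<^bsub>M\<^esub> u0" using yx[of n] T_smult_diff'[OF w(2) True yM[of n]] by (simp add: u0_def)
        moreover have "T (q n - b) \<odot>\<^bsub>M\<^esub> u0 \<in> tmul ((q n - b) + h)" by (rule tmul_smult[OF _ h u0h]) (use True in simp)
        ultimately show ?thesis using g q0[of n] by (simp add: H_def)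
      next
        case False
        then have "u0 = T (b - q n) \<odot>\<^bsub>M\<^esub> x" using yx[of n] T_smult_diff'[OF q0[of n] _ yM[of n], of b] by (simp add: u0_def)
        moreover from this have "T (b - q n) \<odot>\<^bsub>M\<^esub> x \<in> tmul ((b - q n) + (q n + g))" using u0h g by simp
        ultimately have "x \<in> tmul (q n + g)"
          using st u00 False g q0[of n] unfolding stable_def by (metis add_nonneg_pos diff_ge_0_iff_ge less_imp_le not_le)
        then show ?thesis using g q0[of n] by (simp add: H_def)
      qed
      then obtain m where m: "q n + g \<le> q m" using cof by blast
      have nm: "n \<le> m"
      proof (rule ccontr)
        assume "\<not> n \<le> m"
        then have "q m \<le> q n" by (intro qmono) simp
        with m g show False by simp
      qed
      have "u0 = T (b + (q m - q n)) \<odot>\<^bsub>M\<^esub> y m"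
        unfolding u0_def yy[OF nm] using T_smult_add[OF w(2) _ yM[of m], of "q m - q n"] qmono[OF nm] by simp
      also have "\<dots> = T h \<odot>\<^bsub>M\<^esub> (T (b + (q m - q n) - h) \<odot>\<^bsub>M\<^esub> y m)"
        by (rule T_smult_diff[OF h _ yM]) (use g m in simp)
      finally have "u0 = T h \<odot>\<^bsub>M\<^esub> (T (b + (q m - q n) - h) \<odot>\<^bsub>M\<^esub> y m)" .
      moreover have "T (b + (q m - q n) - h) \<odot>\<^bsub>M\<^esub> y m \<in> U"
        by (rule submodule_smult[OF U _ yU]) (use g m in auto)
      ultimately show ?thesis by blast
    qed
    then obtain v where v: "v \<in> U" "u0 = T h \<odot>\<^bsub>M\<^esub> v" ..
    then have "u = T h \<odot>\<^bsub>M\<^esub> (w \<odot>\<^bsub>M\<^esub> v)"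
      using u0 wR h submodule_carrier[OF U v(1)] by (simp add: smult_assoc1[symmetric] R.m_comm)
    moreover have "w \<odot>\<^bsub>M\<^esub> v \<in> U" by (rule submodule_smult[OF U wR v(1)])
    ultimately show "\<exists>v\<in>U. u = T h \<odot>\<^bsub>M\<^esub> v" by blast
  qed
  ultimately show ?thesis using that U by blast
qed

end

section \<open>Pure basic submodules split off\<close>

lemma (in abelian_group) minus_add_distrib2:
  "a \<in> carrier G \<Longrightarrow> b \<in> carrier G \<Longrightarrow> c \<in> carrier G \<Longrightarrow> d \<in> carrier G \<Longrightarrow>
    (a \<oplus> b) \<ominus> (c \<oplus> d) = (a \<ominus> c) \<oplus> (b \<ominus> d)"
  by (simp add: a_minus_def minus_add a_ac)

lemma (in abelian_group) minus_add_cancel [simp]: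
  "a \<in> carrier G \<Longrightarrow> b \<in> carrier G \<Longrightarrow> (a \<ominus> b) \<oplus> b = a"
  by (simp add: a_minus_def a_assoc l_neg)

lemma (in abelian_group) add_minus_cancel [simp]:
  "a \<in> carrier G \<Longrightarrow> b \<in> carrier G \<Longrightarrow> (a \<oplus> b) \<ominus> b = a"
  by (simp add: a_minus_def a_assoc r_neg)

lemma (in abelian_group) add_minus_cancel_left [simp]:
  "a \<in> carrier G \<Longrightarrow> b \<in> carrier G \<Longrightarrow> b \<oplus> (a \<ominus> b) = a"
  using a_comm[of b "a \<ominus> b"] by simp

lemma (in abelian_group) minus_minus_cancel [simp]:
  "a \<in> carrier G \<Longrightarrow> b \<in> carrier G \<Longrightarrow> a \<ominus> (a \<ominus> b) = b"
  using add_minus_cancel[of b "a \<ominus> b"] add_minus_cancel_left[of a b] by simp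

lemma (in abelian_group) minus_eq_minusI:
  assumes "a \<oplus> k = b \<oplus> l" "a \<in> carrier G" "b \<in> carrier G" "k \<in> carrier G" "l \<in> carrier G"
  shows "a \<ominus> b = l \<ominus> k"
proof -
  have "a = (b \<oplus> l) \<ominus> k" using assms(1)[symmetric] assms(2-) by simp
  also have "\<dots> = (l \<ominus> k) \<oplus> b" using assms(2-) by (simp add: a_minus_def a_ac)
  finally show ?thesis using assms(2-) by simp
qed

lemma (in abelian_group) minus_eq_iff:
  "a \<in> carrier G \<Longrightarrow> b \<in> carrier G \<Longrightarrow> c \<in> carrier G \<Longrightarrow> a \<ominus> b = c \<longleftrightarrow> a = c \<oplus> b"
  by auto

context root_module
begin

text \<open>Purity of the image of U in M/V, phrased without a quotient module. The scalar 0 is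
  included, so that U and V can meet only in zero.\<close>

definition pure_mod :: "'c set \<Rightarrow> 'c set \<Rightarrow> bool" where
  "pure_mod U V \<longleftrightarrow> (\<forall>a\<in>U. \<forall>s\<in>carrier R. \<forall>m\<in>carrier M. \<forall>v\<in>V.
     a = s \<odot>\<^bsub>M\<^esub> m \<oplus>\<^bsub>M\<^esub> v \<longrightarrow> (\<exists>u\<in>U. a = s \<odot>\<^bsub>M\<^esub> u))"

lemma pure_modD:
  "pure_mod U V \<Longrightarrow> a \<in> U \<Longrightarrow> s \<in> carrier R \<Longrightarrow> m \<in> carrier M \<Longrightarrow> v \<in> V \<Longrightarrow>
    a = s \<odot>\<^bsub>M\<^esub> m \<oplus>\<^bsub>M\<^esub> v \<Longrightarrow> \<exists>u\<in>U. a = s \<odot>\<^bsub>M\<^esub> u"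
  unfolding pure_mod_def by blast

text \<open>The conditions on \<open>u\<close> that keep \<open>V + P (x - u)\<close> in the class over which Zorn's lemma is applied.
  They are affine and pairwise compatible, so linear compactness of \<open>U\<close> satisfies all of them.\<close>

lemma exists_correction:
  assumes U: "submodule U R M" "basic R (M\<lparr>carrier := U\<rparr>)" and V: "submodule V R M" "pure_mod U V"
    and x: "x \<in> carrier M"
  obtains u where "u \<in> U"
    "\<And>r s a m v. r \<in> carrier R \<Longrightarrow> s \<in> carrier R \<Longrightarrow> a \<in> U \<Longrightarrow> m \<in> carrier M \<Longrightarrow> v \<in> V \<Longrightarrow>
      r \<odot>\<^bsub>M\<^esub> x = a \<oplus>\<^bsub>M\<^esub> (s \<odot>\<^bsub>M\<^esub> m \<oplus>\<^bsub>M\<^esub> v) \<Longrightarrow> \<exists>u1\<in>U. r \<odot>\<^bsub>M\<^esub> u = a \<oplus>\<^bsub>M\<^esub> s \<odot>\<^bsub>M\<^esub> u1"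
proof -
  note SU = submodule_simps[OF U(1)] and SV = submodule_simps[OF V(1)]
  \<comment> \<open>The relation r x = a + s m + v is a congruence of r x and a modulo sM + V;
    \<open>C r s a\<close> asks for r u and a to be congruent modulo sU.\<close>
  define C where "C r s a = {u \<in> U. \<exists>u1\<in>U. r \<odot>\<^bsub>M\<^esub> u = a \<oplus>\<^bsub>M\<^esub> s \<odot>\<^bsub>M\<^esub> u1}" for r s a
  define ok where "ok r s a \<longleftrightarrow> r \<in> carrier R \<and> s \<in> carrier R \<and> a \<in> U \<and>
    (\<exists>m\<in>carrier M. \<exists>v\<in>V. r \<odot>\<^bsub>M\<^esub> x = a \<oplus>\<^bsub>M\<^esub> (s \<odot>\<^bsub>M\<^esub> m \<oplus>\<^bsub>M\<^esub> v))" for r s a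
  have rel: "r \<odot>\<^bsub>M\<^esub> x \<ominus>\<^bsub>M\<^esub> a = s \<odot>\<^bsub>M\<^esub> m \<oplus>\<^bsub>M\<^esub> v"
    if "r \<odot>\<^bsub>M\<^esub> x = a \<oplus>\<^bsub>M\<^esub> (s \<odot>\<^bsub>M\<^esub> m \<oplus>\<^bsub>M\<^esub> v)" "s \<in> carrier R" "a \<in> U" "m \<in> carrier M" "v \<in> V" for r s a m v
    using that SU(1) SV(1) by (simp add: M.a_comm[of a])
  \<comment> \<open>If s divides r, purity exhibits a as an s-multiple in U, and every u satisfies
    the condition.\<close>
  have all: "C r s a = U" if ok: "ok r s a" and c: "c \<in> carrier R" "r = c \<otimes> s" for r s a c
  proof -
    obtain m v where mv: "r \<in> carrier R" "s \<in> carrier R" "a \<in> U" "m \<in> carrier M" "v \<in> V"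
      "r \<odot>\<^bsub>M\<^esub> x = a \<oplus>\<^bsub>M\<^esub> (s \<odot>\<^bsub>M\<^esub> m \<oplus>\<^bsub>M\<^esub> v)" using ok unfolding ok_def by blast
    have cl: "a \<in> carrier M" "v \<in> carrier M" using mv SU(1) SV(1) by auto
    have rs: "r \<odot>\<^bsub>M\<^esub> z = s \<odot>\<^bsub>M\<^esub> (c \<odot>\<^bsub>M\<^esub> z)" if "z \<in> carrier M" for z
      using c mv that by (simp add: smult_assoc1[symmetric] R.m_comm)
    have "a = r \<odot>\<^bsub>M\<^esub> x \<ominus>\<^bsub>M\<^esub> (s \<odot>\<^bsub>M\<^esub> m \<oplus>\<^bsub>M\<^esub> v)" using mv cl by simp
    also have "\<dots> = s \<odot>\<^bsub>M\<^esub> (c \<odot>\<^bsub>M\<^esub> x \<ominus>\<^bsub>M\<^esub> m) \<oplus>\<^bsub>M\<^esub> (\<ominus>\<^bsub>M\<^esub> v)"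
      using mv cl c x rs[OF x] by (simp add: smult_r_distr smult_r_minus a_minus_def M.minus_add M.a_assoc)
    finally have eq: "a = s \<odot>\<^bsub>M\<^esub> (c \<odot>\<^bsub>M\<^esub> x \<ominus>\<^bsub>M\<^esub> m) \<oplus>\<^bsub>M\<^esub> (\<ominus>\<^bsub>M\<^esub> v)" .
    have "c \<odot>\<^bsub>M\<^esub> x \<ominus>\<^bsub>M\<^esub> m \<in> carrier M" using c x mv by simp
    from pure_modD[OF V(2) mv(3,2) this SV(4)[OF mv(5)] eq] obtain u1
      where u1: "u1 \<in> U" "a = s \<odot>\<^bsub>M\<^esub> u1" ..
    have "u \<in> C r s a" if u: "u \<in> U" for u
    proof -
      have "c \<odot>\<^bsub>M\<^esub> u \<ominus>\<^bsub>M\<^esub> u1 \<in> U" using u u1 c SU(5,6) by blast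
      moreover have "r \<odot>\<^bsub>M\<^esub> u = a \<oplus>\<^bsub>M\<^esub> s \<odot>\<^bsub>M\<^esub> (c \<odot>\<^bsub>M\<^esub> u \<ominus>\<^bsub>M\<^esub> u1)"
        unfolding u1(2) using rs[of u] u u1(1) c mv SU(1) by (simp add: smult_minus_distr)
      ultimately show ?thesis using u by (auto simp: C_def)
    qed
    then show ?thesis by (auto simp: C_def)
  qed
  \<comment> \<open>If r divides s, purity divides a by r inside U, and the quotient solves the
    condition with remainder zero.\<close>
  have root: "\<exists>a0\<in>U. a = r \<odot>\<^bsub>M\<^esub> a0" if ok: "ok r s a" and e: "e \<in> carrier R" "s = e \<otimes> r" for r s a e
  proof -
    obtain m v where mv: "r \<in> carrier R" "s \<in> carrier R" "a \<in> U" "m \<in> carrier M" "v \<in> V"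
      "r \<odot>\<^bsub>M\<^esub> x = a \<oplus>\<^bsub>M\<^esub> (s \<odot>\<^bsub>M\<^esub> m \<oplus>\<^bsub>M\<^esub> v)" using ok unfolding ok_def by blast
    have cl: "a \<in> carrier M" "v \<in> carrier M" using mv SU(1) SV(1) by auto
    have sr: "s \<odot>\<^bsub>M\<^esub> m = r \<odot>\<^bsub>M\<^esub> (e \<odot>\<^bsub>M\<^esub> m)"
      using e mv by (simp add: smult_assoc1[symmetric] R.m_comm)
    have "a = r \<odot>\<^bsub>M\<^esub> x \<ominus>\<^bsub>M\<^esub> (s \<odot>\<^bsub>M\<^esub> m \<oplus>\<^bsub>M\<^esub> v)" using mv cl by simp
    also have "\<dots> = r \<odot>\<^bsub>M\<^esub> (x \<ominus>\<^bsub>M\<^esub> e \<odot>\<^bsub>M\<^esub> m) \<oplus>\<^bsub>M\<^esub> (\<ominus>\<^bsub>M\<^esub> v)"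
      unfolding sr using mv cl e x by (simp add: smult_r_distr smult_r_minus a_minus_def M.minus_add M.a_assoc)
    finally have eq: "a = r \<odot>\<^bsub>M\<^esub> (x \<ominus>\<^bsub>M\<^esub> e \<odot>\<^bsub>M\<^esub> m) \<oplus>\<^bsub>M\<^esub> (\<ominus>\<^bsub>M\<^esub> v)" .
    have "x \<ominus>\<^bsub>M\<^esub> e \<odot>\<^bsub>M\<^esub> m \<in> carrier M" using e x mv by simp
    from pure_modD[OF V(2) mv(3,1) this SV(4)[OF mv(5)] eq] show ?thesis .
  qed
  have root_mem: "a0 \<in> C r s a" if "a0 \<in> U" "a = r \<odot>\<^bsub>M\<^esub> a0" "r \<in> carrier R" "s \<in> carrier R" for a0 r s a
    using that SU(1,2) unfolding C_def by (auto intro!: bexI[of _ "\<zero>\<^bsub>M\<^esub>"])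
  have ne: "\<exists>u. u \<in> C r s a" if ok: "ok r s a" for r s a
  proof -
    have rs: "r \<in> carrier R" "s \<in> carrier R" using ok by (auto simp: ok_def)
    from dvd_total[OF rs] show ?thesis
    proof (elim disjE bexE)
      fix c assume "c \<in> carrier R" "r = c \<otimes> s"
      from all[OF ok this] show ?thesis using SU(2) by blast
    next
      fix e assume "e \<in> carrier R" "s = e \<otimes> r"
      from root[OF ok this] show ?thesis using root_mem rs by blast
    qed
  qed
  have meet: "\<exists>u. u \<in> C r s a \<and> u \<in> C r' s' a'"
    if ok: "ok r s a" and ok': "ok r' s' a'" and c: "c \<in> carrier R" "r' = c \<otimes> r" for r s a r' s' a' c
  proof -
    obtain m v where mv: "r \<in> carrier R" "s \<in> carrier R" "a \<in> U" "m \<in> carrier M" "v \<in> V"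
      "r \<odot>\<^bsub>M\<^esub> x = a \<oplus>\<^bsub>M\<^esub> (s \<odot>\<^bsub>M\<^esub> m \<oplus>\<^bsub>M\<^esub> v)" using ok unfolding ok_def by blast
    obtain m' v' where mv': "r' \<in> carrier R" "s' \<in> carrier R" "a' \<in> U" "m' \<in> carrier M" "v' \<in> V"
      "r' \<odot>\<^bsub>M\<^esub> x = a' \<oplus>\<^bsub>M\<^esub> (s' \<odot>\<^bsub>M\<^esub> m' \<oplus>\<^bsub>M\<^esub> v')" using ok' unfolding ok_def by blast
    have cl: "a \<in> carrier M" "v \<in> carrier M" "a' \<in> carrier M" "v' \<in> carrier M"
      using mv mv' SU(1) SV(1) by auto
    from dvd_total[OF mv(1,2)] show ?thesis
    proof (elim disjE bexE)
      fix d assume "d \<in> carrier R" "r = d \<otimes> s"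
      from all[OF ok this] ne[OF ok'] show ?thesis by (auto simp: C_def)
    next
      fix e assume e: "e \<in> carrier R" "s = e \<otimes> r"
      from root[OF ok e] obtain a0 where a0: "a0 \<in> U" "a = r \<odot>\<^bsub>M\<^esub> a0" ..
      have a0C: "a0 \<in> C r s a" by (rule root_mem[OF a0 mv(1,2)])
      have a0M: "a0 \<in> carrier M" using SU(1) a0 by blast
      have ra0: "r' \<odot>\<^bsub>M\<^esub> a0 = c \<odot>\<^bsub>M\<^esub> a" using c a0 mv a0M by (simp add: smult_assoc1)
      have csm: "c \<odot>\<^bsub>M\<^esub> (s \<odot>\<^bsub>M\<^esub> z) = (c \<otimes> s) \<odot>\<^bsub>M\<^esub> z" if "z \<in> carrier M" for z
        using that c mv by (simp add: smult_assoc1)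
      \<comment> \<open>Scaling the first relation by c and comparing it with the second expresses c
        a - a' modulo V by multiples of c s and s'. One of these two scalars divides the other, so
        purity makes the difference a single multiple within U.\<close>
      have "c \<odot>\<^bsub>M\<^esub> a \<oplus>\<^bsub>M\<^esub> ((c \<otimes> s) \<odot>\<^bsub>M\<^esub> m \<oplus>\<^bsub>M\<^esub> c \<odot>\<^bsub>M\<^esub> v) = c \<odot>\<^bsub>M\<^esub> (r \<odot>\<^bsub>M\<^esub> x)"
        using mv cl c csm[of m] by (simp add: smult_r_distr)
      also have "\<dots> = r' \<odot>\<^bsub>M\<^esub> x" using c mv x by (simp add: smult_assoc1)
      finally have eq: "c \<odot>\<^bsub>M\<^esub> a \<oplus>\<^bsub>M\<^esub> ((c \<otimes> s) \<odot>\<^bsub>M\<^esub> m \<oplus>\<^bsub>M\<^esub> c \<odot>\<^bsub>M\<^esub> v) = a' \<oplus>\<^bsub>M\<^esub> (s' \<odot>\<^bsub>M\<^esub> m' \<oplus>\<^bsub>M\<^esub> v')"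
        using mv' by simp
      let ?k = "(c \<otimes> s) \<odot>\<^bsub>M\<^esub> m \<oplus>\<^bsub>M\<^esub> c \<odot>\<^bsub>M\<^esub> v" and ?k' = "s' \<odot>\<^bsub>M\<^esub> m' \<oplus>\<^bsub>M\<^esub> v'"
      have kcl: "?k \<in> carrier M" "?k' \<in> carrier M" "c \<odot>\<^bsub>M\<^esub> a \<in> carrier M" using mv mv' cl c by auto
      have "c \<odot>\<^bsub>M\<^esub> a \<ominus>\<^bsub>M\<^esub> a' = ?k' \<ominus>\<^bsub>M\<^esub> ?k"
        by (rule M.minus_eq_minusI[OF eq kcl(3) cl(3) kcl(1,2)])
      also have "\<dots> = (s' \<odot>\<^bsub>M\<^esub> m' \<ominus>\<^bsub>M\<^esub> (c \<otimes> s) \<odot>\<^bsub>M\<^esub> m) \<oplus>\<^bsub>M\<^esub> (v' \<ominus>\<^bsub>M\<^esub> c \<odot>\<^bsub>M\<^esub> v)"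
        using mv mv' cl c by (intro M.minus_add_distrib2) auto
      finally have diff: "c \<odot>\<^bsub>M\<^esub> a \<ominus>\<^bsub>M\<^esub> a' =
        (s' \<odot>\<^bsub>M\<^esub> m' \<ominus>\<^bsub>M\<^esub> (c \<otimes> s) \<odot>\<^bsub>M\<^esub> m) \<oplus>\<^bsub>M\<^esub> (v' \<ominus>\<^bsub>M\<^esub> c \<odot>\<^bsub>M\<^esub> v)" .
      have dU: "c \<odot>\<^bsub>M\<^esub> a \<ominus>\<^bsub>M\<^esub> a' \<in> U" using SU(5,6) mv mv' c by blast
      have vV: "v' \<ominus>\<^bsub>M\<^esub> c \<odot>\<^bsub>M\<^esub> v \<in> V" using SV(5,6) mv mv' c by blast
      have cs: "c \<otimes> s \<in> carrier R" using c mv by simp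
      from dvd_total[OF mv'(2) cs] show ?thesis
      proof (elim disjE bexE)
        fix d assume d: "d \<in> carrier R" "s' = d \<otimes> (c \<otimes> s)"
        have "s' \<odot>\<^bsub>M\<^esub> m' = (c \<otimes> s) \<odot>\<^bsub>M\<^esub> (d \<odot>\<^bsub>M\<^esub> m')"
          using d cs mv' by (simp add: smult_assoc1[symmetric] R.m_comm)
        then have "s' \<odot>\<^bsub>M\<^esub> m' \<ominus>\<^bsub>M\<^esub> (c \<otimes> s) \<odot>\<^bsub>M\<^esub> m = (c \<otimes> s) \<odot>\<^bsub>M\<^esub> (d \<odot>\<^bsub>M\<^esub> m' \<ominus>\<^bsub>M\<^esub> m)"
          using d cs mv mv' by (simp add: smult_minus_distr)
        with diff have diff': "c \<odot>\<^bsub>M\<^esub> a \<ominus>\<^bsub>M\<^esub> a' = (c \<otimes> s) \<odot>\<^bsub>M\<^esub> (d \<odot>\<^bsub>M\<^esub> m' \<ominus>\<^bsub>M\<^esub> m) \<oplus>\<^bsub>M\<^esub> (v' \<ominus>\<^bsub>M\<^esub> c \<odot>\<^bsub>M\<^esub> v)"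
          by simp
        have "d \<odot>\<^bsub>M\<^esub> m' \<ominus>\<^bsub>M\<^esub> m \<in> carrier M" using d mv mv' by simp
        from pure_modD[OF V(2) dU cs this vV diff'] obtain u1 where
          u1: "u1 \<in> U" "c \<odot>\<^bsub>M\<^esub> a \<ominus>\<^bsub>M\<^esub> a' = (c \<otimes> s) \<odot>\<^bsub>M\<^esub> u1" ..
        have u1M: "u1 \<in> carrier M" using u1 SU(1) by blast
        \<comment> \<open>The shift by e u1 preserves the first condition, as r e = s, and turns the
          second into the equation r' u = a'.\<close>
        define u where "u = a0 \<ominus>\<^bsub>M\<^esub> e \<odot>\<^bsub>M\<^esub> u1"
        have uU: "u \<in> U" unfolding u_def using SU(5,6) a0 e u1 by blast
        have ru: "r \<odot>\<^bsub>M\<^esub> u = a \<oplus>\<^bsub>M\<^esub> s \<odot>\<^bsub>M\<^esub> (\<ominus>\<^bsub>M\<^esub> u1)"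
        proof -
          have "r \<odot>\<^bsub>M\<^esub> (e \<odot>\<^bsub>M\<^esub> u1) = s \<odot>\<^bsub>M\<^esub> u1" using e mv u1M by (simp add: smult_assoc1[symmetric] R.m_comm)
          then show ?thesis unfolding u_def using a0 a0M e mv u1M
            by (simp add: smult_r_distr smult_r_minus a_minus_def)
        qed
        then have "u \<in> C r s a" using uU SU(4)[OF u1(1)] by (auto simp: C_def)
        moreover have "r' \<odot>\<^bsub>M\<^esub> u = a'"
        proof -
          have "r' \<odot>\<^bsub>M\<^esub> u = c \<odot>\<^bsub>M\<^esub> (a \<oplus>\<^bsub>M\<^esub> s \<odot>\<^bsub>M\<^esub> (\<ominus>\<^bsub>M\<^esub> u1))"
            unfolding ru[symmetric] using c mv SU(1)[OF uU] by (simp add: smult_assoc1)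
          also have "\<dots> = c \<odot>\<^bsub>M\<^esub> a \<ominus>\<^bsub>M\<^esub> (c \<otimes> s) \<odot>\<^bsub>M\<^esub> u1"
            using c mv cl u1M csm[of "\<ominus>\<^bsub>M\<^esub> u1"] by (simp add: smult_r_distr smult_r_minus a_minus_def)
          also have "\<dots> = c \<odot>\<^bsub>M\<^esub> a \<ominus>\<^bsub>M\<^esub> (c \<odot>\<^bsub>M\<^esub> a \<ominus>\<^bsub>M\<^esub> a')" using u1 by simp
          also have "\<dots> = a'" using kcl cl by simp
          finally show ?thesis .
        qed
        then have "u \<in> C r' s' a'"
          using uU SU(1)[OF mv'(3)] SU(2) mv'(2) unfolding C_def by (auto intro!: bexI[of _ "\<zero>\<^bsub>M\<^esub>"])
        ultimately show ?thesis by blast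
      next
        fix d assume d: "d \<in> carrier R" "c \<otimes> s = d \<otimes> s'"
        have "(c \<otimes> s) \<odot>\<^bsub>M\<^esub> m = s' \<odot>\<^bsub>M\<^esub> (d \<odot>\<^bsub>M\<^esub> m)"
          using d cs mv mv' by (simp add: smult_assoc1[symmetric] R.m_comm)
        then have "s' \<odot>\<^bsub>M\<^esub> m' \<ominus>\<^bsub>M\<^esub> (c \<otimes> s) \<odot>\<^bsub>M\<^esub> m = s' \<odot>\<^bsub>M\<^esub> (m' \<ominus>\<^bsub>M\<^esub> d \<odot>\<^bsub>M\<^esub> m)"
          using d mv mv' by (simp add: smult_minus_distr)
        with diff have diff': "c \<odot>\<^bsub>M\<^esub> a \<ominus>\<^bsub>M\<^esub> a' = s' \<odot>\<^bsub>M\<^esub> (m' \<ominus>\<^bsub>M\<^esub> d \<odot>\<^bsub>M\<^esub> m) \<oplus>\<^bsub>M\<^esub> (v' \<ominus>\<^bsub>M\<^esub> c \<odot>\<^bsub>M\<^esub> v)"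
          by simp
        have "m' \<ominus>\<^bsub>M\<^esub> d \<odot>\<^bsub>M\<^esub> m \<in> carrier M" using d mv mv' by simp
        from pure_modD[OF V(2) dU mv'(2) this vV diff'] obtain u1 where
          u1: "u1 \<in> U" "c \<odot>\<^bsub>M\<^esub> a \<ominus>\<^bsub>M\<^esub> a' = s' \<odot>\<^bsub>M\<^esub> u1" ..
        have "c \<odot>\<^bsub>M\<^esub> a = a' \<oplus>\<^bsub>M\<^esub> s' \<odot>\<^bsub>M\<^esub> u1"
          using u1 kcl cl mv' SU(1)[OF u1(1)] by (simp add: minus_eq_iff M.a_comm)
        then have "a0 \<in> C r' s' a'" using ra0 a0 u1 by (auto simp: C_def)
        with a0C show ?thesis by blast
      qed
    qed
  qed
  let ?F = "{C r s a |r s a. ok r s a}"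
  have FU: "C r s a \<subseteq> U" for r s a by (auto simp: C_def)
  have aff: "affine_subset R M (C r s a)" if ok: "ok r s a" for r s a
  proof (rule affineI)
    have rs: "r \<in> carrier R" "s \<in> carrier R" "a \<in> carrier M" using ok SU(1) by (auto simp: ok_def)
    show "C r s a \<subseteq> carrier M" using SU(1) by (auto simp: C_def)
    show "C r s a \<noteq> {}" using ne[OF ok] by blast
    fix y1 y2 y3 k assume "y1 \<in> C r s a" "y2 \<in> C r s a" "y3 \<in> C r s a" and k: "k \<in> carrier R"
    then obtain z1 z2 z3 where y: "y1 \<in> U" "y2 \<in> U" "y3 \<in> U" and z: "z1 \<in> U" "z2 \<in> U" "z3 \<in> U"
      and e: "r \<odot>\<^bsub>M\<^esub> y1 = a \<oplus>\<^bsub>M\<^esub> s \<odot>\<^bsub>M\<^esub> z1" "r \<odot>\<^bsub>M\<^esub> y2 = a \<oplus>\<^bsub>M\<^esub> s \<odot>\<^bsub>M\<^esub> z2" "r \<odot>\<^bsub>M\<^esub> y3 = a \<oplus>\<^bsub>M\<^esub> s \<odot>\<^bsub>M\<^esub> z3"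
      by (auto simp: C_def)
    have "r \<odot>\<^bsub>M\<^esub> (y1 \<oplus>\<^bsub>M\<^esub> k \<odot>\<^bsub>M\<^esub> (y2 \<ominus>\<^bsub>M\<^esub> y3)) =
      (a \<oplus>\<^bsub>M\<^esub> s \<odot>\<^bsub>M\<^esub> z1) \<oplus>\<^bsub>M\<^esub> k \<odot>\<^bsub>M\<^esub> ((a \<oplus>\<^bsub>M\<^esub> s \<odot>\<^bsub>M\<^esub> z2) \<ominus>\<^bsub>M\<^esub> (a \<oplus>\<^bsub>M\<^esub> s \<odot>\<^bsub>M\<^esub> z3))"
      using affine_smult[OF k rs(1)] y SU(1) e by simp
    also have "\<dots> = (a \<oplus>\<^bsub>M\<^esub> k \<odot>\<^bsub>M\<^esub> (a \<ominus>\<^bsub>M\<^esub> a)) \<oplus>\<^bsub>M\<^esub> (s \<odot>\<^bsub>M\<^esub> z1 \<oplus>\<^bsub>M\<^esub> k \<odot>\<^bsub>M\<^esub> (s \<odot>\<^bsub>M\<^esub> z2 \<ominus>\<^bsub>M\<^esub> s \<odot>\<^bsub>M\<^esub> z3))"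
      using affine_add[OF k] rs z SU(1) by simp
    also have "\<dots> = a \<oplus>\<^bsub>M\<^esub> s \<odot>\<^bsub>M\<^esub> (z1 \<oplus>\<^bsub>M\<^esub> k \<odot>\<^bsub>M\<^esub> (z2 \<ominus>\<^bsub>M\<^esub> z3))"
      using affine_smult[OF k rs(2)] rs z SU(1) k by simp
    finally have "r \<odot>\<^bsub>M\<^esub> (y1 \<oplus>\<^bsub>M\<^esub> k \<odot>\<^bsub>M\<^esub> (y2 \<ominus>\<^bsub>M\<^esub> y3)) = a \<oplus>\<^bsub>M\<^esub> s \<odot>\<^bsub>M\<^esub> (z1 \<oplus>\<^bsub>M\<^esub> k \<odot>\<^bsub>M\<^esub> (z2 \<ominus>\<^bsub>M\<^esub> z3))" .
    moreover have "y1 \<oplus>\<^bsub>M\<^esub> k \<odot>\<^bsub>M\<^esub> (y2 \<ominus>\<^bsub>M\<^esub> y3) \<in> U" "z1 \<oplus>\<^bsub>M\<^esub> k \<odot>\<^bsub>M\<^esub> (z2 \<ominus>\<^bsub>M\<^esub> z3) \<in> U"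
      using SU(3,5,6) y z k by auto
    ultimately show "y1 \<oplus>\<^bsub>M\<^esub> k \<odot>\<^bsub>M\<^esub> (y2 \<ominus>\<^bsub>M\<^esub> y3) \<in> C r s a" by (auto simp: C_def)
  qed
  obtain u where u: "u \<in> U" "\<And>X. X \<in> ?F \<Longrightarrow> u \<in> X"
  proof (rule linearly_compactD[OF basic_linearly_compact[OF U], of ?F])
    show "\<And>X. X \<in> ?F \<Longrightarrow> X \<subseteq> U" using FU by blast
    show "\<And>X. X \<in> ?F \<Longrightarrow> affine_subset R M X" using aff by blast
    fix X Y assume XY: "X \<in> ?F" "Y \<in> ?F"
    then obtain r s a r' s' a' where X: "X = C r s a" "ok r s a" and Y: "Y = C r' s' a'" "ok r' s' a'" by blast
    have "r \<in> carrier R" "r' \<in> carrier R" using X Y by (auto simp: ok_def)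
    from dvd_total[OF this] obtain p where p: "p \<in> X" "p \<in> Y"
      using meet[OF X(2) Y(2)] meet[OF Y(2) X(2)] X(1) Y(1) by blast
    have uni: "y \<in> cyclic z \<or> z \<in> cyclic y" if "y \<in> U" "z \<in> U" for y z
      using U(2) that unfolding basic_iff by blast
    \<comment> \<open>Cosets of a uniserial module that meet are nested, so compatibility in pairs
      already makes the family directed.\<close>
    have "X \<subseteq> Y \<or> Y \<subseteq> X"
      using uniserial_affine_chain[OF U(1) uni _ _ _ _ p] aff[OF X(2)] aff[OF Y(2)] FU X(1) Y(1) by simp
    then show "\<exists>E\<in>?F. E \<subseteq> X \<and> E \<subseteq> Y" using XY by blast
  qed blast
  show ?thesis
  proof (rule that[OF u(1)])
    fix r s a m v assume "r \<in> carrier R" "s \<in> carrier R" "a \<in> U" "m \<in> carrier M" "v \<in> V"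
      "r \<odot>\<^bsub>M\<^esub> x = a \<oplus>\<^bsub>M\<^esub> (s \<odot>\<^bsub>M\<^esub> m \<oplus>\<^bsub>M\<^esub> v)"
    then have "C r s a \<in> ?F" unfolding ok_def by blast
    from u(2)[OF this] show "\<exists>u1\<in>U. r \<odot>\<^bsub>M\<^esub> u = a \<oplus>\<^bsub>M\<^esub> s \<odot>\<^bsub>M\<^esub> u1" by (simp add: C_def)
  qed
qed

end


section \<open>The splitting and the finite decomposition\<close>

context root_module
begin

text \<open>Zorn's lemma runs over the V modulo which U stays pure, a class that contains 0 and is
  closed under unions of chains. A maximal V satisfies U + V = M, because any x can be corrected by
  an element of U and then adjoined to V.\<close>

lemma pure_basic_split:
  assumes U: "submodule U R M" "basic R (M\<lparr>carrier := U\<rparr>)" and p: "pure U"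
  obtains V where "is_dsum (carrier M) U V"
proof -
  note SU = submodule_simps[OF U(1)]
  let ?A = "{V. submodule V R M \<and> pure_mod U V}"
  have "\<exists>V\<in>?A. \<forall>X\<in>?A. V \<subseteq> X \<longrightarrow> X = V"
  proof (rule subset_Zorn_nonempty)
    have "pure_mod U {\<zero>\<^bsub>M\<^esub>}" using p unfolding pure_def pure_mod_def by simp
    then show "?A \<noteq> {}" using zero_submodule by blast
    fix C assume C: "C \<noteq> {}" "subset.chain ?A C"
    have CA: "submodule V R M" "pure_mod U V" if "V \<in> C" for V using C(2) that unfolding subset_chain_def by auto
    have ch: "V \<subseteq> W \<or> W \<subseteq> V" if "V \<in> C" "W \<in> C" for V W using C(2) that unfolding subset_chain_def by blast
    have "submodule (\<Union>C) R M"
    proof (rule submoduleI')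
      show "\<Union>C \<subseteq> carrier M" using CA(1) submodule_carrier by blast
      obtain V where "V \<in> C" using C(1) by blast
      then show "\<zero>\<^bsub>M\<^esub> \<in> \<Union>C" using submodule_zero[OF CA(1)] by blast
      show "a \<oplus>\<^bsub>M\<^esub> b \<in> \<Union>C" if ab: "a \<in> \<Union>C" "b \<in> \<Union>C" for a b
      proof -
        obtain V W where VW: "V \<in> C" "a \<in> V" "W \<in> C" "b \<in> W" using ab by blast
        from ch[OF VW(1,3)] obtain X where "X \<in> C" "a \<in> X" "b \<in> X" using VW by blast
        then show ?thesis using submodule_add[OF CA(1)] by blast
      qed
      show "r \<odot>\<^bsub>M\<^esub> a \<in> \<Union>C" if "r \<in> carrier R" "a \<in> \<Union>C" for r a
        using that submodule_smult[OF CA(1)] by blast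
    qed
    moreover have "pure_mod U (\<Union>C)" unfolding pure_mod_def
    proof (intro ballI impI)
      fix a s m v assume a: "a \<in> U" "s \<in> carrier R" "m \<in> carrier M" "v \<in> \<Union>C" "a = s \<odot>\<^bsub>M\<^esub> m \<oplus>\<^bsub>M\<^esub> v"
      then obtain V where "V \<in> C" "v \<in> V" by blast
      from pure_modD[OF CA(2)[OF this(1)] a(1,2,3) this(2) a(5)] show "\<exists>u\<in>U. a = s \<odot>\<^bsub>M\<^esub> u" .
    qed
    ultimately show "\<Union>C \<in> ?A" by blast
  qed
  then obtain V where VA: "V \<in> ?A" and max: "\<forall>X\<in>?A. V \<subseteq> X \<longrightarrow> X = V" ..
  have V: "submodule V R M" "pure_mod U V" using VA by auto
  note SV = submodule_simps[OF V(1)]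
  have "carrier M \<subseteq> sumset U V"
  proof
    fix x assume x: "x \<in> carrier M"
    show "x \<in> sumset U V"
    proof (rule ccontr)
      assume n: "x \<notin> sumset U V"
      obtain u where u: "u \<in> U"
        "\<And>r s a m v. r \<in> carrier R \<Longrightarrow> s \<in> carrier R \<Longrightarrow> a \<in> U \<Longrightarrow> m \<in> carrier M \<Longrightarrow> v \<in> V \<Longrightarrow>
          r \<odot>\<^bsub>M\<^esub> x = a \<oplus>\<^bsub>M\<^esub> (s \<odot>\<^bsub>M\<^esub> m \<oplus>\<^bsub>M\<^esub> v) \<Longrightarrow> \<exists>u1\<in>U. r \<odot>\<^bsub>M\<^esub> u = a \<oplus>\<^bsub>M\<^esub> s \<odot>\<^bsub>M\<^esub> u1"
        by (rule exists_correction[OF U V x]) blast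
      have uM: "u \<in> carrier M" using SU(1) u(1) by blast
      have xu: "x \<ominus>\<^bsub>M\<^esub> u \<in> carrier M" using x uM by simp
      note cyc = cyclic_submodule[OF xu]
      let ?V = "sumset V (cyclic (x \<ominus>\<^bsub>M\<^esub> u))"
      have "pure_mod U ?V" unfolding pure_mod_def
      proof (intro ballI impI)
        fix a s m v' assume a: "a \<in> U" "s \<in> carrier R" "m \<in> carrier M" "v' \<in> ?V" "a = s \<odot>\<^bsub>M\<^esub> m \<oplus>\<^bsub>M\<^esub> v'"
        obtain v r where v: "v \<in> V" "r \<in> carrier R" "v' = v \<oplus>\<^bsub>M\<^esub> r \<odot>\<^bsub>M\<^esub> (x \<ominus>\<^bsub>M\<^esub> u)"
          using a(4) unfolding cyclic_def by (auto elim: sumsetE)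
        have cl: "a \<in> carrier M" "v \<in> carrier M" using SU(1) SV(1) a v by auto
        \<comment> \<open>Solved for r x, the relation becomes one of the congruences that u was
          chosen to respect.\<close>
        have "a \<oplus>\<^bsub>M\<^esub> r \<odot>\<^bsub>M\<^esub> u = (s \<odot>\<^bsub>M\<^esub> m \<oplus>\<^bsub>M\<^esub> v) \<oplus>\<^bsub>M\<^esub> ((r \<odot>\<^bsub>M\<^esub> x \<ominus>\<^bsub>M\<^esub> r \<odot>\<^bsub>M\<^esub> u) \<oplus>\<^bsub>M\<^esub> r \<odot>\<^bsub>M\<^esub> u)"
          using a v cl x uM by (simp add: smult_minus_distr M.a_assoc)
        then have au: "a \<oplus>\<^bsub>M\<^esub> r \<odot>\<^bsub>M\<^esub> u = r \<odot>\<^bsub>M\<^esub> x \<oplus>\<^bsub>M\<^esub> (s \<odot>\<^bsub>M\<^esub> m \<oplus>\<^bsub>M\<^esub> v)"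
          using a v cl x uM by (simp add: M.a_comm)
        have "r \<odot>\<^bsub>M\<^esub> x = (a \<oplus>\<^bsub>M\<^esub> r \<odot>\<^bsub>M\<^esub> u) \<ominus>\<^bsub>M\<^esub> (s \<odot>\<^bsub>M\<^esub> m \<oplus>\<^bsub>M\<^esub> v)"
          unfolding au using a v cl x by simp
        also have "\<dots> = (a \<oplus>\<^bsub>M\<^esub> r \<odot>\<^bsub>M\<^esub> u) \<oplus>\<^bsub>M\<^esub> (s \<odot>\<^bsub>M\<^esub> (\<ominus>\<^bsub>M\<^esub> m) \<oplus>\<^bsub>M\<^esub> (\<ominus>\<^bsub>M\<^esub> v))"
          using a v cl uM by (simp add: a_minus_def smult_r_minus M.minus_add)
        finally have eq: "r \<odot>\<^bsub>M\<^esub> x = (a \<oplus>\<^bsub>M\<^esub> r \<odot>\<^bsub>M\<^esub> u) \<oplus>\<^bsub>M\<^esub> (s \<odot>\<^bsub>M\<^esub> (\<ominus>\<^bsub>M\<^esub> m) \<oplus>\<^bsub>M\<^esub> (\<ominus>\<^bsub>M\<^esub> v))" .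
        have aU: "a \<oplus>\<^bsub>M\<^esub> r \<odot>\<^bsub>M\<^esub> u \<in> U" by (rule SU(3)[OF a(1) SU(6)[OF v(2) u(1)]])
        have mM: "\<ominus>\<^bsub>M\<^esub> m \<in> carrier M" using a by simp
        from u(2)[OF v(2) a(2) aU mM SV(4)[OF v(1)] eq] obtain u1 where
          u1: "u1 \<in> U" "r \<odot>\<^bsub>M\<^esub> u = (a \<oplus>\<^bsub>M\<^esub> r \<odot>\<^bsub>M\<^esub> u) \<oplus>\<^bsub>M\<^esub> s \<odot>\<^bsub>M\<^esub> u1" ..
        have u1M: "u1 \<in> carrier M" using SU(1) u1 by blast
        have e: "\<zero>\<^bsub>M\<^esub> \<oplus>\<^bsub>M\<^esub> r \<odot>\<^bsub>M\<^esub> u = (a \<oplus>\<^bsub>M\<^esub> s \<odot>\<^bsub>M\<^esub> u1) \<oplus>\<^bsub>M\<^esub> r \<odot>\<^bsub>M\<^esub> u"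
          using u1 u1M cl uM v a by (simp add: M.a_ac)
        have "\<zero>\<^bsub>M\<^esub> = (\<zero>\<^bsub>M\<^esub> \<oplus>\<^bsub>M\<^esub> r \<odot>\<^bsub>M\<^esub> u) \<ominus>\<^bsub>M\<^esub> r \<odot>\<^bsub>M\<^esub> u" using uM v by simp
        also have "\<dots> = a \<oplus>\<^bsub>M\<^esub> s \<odot>\<^bsub>M\<^esub> u1" unfolding e using u1M cl uM v a by (intro M.add_minus_cancel) auto
        finally have "\<zero>\<^bsub>M\<^esub> = a \<oplus>\<^bsub>M\<^esub> s \<odot>\<^bsub>M\<^esub> u1" .
        then have "a = \<ominus>\<^bsub>M\<^esub> (s \<odot>\<^bsub>M\<^esub> u1)" using M.minus_equality[of a "s \<odot>\<^bsub>M\<^esub> u1"] cl u1M a by simp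
        then have "a = s \<odot>\<^bsub>M\<^esub> (\<ominus>\<^bsub>M\<^esub> u1)" using u1M a by (simp add: smult_r_minus)
        then show "\<exists>u\<in>U. a = s \<odot>\<^bsub>M\<^esub> u" using SU(4)[OF u1(1)] by blast
      qed
      moreover have "submodule ?V R M" by (rule sumset_submodule[OF V(1) cyc])
      moreover have "V \<subseteq> ?V" by (rule sumset_left[OF V(1) cyc])
      ultimately have "?V = V" using max by blast
      moreover have "x \<ominus>\<^bsub>M\<^esub> u \<in> ?V" using sumset_right[OF V(1) cyc] cyclic_self[OF xu] by blast
      ultimately have "x \<ominus>\<^bsub>M\<^esub> u \<in> V" by simp
      from sumsetI[OF u(1) this] have "x \<in> sumset U V" using x uM by simp
      with n show False ..
    qed
  qed
  moreover have "sumset U V \<subseteq> carrier M" using submodule_carrier[OF sumset_submodule[OF U(1) V(1)]] by blast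
  moreover have "U \<inter> V = {\<zero>\<^bsub>M\<^esub>}"
  proof -
    have "a = \<zero>\<^bsub>M\<^esub>" if a: "a \<in> U" "a \<in> V" for a
    proof -
      have "a = \<zero> \<odot>\<^bsub>M\<^esub> \<zero>\<^bsub>M\<^esub> \<oplus>\<^bsub>M\<^esub> a" using SU(1)[OF a(1)] by simp
      from pure_modD[OF V(2) a(1) _ _ a(2) this] SU(1) show ?thesis by auto
    qed
    then show ?thesis using SU(2) SV(2) by blast
  qed
  ultimately show ?thesis using that[of V] U(1) V(1) unfolding is_dsum_def by blast
qed

lemma exists_basic_summand:
  assumes lc: "linearly_compact R M (carrier M)" and nz: "carrier M \<noteq> {\<zero>\<^bsub>M\<^esub>}"
  shows "\<exists>U V. is_dsum (carrier M) U V \<and> basic R (M\<lparr>carrier := U\<rparr>)"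
proof -
  obtain x where "stable x" using exists_stable[OF lc nz] ..
  then obtain U where U: "submodule U R M" "basic R (M\<lparr>carrier := U\<rparr>)" "pure U"
    by (rule pure_basic_submodule[OF lc])
  obtain V where "is_dsum (carrier M) U V" by (rule pure_basic_split[OF U])
  with U show ?thesis by blast
qed

lemma root_module_submodule:
  assumes "submodule V R M" shows "root_module R T (M\<lparr>carrier := V\<rparr>)"
  by (rule root_module.intro[OF submodule.submodule_is_module[OF assms module_axioms] root_ring_axioms])

lemma linearly_compact_submodule:
  assumes lc: "linearly_compact R M N" and V: "submodule V R M" "V \<subseteq> N"
  shows "linearly_compact R M V"
  unfolding linearly_compact_def
proof (intro allI impI)
  fix F assume F: "(\<forall>C\<in>F. C \<subseteq> V \<and> affine_subset R M C) \<and> down_directed F"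
  have "\<exists>x\<in>N. \<forall>C\<in>F. x \<in> C"
    by (rule lc[unfolded linearly_compact_def, rule_format]) (use F V(2) in blast)
  then obtain x where "\<forall>C\<in>F. x \<in> C" by blast
  then show "\<exists>x\<in>V. \<forall>C\<in>F. x \<in> C"
    using F submodule_zero[OF V(1)] by (cases "F = {}") auto
qed

text \<open>V is treated as a module in its own right; its operations are those of M, so the
  summands found there are summands within M.\<close>

lemma exists_basic_summand_submodule:
  assumes lc: "linearly_compact R M (carrier M)" and V: "submodule V R M" "V \<noteq> {\<zero>\<^bsub>M\<^esub>}"
  shows "\<exists>U V'. is_dsum V U V' \<and> basic R (M\<lparr>carrier := U\<rparr>)"
proof -
  let ?N = "M\<lparr>carrier := V\<rparr>"
  interpret N: root_module R T ?N by (rule root_module_submodule[OF V(1)])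
  have "linearly_compact R M V"
    by (rule linearly_compact_submodule[OF lc V(1)]) (use submodule_carrier[OF V(1)] in blast)
  then have "linearly_compact R ?N (carrier ?N)" by (simp add: linearly_compact_def affine_subset_def)
  moreover have "carrier ?N \<noteq> {\<zero>\<^bsub>?N\<^esub>}" using V(2) by simp
  ultimately obtain U V' where UV: "N.is_dsum (carrier ?N) U V'" "basic R (?N\<lparr>carrier := U\<rparr>)"
    using N.exists_basic_summand by blast
  have sub: "submodule W R M" if W: "submodule W R ?N" for W
  proof (rule submoduleI')
    show "W \<subseteq> carrier M" using N.submodule_simps(1)[OF W] submodule_carrier[OF V(1)] by auto
  qed (use N.submodule_simps(2,3,6)[OF W] in simp_all)
  have "submodule U R ?N" "submodule V' R ?N" using UV(1) by (simp_all add: N.is_dsum_def)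
  then have "submodule U R M" "submodule V' R M" using sub by blast+
  then have "is_dsum V U V'"
    using UV(1) unfolding N.is_dsum_def is_dsum_def N.sumset_def sumset_def by simp
  with UV(2) show ?thesis by auto
qed

text \<open>Without a finite decomposition, every remaining complement would again be nonzero and
  have none, so basic summands could be split off for ever. Nonzero elements of these summands form
  an independent sequence.\<close>

lemma linearly_compact_imp_dsum:
  assumes lc: "linearly_compact R M (carrier M)"
  shows "\<exists>Us. dsum (carrier M) Us \<and> (\<forall>U\<in>set Us. basic R (M\<lparr>carrier := U\<rparr>))"
proof (rule ccontr)
  assume n: "\<not> ?thesis"
  define bad where "bad V \<longleftrightarrow> submodule V R M \<and>
    \<not> (\<exists>Us. dsum V Us \<and> (\<forall>U\<in>set Us. basic R (M\<lparr>carrier := U\<rparr>)))" for V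
  have "\<exists>f. \<forall>k::nat. bad (f k) \<and> (\<exists>U. is_dsum (f k) U (f (Suc k)) \<and> basic R (M\<lparr>carrier := U\<rparr>))"
  proof (rule dependent_nat_choice[of "\<lambda>_. bad" "\<lambda>_ V V'. \<exists>U. is_dsum V U V' \<and> basic R (M\<lparr>carrier := U\<rparr>)"])
    show "\<exists>V. bad V" using n carrier_is_submodule unfolding bad_def by blast
    fix V assume b: "bad V"
    have "V \<noteq> {\<zero>\<^bsub>M\<^esub>}"
    proof
      assume "V = {\<zero>\<^bsub>M\<^esub>}"
      then have "dsum V [] \<and> (\<forall>U\<in>set []. basic R (M\<lparr>carrier := U\<rparr>))" by simp
      with b show False unfolding bad_def by blast
    qed
    then obtain U V' where UV: "is_dsum V U V'" "basic R (M\<lparr>carrier := U\<rparr>)"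
      using exists_basic_summand_submodule[OF lc] b unfolding bad_def by blast
    have "bad V'" unfolding bad_def
    proof (intro conjI notI)
      show "submodule V' R M" using UV(1) by (simp add: is_dsum_def)
      assume "\<exists>Us. dsum V' Us \<and> (\<forall>U\<in>set Us. basic R (M\<lparr>carrier := U\<rparr>))"
      then obtain Us where "dsum V' Us" "\<forall>U\<in>set Us. basic R (M\<lparr>carrier := U\<rparr>)" by blast
      then have "dsum V (U # Us) \<and> (\<forall>U\<in>set (U # Us). basic R (M\<lparr>carrier := U\<rparr>))" using UV by auto
      with b show False unfolding bad_def by blast
    qed
    with UV show "\<exists>V'. bad V' \<and> (\<exists>U. is_dsum V U V' \<and> basic R (M\<lparr>carrier := U\<rparr>))" by blast
  qed
  then obtain V where V: "\<And>k::nat. \<exists>U. is_dsum (V k) U (V (Suc k)) \<and> basic R (M\<lparr>carrier := U\<rparr>)" by blast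
  then obtain U where U: "\<And>k. is_dsum (V k) (U k) (V (Suc k))" "\<And>k. basic R (M\<lparr>carrier := U k\<rparr>)" by metis
  have sub: "submodule (U k) R M" "submodule (V (Suc k)) R M" "U k \<inter> V (Suc k) = {\<zero>\<^bsub>M\<^esub>}"
    "V k = sumset (U k) (V (Suc k))" for k
    using U(1)[of k] by (auto simp: is_dsum_def)
  have "V (Suc k) \<subseteq> V k" for k using sumset_right[OF sub(1,2)] sub(4)[of k] by simp
  then have Vdec: "V n \<subseteq> V m" if "m \<le> n" for m n using lift_Suc_antimono_le[of V m n] that by blast
  have UV: "U k \<subseteq> V k" for k using sumset_left[OF sub(1,2)] sub(4)[of k] by simp
  have "\<exists>w. w \<in> U k \<and> w \<noteq> \<zero>\<^bsub>M\<^esub>" for k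
    using U(2)[of k] submodule_zero[OF sub(1)[of k]] unfolding basic_iff by blast
  then obtain w where w: "\<And>k. w k \<in> U k" "\<And>k. w k \<noteq> \<zero>\<^bsub>M\<^esub>" by metis
  have wM: "w k \<in> carrier M" for k using submodule_carrier[OF sub(1) w(1)] .
  have "independent w" unfolding independent_def
  proof (intro allI impI, rule ccontr)
    fix n f i assume f: "\<forall>k. f k \<in> cyclic (w k)" and s: "psum f n = \<zero>\<^bsub>M\<^esub>" and i: "i < n" "f i \<noteq> \<zero>\<^bsub>M\<^esub>"
    have fU: "f k \<in> U k" for k using f cyclic_subset[OF sub(1) w(1)] by blast
    have fM: "f k \<in> carrier M" for k using submodule_carrier[OF sub(1) fU] .
    define k where "k = (LEAST k. f k \<noteq> \<zero>\<^bsub>M\<^esub>)"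
    have k: "f k \<noteq> \<zero>\<^bsub>M\<^esub>" unfolding k_def by (rule LeastI[of _ i]) (rule i(2))
    have low: "f j = \<zero>\<^bsub>M\<^esub>" if "j < k" for j using not_less_Least[of j "\<lambda>k. f k \<noteq> \<zero>\<^bsub>M\<^esub>"] that k_def by auto
    have "k \<le> i" unfolding k_def by (rule Least_le) (rule i(2))
    \<comment> \<open>All terms after the first nonzero one lie in the complement
      \<open>V (Suc k)\<close>, hence so does that term; but it also lies in
      \<open>U k\<close>.\<close>
    have "f k \<in> V (Suc k)"
    proof (rule psum_isolate[OF sub(2) fM low _ _ s])
      show "k < n" using \<open>k \<le> i\<close> i(1) by simp
      fix j assume "k < j"
      then show "f j \<in> V (Suc k)" using fU[of j] UV[of j] Vdec[of "Suc k" j] by auto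
    qed
    then show False using k fU[of k] sub(3)[of k] by blast
  qed
  with linearly_compact_no_independent[OF lc wM w(2)] show False ..
qed

end


section \<open>Uniqueness of the decomposition\<close>

lemma (in abelian_group) minus_zero_right [simp]: "x \<in> carrier G \<Longrightarrow> x \<ominus> \<zero> = x"
  using add_minus_cancel[of x \<zero>] by simp

context Module.module
begin

section \<open>Projections of binary direct sums\<close>

lemma is_dsum_comm: "is_dsum X A B \<Longrightarrow> is_dsum X B A"
  unfolding is_dsum_def using sumset_comm by (auto simp: Int_commute)

lemma is_dsum_subset: "is_dsum X A B \<Longrightarrow> A \<subseteq> X" "is_dsum X A B \<Longrightarrow> B \<subseteq> X"
  unfolding is_dsum_def using sumset_left sumset_right by auto

lemma is_dsum_assoc:
  assumes X: "is_dsum X A Y" and Y: "is_dsum Y B C"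
  shows "is_dsum X (sumset A B) C" "is_dsum (sumset A B) A B"
proof -
  have A: "submodule A R M" and B: "submodule B R M" and C: "submodule C R M" and Ys: "submodule Y R M"
    using X Y by (auto simp: is_dsum_def)
  have i: "A \<inter> Y = {\<zero>\<^bsub>M\<^esub>}" "B \<inter> C = {\<zero>\<^bsub>M\<^esub>}" and s: "X = sumset A Y" "Y = sumset B C"
    using X Y by (auto simp: is_dsum_def)
  have "A \<inter> B = {\<zero>\<^bsub>M\<^esub>}"
    using i(1) is_dsum_subset(1)[OF Y] submodule_zero[OF A] submodule_zero[OF B] by blast
  then show "is_dsum (sumset A B) A B" using A B by (simp add: is_dsum_def)
  have "c = \<zero>\<^bsub>M\<^esub>" if c: "c \<in> sumset A B" "c \<in> C" for c
  proof -
    obtain a b where ab: "a \<in> A" "b \<in> B" "c = a \<oplus>\<^bsub>M\<^esub> b" using c(1) by (rule sumsetE)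
    have cl: "a \<in> carrier M" "b \<in> carrier M" using submodule_carrier[OF A ab(1)] submodule_carrier[OF B ab(2)] .
    have "c \<ominus>\<^bsub>M\<^esub> b \<in> Y"
      using submodule_minus[OF Ys] is_dsum_subset[OF Y] ab(2) c(2) by blast
    moreover have "c \<ominus>\<^bsub>M\<^esub> b = a" using ab cl by simp
    ultimately have "a = \<zero>\<^bsub>M\<^esub>" using i(1) ab(1) by blast
    then have "c = b" using ab cl by simp
    then show ?thesis using i(2) ab(2) c(2) by blast
  qed
  then have "sumset A B \<inter> C = {\<zero>\<^bsub>M\<^esub>}"
    using submodule_zero[OF sumset_submodule[OF A B]] submodule_zero[OF C] by blast
  moreover have "X = sumset (sumset A B) C" using s sumset_assoc[OF A B C] by simp
  ultimately show "is_dsum X (sumset A B) C" using sumset_submodule[OF A B] C by (simp add: is_dsum_def)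
qed

definition pr :: "'c set \<Rightarrow> 'c set \<Rightarrow> 'c \<Rightarrow> 'c" where
  "pr A B x = (THE a. a \<in> A \<and> x \<ominus>\<^bsub>M\<^esub> a \<in> B)"

lemma pr_unique:
  assumes d: "is_dsum (carrier M) A B" and x: "x \<in> carrier M" and a: "a \<in> A" "x \<ominus>\<^bsub>M\<^esub> a \<in> B"
  shows "pr A B x = a"
  unfolding pr_def
proof (rule the_equality)
  show "a \<in> A \<and> x \<ominus>\<^bsub>M\<^esub> a \<in> B" using a by blast
  have A: "submodule A R M" and B: "submodule B R M" and i: "A \<inter> B = {\<zero>\<^bsub>M\<^esub>}" using d by (auto simp: is_dsum_def)
  fix a' assume a': "a' \<in> A \<and> x \<ominus>\<^bsub>M\<^esub> a' \<in> B"
  have cl: "a \<in> carrier M" "a' \<in> carrier M" using submodule_carrier[OF A] a a' by auto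
  have "(x \<ominus>\<^bsub>M\<^esub> a) \<ominus>\<^bsub>M\<^esub> (x \<ominus>\<^bsub>M\<^esub> a') = a' \<ominus>\<^bsub>M\<^esub> a"
    by (rule M.minus_eq_minusI) (use cl x in simp_all)
  moreover have "(x \<ominus>\<^bsub>M\<^esub> a) \<ominus>\<^bsub>M\<^esub> (x \<ominus>\<^bsub>M\<^esub> a') \<in> B" using submodule_minus[OF B] a a' by blast
  moreover have "a' \<ominus>\<^bsub>M\<^esub> a \<in> A" using submodule_minus[OF A] a a' by blast
  ultimately have "a' \<ominus>\<^bsub>M\<^esub> a \<in> A \<inter> B" by simp
  then show "a' = a" using i cl by simp
qed

lemma pr_mem:
  assumes d: "is_dsum (carrier M) A B" and x: "x \<in> carrier M"
  shows "pr A B x \<in> A" "x \<ominus>\<^bsub>M\<^esub> pr A B x \<in> B"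
proof -
  have A: "submodule A R M" and B: "submodule B R M" using d by (auto simp: is_dsum_def)
  have "x \<in> sumset A B" using d x by (simp add: is_dsum_def)
  then obtain a b where ab: "a \<in> A" "b \<in> B" "x = a \<oplus>\<^bsub>M\<^esub> b" by (rule sumsetE)
  have cl: "a \<in> carrier M" "b \<in> carrier M" using submodule_carrier[OF A ab(1)] submodule_carrier[OF B ab(2)] .
  have "x \<ominus>\<^bsub>M\<^esub> a = b" using ab cl by (simp add: M.a_comm[of a])
  then have "pr A B x = a" using pr_unique[OF d x ab(1)] ab(2) by simp
  then show "pr A B x \<in> A" "x \<ominus>\<^bsub>M\<^esub> pr A B x \<in> B" using ab \<open>x \<ominus>\<^bsub>M\<^esub> a = b\<close> by auto
qed

lemma pr_carrier: "is_dsum (carrier M) A B \<Longrightarrow> x \<in> carrier M \<Longrightarrow> pr A B x \<in> carrier M"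
  using pr_mem(1) submodule_carrier by (auto simp: is_dsum_def)

lemma pr_add:
  assumes d: "is_dsum (carrier M) A B" and x: "x \<in> carrier M" and y: "y \<in> carrier M"
  shows "pr A B (x \<oplus>\<^bsub>M\<^esub> y) = pr A B x \<oplus>\<^bsub>M\<^esub> pr A B y"
proof (rule pr_unique[OF d])
  have A: "submodule A R M" and B: "submodule B R M" using d by (auto simp: is_dsum_def)
  note px = pr_mem[OF d x] and py = pr_mem[OF d y]
  show "pr A B x \<oplus>\<^bsub>M\<^esub> pr A B y \<in> A" by (rule submodule_add[OF A px(1) py(1)])
  have "(x \<ominus>\<^bsub>M\<^esub> pr A B x) \<oplus>\<^bsub>M\<^esub> (y \<ominus>\<^bsub>M\<^esub> pr A B y) \<in> B" by (rule submodule_add[OF B px(2) py(2)])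
  then show "(x \<oplus>\<^bsub>M\<^esub> y) \<ominus>\<^bsub>M\<^esub> (pr A B x \<oplus>\<^bsub>M\<^esub> pr A B y) \<in> B"
    using x y pr_carrier[OF d] by (simp add: M.minus_add_distrib2)
qed (use x y in simp)

lemma pr_smult:
  assumes d: "is_dsum (carrier M) A B" and x: "x \<in> carrier M" and r: "r \<in> carrier R"
  shows "pr A B (r \<odot>\<^bsub>M\<^esub> x) = r \<odot>\<^bsub>M\<^esub> pr A B x"
proof (rule pr_unique[OF d])
  have A: "submodule A R M" and B: "submodule B R M" using d by (auto simp: is_dsum_def)
  note px = pr_mem[OF d x]
  show "r \<odot>\<^bsub>M\<^esub> pr A B x \<in> A" by (rule submodule_smult[OF A r px(1)])
  have "r \<odot>\<^bsub>M\<^esub> (x \<ominus>\<^bsub>M\<^esub> pr A B x) \<in> B" by (rule submodule_smult[OF B r px(2)])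
  then show "r \<odot>\<^bsub>M\<^esub> x \<ominus>\<^bsub>M\<^esub> r \<odot>\<^bsub>M\<^esub> pr A B x \<in> B"
    using x r pr_carrier[OF d x] by (simp add: smult_minus_distr)
qed (use x r in simp)

lemma pr_id: assumes d: "is_dsum (carrier M) A B" and x: "x \<in> A" shows "pr A B x = x"
proof (rule pr_unique[OF d])
  have A: "submodule A R M" and B: "submodule B R M" using d by (auto simp: is_dsum_def)
  show xM: "x \<in> carrier M" by (rule submodule_carrier[OF A x])
  show "x \<ominus>\<^bsub>M\<^esub> x \<in> B" using xM submodule_zero[OF B] by simp
qed (rule x)

lemma pr_eq_zero_iff:
  assumes d: "is_dsum (carrier M) A B" and x: "x \<in> carrier M"
  shows "pr A B x = \<zero>\<^bsub>M\<^esub> \<longleftrightarrow> x \<in> B"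
proof
  have A: "submodule A R M" using d by (auto simp: is_dsum_def)
  show "x \<in> B" if "pr A B x = \<zero>\<^bsub>M\<^esub>" using pr_mem(2)[OF d x] that x by simp
  show "pr A B x = \<zero>\<^bsub>M\<^esub>" if "x \<in> B"
    by (rule pr_unique[OF d x submodule_zero[OF A]]) (use that x in simp)
qed

text \<open>The components of x in L, N and W1 do not depend on the bracketing. In the exchange
  argument this makes the scalars of the components add up.\<close>

lemma pr_sumset:
  assumes X: "is_dsum (carrier M) L W" and W: "is_dsum W N W1" and x: "x \<in> carrier M"
  shows "pr (sumset L N) W1 x = pr L W x \<oplus>\<^bsub>M\<^esub> pr N (sumset L W1) x"
proof (rule pr_unique[OF is_dsum_assoc(1)[OF X W] x])
  have d: "is_dsum (carrier M) N (sumset L W1)"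
    by (rule is_dsum_comm[OF is_dsum_assoc(1)[OF X is_dsum_comm[OF W]]])
  have sub: "submodule L R M" "submodule W R M" "submodule N R M" "submodule W1 R M"
    using X W by (auto simp: is_dsum_def)
  let ?l = "pr L W x" and ?n = "pr N (sumset L W1) x"
  show "?l \<oplus>\<^bsub>M\<^esub> ?n \<in> sumset L N" by (rule sumsetI[OF pr_mem(1)[OF X x] pr_mem(1)[OF d x]])
  have "x \<ominus>\<^bsub>M\<^esub> ?l \<in> sumset N W1" using pr_mem(2)[OF X x] W by (simp add: is_dsum_def)
  then obtain n w where nw: "n \<in> N" "w \<in> W1" "x \<ominus>\<^bsub>M\<^esub> ?l = n \<oplus>\<^bsub>M\<^esub> w" by (rule sumsetE)
  have cl: "?l \<in> carrier M" "n \<in> carrier M" "w \<in> carrier M"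
    using pr_carrier[OF X x] submodule_carrier sub nw by auto
  have xe: "x = (?l \<oplus>\<^bsub>M\<^esub> w) \<oplus>\<^bsub>M\<^esub> n"
    using nw(3) cl x by (simp add: M.minus_eq_iff M.a_ac)
  have "?n = n"
  proof (rule pr_unique[OF d x nw(1)])
    have "x \<ominus>\<^bsub>M\<^esub> n = ?l \<oplus>\<^bsub>M\<^esub> w" using xe cl x by (subst M.minus_eq_iff) auto
    then show "x \<ominus>\<^bsub>M\<^esub> n \<in> sumset L W1" using sumsetI[OF pr_mem(1)[OF X x] nw(2)] by simp
  qed
  moreover have "x \<ominus>\<^bsub>M\<^esub> (?l \<oplus>\<^bsub>M\<^esub> n) = w"
    using cl x xe by (subst M.minus_eq_iff) (auto simp: M.a_ac)
  ultimately show "x \<ominus>\<^bsub>M\<^esub> (?l \<oplus>\<^bsub>M\<^esub> ?n) \<in> W1" using nw(2) by simp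
qed

lemma dsum_zero_basic:
  assumes "dsum {\<zero>\<^bsub>M\<^esub>} Ns" "\<And>N. N \<in> set Ns \<Longrightarrow> basic R (M\<lparr>carrier := N\<rparr>)"
  shows "Ns = []"
proof (cases Ns)
  case (Cons N Ns')
  then obtain V where d: "is_dsum {\<zero>\<^bsub>M\<^esub>} N V" using assms(1) by auto
  then have "N = {\<zero>\<^bsub>M\<^esub>}"
    using is_dsum_subset(1)[OF d] submodule_zero[of N] by (auto simp: is_dsum_def)
  moreover have "basic R (M\<lparr>carrier := N\<rparr>)" using assms(2) Cons by simp
  ultimately show ?thesis by (simp add: basic_def)
qed

end

section \<open>Endomorphisms of basic modules and the exchange property\<close>

context root_ring
begin

lemma nonunit_nilpotent:
  assumes "r \<in> carrier R" "r \<notin> Units R"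
  shows "\<exists>n::nat. r [^] n = \<zero>"
proof -
  obtain a c where a: "0 < a" "c \<in> carrier R" "r = T a \<otimes> c" by (rule nonunit_T[OF assms])
  obtain n :: nat where "1 < real n * a" using a(1) ex_less_of_nat_mult by blast
  then have "T a [^] n = \<zero>" using a(1) T_pow[of a n] T_eq_zero_iff[of "real n * a"] by simp
  then have "r [^] n = \<zero>" using a by (simp add: nat_pow_distrib)
  then show ?thesis ..
qed

end

context root_module
begin

lemma unit_smult_eq_zero: "u \<in> Units R \<Longrightarrow> x \<in> carrier M \<Longrightarrow> u \<odot>\<^bsub>M\<^esub> x = \<zero>\<^bsub>M\<^esub> \<Longrightarrow> x = \<zero>\<^bsub>M\<^esub>"
  using unit_smult_mem[OF zero_submodule, of u x] by simp

text \<open>Two coefficients on a nonzero element differ by an annihilating scalar, which is a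
  nonunit; by locality both are units or neither is.\<close>

lemma unit_coefficient:
  assumes "r \<in> Units R" "s \<in> carrier R" "x \<in> carrier M" "x \<noteq> \<zero>\<^bsub>M\<^esub>" "r \<odot>\<^bsub>M\<^esub> x = s \<odot>\<^bsub>M\<^esub> x"
  shows "s \<in> Units R"
proof (rule ccontr)
  assume s: "s \<notin> Units R"
  have r: "r \<in> carrier R" using assms(1) by (rule Units_closed)
  have "(r \<ominus> s) \<odot>\<^bsub>M\<^esub> x = \<zero>\<^bsub>M\<^esub>" using assms r by (simp add: smult_minus_l_distr)
  then have "r \<ominus> s \<notin> Units R" using unit_smult_eq_zero assms by blast
  then have "(r \<ominus> s) \<oplus> s \<notin> Units R" using nonunit_add[of "r \<ominus> s" s] s r assms(2) by blast
  then show False using assms(1,2) r by simp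
qed

text \<open>As U is uniserial, e y is a multiple of y or y = c e y. A unit c can be inverted; for a
  nonunit c iteration gives y = c^k e^k(y), and nilpotency forces y = 0. The scalar may depend on
  y.\<close>

lemma basic_endomorphism_scalar:
  assumes U: "submodule U R M" "basic R (M\<lparr>carrier := U\<rparr>)"
    and e: "\<And>y. y \<in> U \<Longrightarrow> e y \<in> U" "\<And>r y. r \<in> carrier R \<Longrightarrow> y \<in> U \<Longrightarrow> e (r \<odot>\<^bsub>M\<^esub> y) = r \<odot>\<^bsub>M\<^esub> e y"
    and y: "y \<in> U"
  shows "\<exists>s\<in>carrier R. e y = s \<odot>\<^bsub>M\<^esub> y"
proof -
  have cl: "z \<in> carrier M" if "z \<in> U" for z using submodule_carrier[OF U(1) that] .
  have "y \<in> cyclic (e y) \<or> e y \<in> cyclic y" using U(2) y e(1)[OF y] unfolding basic_iff by blast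
  then show ?thesis
  proof
    assume "e y \<in> cyclic y" then show ?thesis unfolding cyclic_def by blast
  next
    assume "y \<in> cyclic (e y)"
    then obtain c where c: "c \<in> carrier R" "y = c \<odot>\<^bsub>M\<^esub> e y" unfolding cyclic_def by blast
    show ?thesis
    proof (cases "c \<in> Units R")
      case True
      then have ic: "inv c \<in> carrier R" by simp
      have "inv c \<odot>\<^bsub>M\<^esub> y = (inv c \<otimes> c) \<odot>\<^bsub>M\<^esub> e y"
        using c ic cl[OF e(1)[OF y]] by (simp add: smult_assoc1)
      then have "e y = inv c \<odot>\<^bsub>M\<^esub> y" using True cl[OF e(1)[OF y]] by simp
      with ic show ?thesis by blast
    next
      case False
      then obtain n :: nat where n: "c [^] n = \<zero>" using nonunit_nilpotent c(1) by blast
      have "\<exists>z\<in>U. y = c [^] k \<odot>\<^bsub>M\<^esub> z \<and> z = c \<odot>\<^bsub>M\<^esub> e z" for k :: nat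
      proof (induction k)
        case 0 show ?case using y c cl by (intro bexI[of _ y]) auto
      next
        case (Suc k)
        then obtain z where z: "z \<in> U" "y = c [^] k \<odot>\<^bsub>M\<^esub> z" "z = c \<odot>\<^bsub>M\<^esub> e z" by blast
        have "y = c [^] k \<odot>\<^bsub>M\<^esub> (c \<odot>\<^bsub>M\<^esub> e z)" using z by simp
        also have "\<dots> = c [^] Suc k \<odot>\<^bsub>M\<^esub> e z" using c(1) cl[OF e(1)[OF z(1)]] by (simp add: smult_assoc1)
        finally have "y = c [^] Suc k \<odot>\<^bsub>M\<^esub> e z" .
        moreover have "e z = c \<odot>\<^bsub>M\<^esub> e (e z)"
          using e(2)[OF c(1) e(1)[OF z(1)]] z(3) by simp
        ultimately show ?case using e(1)[OF z(1)] by blast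
      qed
      from this[of n] n have "y = \<zero>\<^bsub>M\<^esub>" using cl by auto
      moreover have "e \<zero>\<^bsub>M\<^esub> = \<zero>\<^bsub>M\<^esub>"
        using e(2)[of \<zero> y] y cl e(1)[OF y] by simp
      ultimately have "e y = \<zero> \<odot>\<^bsub>M\<^esub> y" by simp
      then show ?thesis by blast
    qed
  qed
qed

text \<open>Multiples of x inherit the coefficient r. If instead x is a multiple of y, a coefficient
  of y also acts on x and is therefore a unit, so y is in the image; and e y = 0 would force e x =
  0.\<close>

lemma basic_endomorphism_bij:
  assumes U: "submodule U R M" "basic R (M\<lparr>carrier := U\<rparr>)"
    and e: "\<And>y. y \<in> U \<Longrightarrow> e y \<in> U" "\<And>r y. r \<in> carrier R \<Longrightarrow> y \<in> U \<Longrightarrow> e (r \<odot>\<^bsub>M\<^esub> y) = r \<odot>\<^bsub>M\<^esub> e y"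
    and x: "x \<in> U" "x \<noteq> \<zero>\<^bsub>M\<^esub>" and r: "r \<in> Units R" "e x = r \<odot>\<^bsub>M\<^esub> x"
  shows "\<And>y. y \<in> U \<Longrightarrow> e y = \<zero>\<^bsub>M\<^esub> \<Longrightarrow> y = \<zero>\<^bsub>M\<^esub>" "\<And>y. y \<in> U \<Longrightarrow> \<exists>z\<in>U. e z = y"
proof -
  have cl: "z \<in> carrier M" if "z \<in> U" for z using submodule_carrier[OF U(1) that] .
  have rc: "r \<in> carrier R" "inv r \<in> carrier R" using r(1) by auto
  have cmp: "y \<in> cyclic x \<or> x \<in> cyclic y" if "y \<in> U" for y using U(2) x(1) that unfolding basic_iff by blast
  fix y assume y: "y \<in> U"
  {
    assume ey: "e y = \<zero>\<^bsub>M\<^esub>"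
    from cmp[OF y] show "y = \<zero>\<^bsub>M\<^esub>"
    proof
      assume "y \<in> cyclic x"
      then obtain c where c: "c \<in> carrier R" "y = c \<odot>\<^bsub>M\<^esub> x" unfolding cyclic_def by blast
      have "e y = c \<odot>\<^bsub>M\<^esub> (r \<odot>\<^bsub>M\<^esub> x)" using e(2)[OF c(1) x(1)] c(2) r(2) by simp
      also have "\<dots> = r \<odot>\<^bsub>M\<^esub> y" using c rc cl[OF x(1)] by (simp add: smult_assoc1[symmetric] R.m_comm)
      finally show ?thesis using unit_smult_eq_zero[OF r(1) cl[OF y]] ey by simp
    next
      assume "x \<in> cyclic y"
      then obtain c where c: "c \<in> carrier R" "x = c \<odot>\<^bsub>M\<^esub> y" unfolding cyclic_def by blast
      have "e x = \<zero>\<^bsub>M\<^esub>" using e(2)[OF c(1) y] c ey by simp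
      then show ?thesis using unit_smult_eq_zero[OF r(1) cl[OF x(1)]] r(2) x(2) by simp
    qed
  }
  from cmp[OF y] show "\<exists>z\<in>U. e z = y"
  proof
    assume "y \<in> cyclic x"
    then obtain c where c: "c \<in> carrier R" "y = c \<odot>\<^bsub>M\<^esub> x" unfolding cyclic_def by blast
    have ce: "c \<otimes> inv r \<in> carrier R" using c rc by simp
    have "e ((c \<otimes> inv r) \<odot>\<^bsub>M\<^esub> x) = (c \<otimes> inv r) \<odot>\<^bsub>M\<^esub> (r \<odot>\<^bsub>M\<^esub> x)" using e(2)[OF ce x(1)] r(2) by simp
    also have "\<dots> = (c \<otimes> (inv r \<otimes> r)) \<odot>\<^bsub>M\<^esub> x"
      using c rc cl[OF x(1)] by (simp add: smult_assoc1[symmetric] R.m_assoc del: Units_l_inv)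
    also have "\<dots> = y" using c r(1) by simp
    finally show ?thesis using submodule_smult[OF U(1) ce x(1)] by blast
  next
    assume "x \<in> cyclic y"
    then obtain c where c: "c \<in> carrier R" "x = c \<odot>\<^bsub>M\<^esub> y" unfolding cyclic_def by blast
    obtain s where s: "s \<in> carrier R" "e y = s \<odot>\<^bsub>M\<^esub> y"
      using basic_endomorphism_scalar[of U e, OF U e y] by blast
    have "r \<odot>\<^bsub>M\<^esub> x = c \<odot>\<^bsub>M\<^esub> (s \<odot>\<^bsub>M\<^esub> y)" using e(2)[OF c(1) y] c(2) s(2) r(2) by simp
    also have "\<dots> = s \<odot>\<^bsub>M\<^esub> x" using c s cl[OF y] by (simp add: smult_assoc1[symmetric] R.m_comm)
    finally have su: "s \<in> Units R" by (rule unit_coefficient[OF r(1) s(1) cl[OF x(1)] x(2)])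
    then have si: "inv s \<in> carrier R" by simp
    have "e (inv s \<odot>\<^bsub>M\<^esub> y) = (inv s \<otimes> s) \<odot>\<^bsub>M\<^esub> y"
      using e(2)[OF si y] s si cl[OF y] by (simp add: smult_assoc1)
    then have "e (inv s \<odot>\<^bsub>M\<^esub> y) = y" using su cl[OF y] by simp
    then show ?thesis using submodule_smult[OF U(1) si y] by blast
  qed
qed

text \<open>The components of the identity on \<open>U\<close> with respect to the second decomposition act on \<open>x\<close> as
  scalars adding up to a unit, so one of them is a unit.\<close>

lemma exchange_summand:
  assumes U: "is_dsum (carrier M) U V" "basic R (M\<lparr>carrier := U\<rparr>)" and x: "x \<in> U" "x \<noteq> \<zero>\<^bsub>M\<^esub>"
  shows "is_dsum (carrier M) L W \<Longrightarrow> dsum W Ns \<Longrightarrow>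
    s \<in> carrier R \<Longrightarrow> s \<notin> Units R \<Longrightarrow> pr U V (pr L W x) = s \<odot>\<^bsub>M\<^esub> x \<Longrightarrow>
    \<exists>N W' Ns' r. mset Ns = add_mset N (mset Ns') \<and> dsum W' Ns' \<and> is_dsum W N W' \<and>
      r \<in> Units R \<and> pr U V (pr N (sumset L W') x) = r \<odot>\<^bsub>M\<^esub> x"
proof (induction Ns arbitrary: L W s)
  case Nil
  have sU: "submodule U R M" using U(1) by (simp add: is_dsum_def)
  have xM: "x \<in> carrier M" by (rule submodule_carrier[OF sU x(1)])
  \<comment> \<open>With no summands left L is all of M, the projection is the identity and its
    coefficient on x is 1, against s being a nonunit.\<close>
  have "W = {\<zero>\<^bsub>M\<^esub>}" using Nil by simp
  then have "x \<ominus>\<^bsub>M\<^esub> pr L W x = \<zero>\<^bsub>M\<^esub>" using pr_mem(2)[OF Nil(1) xM] by simp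
  then have "pr L W x = x" using xM pr_carrier[OF Nil(1) xM] by simp
  then have "\<one> \<odot>\<^bsub>M\<^esub> x = s \<odot>\<^bsub>M\<^esub> x" using Nil(5) pr_id[OF U(1) x(1)] xM by simp
  then have "s \<in> Units R" by (rule unit_coefficient[OF Units_one_closed Nil(3) xM x(2)])
  with Nil(4) show ?case by blast
next
  case (Cons N Ns)
  have sU: "submodule U R M" using U(1) by (simp add: is_dsum_def)
  have xM: "x \<in> carrier M" by (rule submodule_carrier[OF sU x(1)])
  obtain W1 where W1: "dsum W1 Ns" "is_dsum W N W1" using Cons.prems(2) by auto
  have sub: "submodule L R M" "submodule N R M" "submodule W1 R M" "submodule W R M"
    using Cons.prems(1) W1(2) by (auto simp: is_dsum_def)
  have dN: "is_dsum (carrier M) N (sumset L W1)"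
    by (rule is_dsum_comm[OF is_dsum_assoc(1)[OF Cons.prems(1) is_dsum_comm[OF W1(2)]]])
  let ?e = "\<lambda>y. pr U V (pr N (sumset L W1) y)"
  \<comment> \<open>The N-component acts on x by some r. If r is a unit, N is the summand sought;
    otherwise N is moved into L, whose coefficient s + r is again a nonunit by locality.\<close>
  have "\<exists>r\<in>carrier R. ?e x = r \<odot>\<^bsub>M\<^esub> x"
  proof (rule basic_endomorphism_scalar[of U ?e, OF sU U(2) _ _ x(1)])
    fix y assume "y \<in> U"
    then have yM: "y \<in> carrier M" by (rule submodule_carrier[OF sU])
    show "?e y \<in> U" by (rule pr_mem(1)[OF U(1) pr_carrier[OF dN yM]])
    fix r assume r: "r \<in> carrier R"
    show "?e (r \<odot>\<^bsub>M\<^esub> y) = r \<odot>\<^bsub>M\<^esub> ?e y"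
      using pr_smult[OF dN yM r] pr_smult[OF U(1) pr_carrier[OF dN yM] r] by simp
  qed
  then obtain r where r: "r \<in> carrier R" "?e x = r \<odot>\<^bsub>M\<^esub> x" ..
  show ?case
  proof (cases "r \<in> Units R")
    case True
    have "mset (N # Ns) = add_mset N (mset Ns)" by simp
    with W1 True r(2) show ?thesis by blast
  next
    case False
    have d1: "is_dsum (carrier M) (sumset L N) W1" by (rule is_dsum_assoc(1)[OF Cons.prems(1) W1(2)])
    have "pr U V (pr (sumset L N) W1 x) = (s \<oplus> r) \<odot>\<^bsub>M\<^esub> x"
      unfolding pr_sumset[OF Cons.prems(1) W1(2) xM]
      using pr_add[OF U(1) pr_carrier[OF Cons.prems(1) xM] pr_carrier[OF dN xM]] Cons.prems(3,5) r xM
      by (simp add: smult_l_distr)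
    from Cons.IH[OF d1 W1(1) _ nonunit_add[OF Cons.prems(3,4) r(1) False] this]
    obtain N' W' Ns' r' where N': "mset Ns = add_mset N' (mset Ns')" "dsum W' Ns'" "is_dsum W1 N' W'"
      "r' \<in> Units R" "pr U V (pr N' (sumset (sumset L N) W') x) = r' \<odot>\<^bsub>M\<^esub> x"
      using Cons.prems(3) r(1) by auto
    have sub': "submodule N' R M" "submodule W' R M" using N'(3) by (auto simp: is_dsum_def)
    have "is_dsum W N' (sumset N W')" "is_dsum (sumset N W') N W'"
      using is_dsum_assoc[OF W1(2) is_dsum_comm[OF N'(3)]] is_dsum_comm by blast+
    moreover from this have "dsum (sumset N W') (N # Ns')" using N'(2) by auto
    moreover have "mset (N # Ns) = add_mset N' (mset (N # Ns'))" using N'(1) by simp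
    moreover have "pr U V (pr N' (sumset L (sumset N W')) x) = r' \<odot>\<^bsub>M\<^esub> x"
      using N'(5) sumset_assoc[OF sub(1,2) sub'(2)] by simp
    ultimately show ?thesis using N'(4) by blast
  qed
qed

text \<open>Let p and \<pi> be the projections to N and U. The unit coefficient makes \<pi> p
  bijective on U, so p is injective there. Every z in N is comparable with p x, which makes \<pi>
  injective on N; hence p maps U onto N, and U can replace N as a complement of C.\<close>

lemma exchange_iso:
  assumes U: "is_dsum (carrier M) U V" "basic R (M\<lparr>carrier := U\<rparr>)" and x: "x \<in> U" "x \<noteq> \<zero>\<^bsub>M\<^esub>"
    and N: "is_dsum (carrier M) N C" "basic R (M\<lparr>carrier := N\<rparr>)"
    and r: "r \<in> Units R" "pr U V (pr N C x) = r \<odot>\<^bsub>M\<^esub> x"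
  shows "module_iso R (M\<lparr>carrier := U\<rparr>) (M\<lparr>carrier := N\<rparr>) \<noteq> {}" "is_dsum (carrier M) U C"
proof -
  have sub: "submodule U R M" "submodule N R M" "submodule C R M" using U(1) N(1) by (auto simp: is_dsum_def)
  let ?p = "pr N C" and ?\<pi> = "pr U V"
  let ?e = "\<lambda>y. ?\<pi> (?p y)"
  have UM: "y \<in> carrier M" if "y \<in> U" for y using submodule_carrier[OF sub(1) that] .
  have NM: "y \<in> carrier M" if "y \<in> N" for y using submodule_carrier[OF sub(2) that] .
  have pM: "?p y \<in> carrier M" "?p y \<in> N" if "y \<in> carrier M" for y
    using pr_carrier[OF N(1) that] pr_mem(1)[OF N(1) that] .
  have e1: "?e y \<in> U" if "y \<in> U" for y using pr_mem(1)[OF U(1) pM(1)[OF UM[OF that]]] .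
  have e2: "?e (c \<odot>\<^bsub>M\<^esub> y) = c \<odot>\<^bsub>M\<^esub> ?e y" if "c \<in> carrier R" "y \<in> U" for c y
    using pr_smult[OF N(1) UM[OF that(2)] that(1)] pr_smult[OF U(1) pM(1)[OF UM[OF that(2)]] that(1)] by simp
  have bij1: "y = \<zero>\<^bsub>M\<^esub>" if y: "y \<in> U" "?e y = \<zero>\<^bsub>M\<^esub>" for y
    by (rule basic_endomorphism_bij(1)[of U ?e, OF sub(1) U(2) e1 e2 x r y])
  have bij2: "\<exists>z\<in>U. ?e z = y" if y: "y \<in> U" for y
    by (rule basic_endomorphism_bij(2)[of U ?e, OF sub(1) U(2) e1 e2 x r y])
  have \<pi>0: "?\<pi> \<zero>\<^bsub>M\<^esub> = \<zero>\<^bsub>M\<^esub>" using pr_id[OF U(1) submodule_zero[OF sub(1)]] .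
  have p0: "?p \<zero>\<^bsub>M\<^esub> = \<zero>\<^bsub>M\<^esub>" using pr_id[OF N(1) submodule_zero[OF sub(2)]] .
  have ker: "z = \<zero>\<^bsub>M\<^esub>" if z: "z \<in> N" "?\<pi> z = \<zero>\<^bsub>M\<^esub>" for z
  proof -
    have xM: "x \<in> carrier M" using UM x by blast
    have "z \<in> cyclic (?p x) \<or> ?p x \<in> cyclic z" using N(2) z(1) pM(2)[OF xM] unfolding basic_iff by blast
    then show ?thesis
    proof
      assume "z \<in> cyclic (?p x)"
      then obtain c where c: "c \<in> carrier R" "z = c \<odot>\<^bsub>M\<^esub> ?p x" unfolding cyclic_def by blast
      then have zc: "z = ?p (c \<odot>\<^bsub>M\<^esub> x)" using pr_smult[OF N(1) xM c(1)] by simp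
      have "?e (c \<odot>\<^bsub>M\<^esub> x) = \<zero>\<^bsub>M\<^esub>" using z(2) zc by simp
      then have "c \<odot>\<^bsub>M\<^esub> x = \<zero>\<^bsub>M\<^esub>" using bij1[OF submodule_smult[OF sub(1) c(1) x(1)]] by simp
      then show ?thesis using zc p0 by simp
    next
      assume "?p x \<in> cyclic z"
      then obtain c where c: "c \<in> carrier R" "?p x = c \<odot>\<^bsub>M\<^esub> z" unfolding cyclic_def by blast
      have "?e x = c \<odot>\<^bsub>M\<^esub> ?\<pi> z" using pr_smult[OF U(1) NM[OF z(1)] c(1)] c(2) by simp
      then have "?e x = \<zero>\<^bsub>M\<^esub>" using z(2) c(1) by simp
      then show ?thesis using bij1[OF x(1)] x(2) by simp
    qed
  qed
  have pr_diff: "pr A B (a \<ominus>\<^bsub>M\<^esub> b) = pr A B a \<ominus>\<^bsub>M\<^esub> pr A B b"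
    if "is_dsum (carrier M) A B" "a \<in> carrier M" "b \<in> carrier M" for A B a b
  proof -
    have "pr A B (a \<ominus>\<^bsub>M\<^esub> b) \<oplus>\<^bsub>M\<^esub> pr A B b = pr A B a"
      using pr_add[OF that(1), of "a \<ominus>\<^bsub>M\<^esub> b" b] that(2,3) by simp
    then have "pr A B a \<ominus>\<^bsub>M\<^esub> pr A B b = pr A B (a \<ominus>\<^bsub>M\<^esub> b)"
      using pr_carrier[OF that(1)] that(2,3) by (subst M.minus_eq_iff) auto
    then show ?thesis by simp
  qed
  have surj: "\<exists>u\<in>U. ?p u = y" if y: "y \<in> N" for y
  proof -
    have yM: "y \<in> carrier M" using NM y by blast
    obtain u where u: "u \<in> U" "?e u = ?\<pi> y" using bij2[OF pr_mem(1)[OF U(1) yM]] by blast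
    have pu: "?p u \<in> N" "?p u \<in> carrier M" using pM UM[OF u(1)] by auto
    have "?\<pi> (y \<ominus>\<^bsub>M\<^esub> ?p u) = \<zero>\<^bsub>M\<^esub>"
      using pr_diff[OF U(1) yM pu(2)] u(2) pr_carrier[OF U(1) yM] by simp
    then have "y \<ominus>\<^bsub>M\<^esub> ?p u = \<zero>\<^bsub>M\<^esub>" using ker submodule_minus[OF sub(2) y pu(1)] by blast
    then show ?thesis using u(1) yM pu(2) by auto
  qed
  have inj: "u = \<zero>\<^bsub>M\<^esub>" if "u \<in> U" "?p u = \<zero>\<^bsub>M\<^esub>" for u using bij1[OF that(1)] that(2) \<pi>0 by simp
  show "is_dsum (carrier M) U C" unfolding is_dsum_def
  proof (intro conjI sub)
    show "U \<inter> C = {\<zero>\<^bsub>M\<^esub>}"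
      using inj pr_eq_zero_iff[OF N(1)] UM submodule_zero[OF sub(1)] submodule_zero[OF sub(3)] by blast
    show "carrier M = sumset U C"
    proof
      show "sumset U C \<subseteq> carrier M" using submodule_carrier[OF sumset_submodule[OF sub(1,3)]] by blast
      show "carrier M \<subseteq> sumset U C"
      proof
        fix m assume m: "m \<in> carrier M"
        obtain u where u: "u \<in> U" "?p u = ?p m" using surj[OF pM(2)[OF m]] by blast
        have "?p (m \<ominus>\<^bsub>M\<^esub> u) = \<zero>\<^bsub>M\<^esub>" using pr_diff[OF N(1) m UM[OF u(1)]] u(2) pM(1)[OF m] by simp
        then have "m \<ominus>\<^bsub>M\<^esub> u \<in> C" using pr_eq_zero_iff[OF N(1)] m UM[OF u(1)] by simp
        from sumsetI[OF u(1) this] show "m \<in> sumset U C" using m UM[OF u(1)] by simp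
      qed
    qed
  qed
  let ?f = "restrict ?p U"
  have "?f \<in> U \<rightarrow>\<^sub>E N" using pM UM by auto
  moreover have "?f (u \<oplus>\<^bsub>M\<^esub> v) = ?f u \<oplus>\<^bsub>M\<^esub> ?f v" if "u \<in> U" "v \<in> U" for u v
    using that submodule_add[OF sub(1)] pr_add[OF N(1)] UM by simp
  moreover have "?f (c \<odot>\<^bsub>M\<^esub> u) = c \<odot>\<^bsub>M\<^esub> ?f u" if "c \<in> carrier R" "u \<in> U" for c u
    using that submodule_smult[OF sub(1)] pr_smult[OF N(1)] UM by simp
  moreover have "bij_betw ?f U N"
  proof -
    have "inj_on ?p U"
    proof (rule inj_onI)
      fix u v assume uv: "u \<in> U" "v \<in> U" "?p u = ?p v"
      then have "?p (u \<ominus>\<^bsub>M\<^esub> v) = \<zero>\<^bsub>M\<^esub>" using pr_diff[OF N(1)] UM pM by simp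
      then have "u \<ominus>\<^bsub>M\<^esub> v = \<zero>\<^bsub>M\<^esub>" using inj submodule_minus[OF sub(1) uv(1,2)] by blast
      then show "u = v" using UM uv by simp
    qed
    moreover have "?p ` U = N" using surj pM UM by blast
    ultimately show ?thesis by (simp add: bij_betw_def)
  qed
  ultimately have "?f \<in> module_iso R (M\<lparr>carrier := U\<rparr>) (M\<lparr>carrier := N\<rparr>)"
    unfolding module_iso_def module_hom_def by simp
  then show "module_iso R (M\<lparr>carrier := U\<rparr>) (M\<lparr>carrier := N\<rparr>) \<noteq> {}" by blast
qed

text \<open>L collects the summands already matched and is a common complement of both remaining
  parts. \<open>rel_mset\<close> disregards the order, so no permutation is carried through the
  induction.\<close>

lemma basic_dsum_unique:
  "dsum V Us \<Longrightarrow> dsum W Ns \<Longrightarrow> is_dsum (carrier M) L V \<Longrightarrow> is_dsum (carrier M) L W \<Longrightarrow>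
    (\<And>U. U \<in> set Us \<Longrightarrow> basic R (M\<lparr>carrier := U\<rparr>)) \<Longrightarrow> (\<And>N. N \<in> set Ns \<Longrightarrow> basic R (M\<lparr>carrier := N\<rparr>)) \<Longrightarrow>
    rel_mset (\<lambda>U N. module_iso R (M\<lparr>carrier := U\<rparr>) (M\<lparr>carrier := N\<rparr>) \<noteq> {}) (mset Us) (mset Ns)"
proof (induction Us arbitrary: V W Ns L)
  case Nil
  have V: "V = {\<zero>\<^bsub>M\<^esub>}" using Nil(1) by simp
  have sub: "submodule L R M" "submodule W R M" using Nil(4) by (auto simp: is_dsum_def)
  have "carrier M \<subseteq> L"
  proof
    fix m assume m: "m \<in> carrier M"
    have "m \<ominus>\<^bsub>M\<^esub> pr L V m = \<zero>\<^bsub>M\<^esub>" using pr_mem(2)[OF Nil(3) m] V by simp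
    then show "m \<in> L" using pr_mem(1)[OF Nil(3) m] pr_carrier[OF Nil(3) m] m by simp
  qed
  then have "W \<subseteq> L \<inter> W" using submodule_carrier[OF sub(2)] by blast
  then have "W = {\<zero>\<^bsub>M\<^esub>}" using Nil(4) submodule_zero[OF sub(2)] unfolding is_dsum_def by blast
  then have "Ns = []" using dsum_zero_basic Nil(2,6) by blast
  then show ?case by (simp add: rel_mset_Zero)
next
  case (Cons U Us)
  obtain V' where V': "dsum V' Us" "is_dsum V U V'" using Cons.prems(1) by auto
  have bU: "basic R (M\<lparr>carrier := U\<rparr>)" using Cons.prems(5) by simp
  have sub: "submodule U R M" "submodule V' R M" "submodule L R M" "submodule W R M"
    using V'(2) Cons.prems(4) by (auto simp: is_dsum_def)
  have dU: "is_dsum (carrier M) U (sumset L V')"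
    by (rule is_dsum_comm[OF is_dsum_assoc(1)[OF Cons.prems(3) is_dsum_comm[OF V'(2)]]])
  obtain x where x: "x \<in> U" "x \<noteq> \<zero>\<^bsub>M\<^esub>"
    using bU submodule_zero[OF sub(1)] unfolding basic_iff by blast
  have xM: "x \<in> carrier M" by (rule submodule_carrier[OF sub(1) x(1)])
  \<comment> \<open>The L-component of x lies in the complement of U, so the exchange starts with
    coefficient 0.\<close>
  have "pr L W x \<in> sumset L V'" using pr_mem(1)[OF Cons.prems(4) xM] sumset_left[OF sub(3,2)] by blast
  then have "pr U (sumset L V') (pr L W x) = \<zero> \<odot>\<^bsub>M\<^esub> x"
    using pr_eq_zero_iff[OF dU pr_carrier[OF Cons.prems(4) xM]] xM by simp
  moreover have "\<zero> \<notin> Units R"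
    using unit_smult_eq_zero[of \<zero> x] x(2) xM by auto
  ultimately obtain N W' Ns' r where N: "mset Ns = add_mset N (mset Ns')" "dsum W' Ns'" "is_dsum W N W'"
    "r \<in> Units R" "pr U (sumset L V') (pr N (sumset L W') x) = r \<odot>\<^bsub>M\<^esub> x"
    using exchange_summand[OF dU bU x Cons.prems(4,2) R.zero_closed] by blast
  have setN: "set Ns = insert N (set Ns')" using N(1) by (metis set_mset_add_mset_insert set_mset_mset)
  have dN: "is_dsum (carrier M) N (sumset L W')" and dLW: "is_dsum (sumset L W') L W'"
    using is_dsum_assoc[OF Cons.prems(4) is_dsum_comm[OF N(3)]] is_dsum_comm by blast+
  have bN: "basic R (M\<lparr>carrier := N\<rparr>)" using Cons.prems(6) setN by blast
  note ex = exchange_iso[OF dU bU x dN bN N(4,5)]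
  \<comment> \<open>Because U has taken the place of N, both remaining parts again have a common
    complement, now L + U.\<close>
  have "is_dsum (carrier M) (sumset U L) W'" by (rule is_dsum_assoc(1)[OF ex(2) dLW])
  then have d2: "is_dsum (carrier M) (sumset L U) W'" using sumset_comm[OF sub(1,3)] by simp
  have d1: "is_dsum (carrier M) (sumset L U) V'" by (rule is_dsum_assoc(1)[OF Cons.prems(3) V'(2)])
  have "rel_mset (\<lambda>U N. module_iso R (M\<lparr>carrier := U\<rparr>) (M\<lparr>carrier := N\<rparr>) \<noteq> {}) (mset Us) (mset Ns')"
    by (rule Cons.IH[OF V'(1) N(2) d1 d2]) (use Cons.prems(5,6) setN in auto)
  then show ?case using rel_mset_Plus[of _ U N] ex(1) N(1) by auto
qed

end


section \<open>Direct sums of lists of submodules\<close>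

context Module.module
begin

text \<open>The product form for an arbitrary set X and with the recursive \<open>psum\<close>, so
  that induction on the list is possible.\<close>

definition direct_sum :: "'c set \<Rightarrow> 'c set list \<Rightarrow> bool" where
  "direct_sum X Ns \<longleftrightarrow> (\<forall>N\<in>set Ns. submodule N R M) \<and>
     bij_betw (\<lambda>x. psum x (length Ns)) (\<Pi>\<^sub>E i\<in>{..<length Ns}. Ns ! i) X"

lemma finsum_eq_psum: "(\<And>k. k < n \<Longrightarrow> x k \<in> carrier M) \<Longrightarrow> (\<Oplus>\<^bsub>M\<^esub>i\<in>{..<n}. x i) = psum x n"
proof (induction n)
  case (Suc n)
  have "(\<Oplus>\<^bsub>M\<^esub>i\<in>{..<n}. x i) \<in> carrier M" using Suc.prems by (intro M.finsum_closed) auto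
  then show ?case using Suc by (simp add: lessThan_Suc Pi_def M.a_comm)
qed simp

lemma is_direct_sum_iff: "is_direct_sum R M Ns \<longleftrightarrow> direct_sum (carrier M) Ns"
proof -
  have eq: "(\<Oplus>\<^bsub>M\<^esub>i\<in>{..<length Ns}. x i) = psum x (length Ns)"
    if "\<forall>N\<in>set Ns. submodule N R M" "x \<in> (\<Pi>\<^sub>E i\<in>{..<length Ns}. Ns ! i)" for x
  proof (rule finsum_eq_psum)
    fix k assume "k < length Ns"
    then have "x k \<in> Ns ! k" "Ns ! k \<in> set Ns" using that(2) by auto
    then show "x k \<in> carrier M" using that(1) submodule_carrier by blast
  qed
  show ?thesis unfolding is_direct_sum_def direct_sum_def
    by (intro conj_cong refl bij_betw_cong eq)
qed

lemma PiE_snoc: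
  "x \<in> (\<Pi>\<^sub>E i\<in>{..<Suc (length Ns)}. (Ns @ [U]) ! i) \<longleftrightarrow>
    (\<exists>y\<in>(\<Pi>\<^sub>E i\<in>{..<length Ns}. Ns ! i). \<exists>u\<in>U. x = y(length Ns := u))" (is "?L \<longleftrightarrow> ?Rt")
proof
  let ?n = "length Ns"
  assume L: ?L
  let ?y = "restrict x {..<?n}"
  have "?y \<in> (\<Pi>\<^sub>E i\<in>{..<?n}. Ns ! i)"
  proof (rule PiE_I)
    fix i assume i: "i \<in> {..<?n}"
    then have "x i \<in> (Ns @ [U]) ! i" using L by (intro PiE_mem[OF L]) auto
    then show "?y i \<in> Ns ! i" using i by (simp add: nth_append)
  qed simp
  moreover have "x ?n \<in> U" using PiE_mem[OF L, of ?n] by simp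
  moreover have "x = ?y(?n := x ?n)"
  proof
    fix i show "x i = (?y(?n := x ?n)) i"
      using PiE_arb[OF L, of i] by (cases "i < ?n"; cases "i = ?n") auto
  qed
  ultimately show ?Rt by blast
next
  let ?n = "length Ns"
  assume ?Rt
  then obtain y u where y: "y \<in> (\<Pi>\<^sub>E i\<in>{..<?n}. Ns ! i)" "u \<in> U" "x = y(?n := u)" by blast
  show ?L unfolding y(3)
  proof (rule PiE_I)
    fix i assume "i \<in> {..<Suc ?n}"
    then show "(y(?n := u)) i \<in> (Ns @ [U]) ! i"
      using y(2) PiE_mem[OF y(1), of i] by (cases "i = ?n") (auto simp: nth_append)
  next
    fix i assume "i \<notin> {..<Suc ?n}"
    then show "(y(?n := u)) i = undefined" using PiE_arb[OF y(1), of i] by auto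
  qed
qed

lemma psum_fun_upd: "psum (y(n := u)) (Suc n) = psum y n \<oplus>\<^bsub>M\<^esub> u"
proof -
  have "psum (y(n := u)) n = psum y n" by (rule psum_cong) simp
  then show ?thesis by simp
qed

text \<open>The induction is at the end of the list, where \<open>psum\<close> adds its last term;
  \<open>dsum\<close> splits at the head, hence the reversal.\<close>

lemma direct_sum_iff_dsum: "direct_sum X Ns \<longleftrightarrow> dsum X (rev Ns)"
proof (induction Ns arbitrary: X rule: rev_induct)
  case Nil
  have "direct_sum X [] \<longleftrightarrow> bij_betw (\<lambda>_. \<zero>\<^bsub>M\<^esub>) {\<lambda>_::nat. undefined :: 'c} X"
    by (simp add: direct_sum_def)
  also have "\<dots> \<longleftrightarrow> X = {\<zero>\<^bsub>M\<^esub>}" by (auto simp: bij_betw_def)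
  finally show ?case by simp
next
  case (snoc U Ns)
  let ?n = "length Ns" and ?P = "\<Pi>\<^sub>E i\<in>{..<length Ns}. Ns ! i"
  let ?Q = "\<Pi>\<^sub>E i\<in>{..<Suc (length Ns)}. (Ns @ [U]) ! i"
  have upd: "y(?n := u) \<in> ?Q" if "y \<in> ?P" "u \<in> U" for y u unfolding PiE_snoc using that by blast
  have "direct_sum X (Ns @ [U]) \<longleftrightarrow> (\<exists>V. direct_sum V Ns \<and> is_dsum X U V)"
  proof
    assume d: "direct_sum X (Ns @ [U])"
    then have subs: "\<forall>N\<in>set Ns. submodule N R M" and U: "submodule U R M"
      and inj: "inj_on (\<lambda>x. psum x (Suc ?n)) ?Q" and im: "(\<lambda>x. psum x (Suc ?n)) ` ?Q = X"
      by (auto simp: direct_sum_def bij_betw_def)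
    let ?V = "(\<lambda>x. psum x ?n) ` ?P"
    have inj2: "y = y' \<and> u = u'"
      if "y \<in> ?P" "u \<in> U" "y' \<in> ?P" "u' \<in> U" "psum y ?n \<oplus>\<^bsub>M\<^esub> u = psum y' ?n \<oplus>\<^bsub>M\<^esub> u'" for y u y' u'
    proof -
      have eq: "y(?n := u) = y'(?n := u')"
        by (rule inj_onD[OF inj _ upd[OF that(1,2)] upd[OF that(3,4)]]) (simp only: psum_fun_upd that(5))
      have "y i = y' i" for i
      proof (cases "i = ?n")
        case True
        then show ?thesis using PiE_arb[OF that(1), of i] PiE_arb[OF that(3), of i] by simp
      next
        case False then show ?thesis using fun_cong[OF eq, of i] by simp
      qed
      moreover have "u = u'" using fun_cong[OF eq, of ?n] by simp
      ultimately show ?thesis by auto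
    qed
    have zU: "\<zero>\<^bsub>M\<^esub> \<in> U" by (rule submodule_zero[OF U])
    have V: "direct_sum ?V Ns" unfolding direct_sum_def bij_betw_def
    proof (intro conjI subs inj_onI refl)
      fix y y' assume "y \<in> ?P" "y' \<in> ?P" "psum y ?n = psum y' ?n"
      then show "y = y'" using inj2[of y "\<zero>\<^bsub>M\<^esub>" y' "\<zero>\<^bsub>M\<^esub>"] zU by simp
    qed
    then have subV: "submodule ?V R M" using snoc.IH dsum_submodule by blast
    have "X = sumset U ?V"
    proof (intro equalityI subsetI)
      fix a assume "a \<in> X"
      then obtain x where "x \<in> ?Q" "a = psum x (Suc ?n)" using im by blast
      then obtain y u where yu: "y \<in> ?P" "u \<in> U" "a = psum (y(?n := u)) (Suc ?n)" unfolding PiE_snoc by blast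
      then have V: "psum y ?n \<in> ?V" by blast
      have "a = u \<oplus>\<^bsub>M\<^esub> psum y ?n"
        using yu(3) submodule_carrier[OF U yu(2)] submodule_carrier[OF subV V] by (simp only: psum_fun_upd M.a_comm)
      then show "a \<in> sumset U ?V" using sumsetI[OF yu(2) V] by simp
    next
      fix a assume "a \<in> sumset U ?V"
      then obtain u v where uv: "u \<in> U" "v \<in> ?V" "a = u \<oplus>\<^bsub>M\<^esub> v" by (rule sumsetE)
      then obtain y where y: "y \<in> ?P" "v = psum y ?n" by blast
      have "a = psum (y(?n := u)) (Suc ?n)" unfolding psum_fun_upd
        using uv y submodule_carrier[OF U uv(1)] submodule_carrier[OF subV uv(2)] by (simp add: M.a_comm)
      then show "a \<in> X" using im upd[OF y(1) uv(1)] by blast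
    qed
    moreover have "U \<inter> ?V = {\<zero>\<^bsub>M\<^esub>}"
    proof -
      have "a = \<zero>\<^bsub>M\<^esub>" if a: "a \<in> U" "a \<in> ?V" for a
      proof -
        obtain y where y: "y \<in> ?P" "a = psum y ?n" using a(2) by blast
        obtain z where z: "z \<in> ?P" "\<zero>\<^bsub>M\<^esub> = psum z ?n" using submodule_zero[OF subV] by blast
        \<comment> \<open>Two expressions for a, one with zero U-part and one with zero V-part; by
          uniqueness a vanishes.\<close>
        have "psum y ?n \<oplus>\<^bsub>M\<^esub> \<zero>\<^bsub>M\<^esub> = psum z ?n \<oplus>\<^bsub>M\<^esub> a"
          using submodule_carrier[OF U a(1)] y(2) z(2)[symmetric] by simp
        from inj2[OF y(1) zU z(1) a(1) this] show ?thesis by simp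
      qed
      then show ?thesis using zU submodule_zero[OF subV] by blast
    qed
    ultimately have "is_dsum X U ?V" using U subV by (simp add: is_dsum_def)
    with V show "\<exists>V. direct_sum V Ns \<and> is_dsum X U V" by blast
  next
    assume "\<exists>V. direct_sum V Ns \<and> is_dsum X U V"
    then obtain V where V: "direct_sum V Ns" and d: "is_dsum X U V" by blast
    have U: "submodule U R M" and sV: "submodule V R M" and i: "U \<inter> V = {\<zero>\<^bsub>M\<^esub>}" and X: "X = sumset U V"
      using d by (auto simp: is_dsum_def)
    have inj: "inj_on (\<lambda>x. psum x ?n) ?P" and im: "(\<lambda>x. psum x ?n) ` ?P = V"
      using V by (auto simp: direct_sum_def bij_betw_def)
    have pV: "psum y ?n \<in> V" if "y \<in> ?P" for y using im that by blast
    have cl: "psum y ?n \<in> carrier M" if "y \<in> ?P" for y using submodule_carrier[OF sV pV[OF that]] .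
    have clU: "u \<in> carrier M" if "u \<in> U" for u using submodule_carrier[OF U that] .
    have "inj_on (\<lambda>x. psum x (Suc ?n)) ?Q"
    proof (rule inj_onI)
      fix x x' assume xx: "x \<in> ?Q" "x' \<in> ?Q" "psum x (Suc ?n) = psum x' (Suc ?n)"
      obtain y u where y: "y \<in> ?P" "u \<in> U" "x = y(?n := u)" using xx(1) unfolding PiE_snoc by blast
      obtain y' u' where y': "y' \<in> ?P" "u' \<in> U" "x' = y'(?n := u')" using xx(2) unfolding PiE_snoc by blast
      have "psum y ?n \<oplus>\<^bsub>M\<^esub> u = psum y' ?n \<oplus>\<^bsub>M\<^esub> u'" using xx(3) unfolding y(3) y'(3) psum_fun_upd .
      then have e: "psum y ?n \<ominus>\<^bsub>M\<^esub> psum y' ?n = u' \<ominus>\<^bsub>M\<^esub> u"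
        by (rule M.minus_eq_minusI) (use cl clU y y' in auto)
      have "u' \<ominus>\<^bsub>M\<^esub> u \<in> U" by (rule submodule_minus[OF U y'(2) y(2)])
      moreover have "u' \<ominus>\<^bsub>M\<^esub> u \<in> V" unfolding e[symmetric] by (rule submodule_minus[OF sV pV[OF y(1)] pV[OF y'(1)]])
      ultimately have z: "u' \<ominus>\<^bsub>M\<^esub> u = \<zero>\<^bsub>M\<^esub>" using i by blast
      then have "u' = u" using clU y(2) y'(2) by simp
      moreover have "psum y ?n = psum y' ?n" using e z cl y(1) y'(1) by simp
      then have "y = y'" using inj_onD[OF inj _ y(1) y'(1)] by blast
      ultimately show "x = x'" using y(3) y'(3) by simp
    qed
    moreover have "(\<lambda>x. psum x (Suc ?n)) ` ?Q = X"
    proof (intro equalityI subsetI)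
      fix a assume "a \<in> (\<lambda>x. psum x (Suc ?n)) ` ?Q"
      then obtain x where "x \<in> ?Q" "a = psum x (Suc ?n)" by blast
      then obtain y u where yu: "y \<in> ?P" "u \<in> U" "a = psum (y(?n := u)) (Suc ?n)" unfolding PiE_snoc by blast
      then have "a = u \<oplus>\<^bsub>M\<^esub> psum y ?n" unfolding psum_fun_upd using cl clU by (simp add: M.a_comm)
      then show "a \<in> X" unfolding X using sumsetI[OF yu(2) pV[OF yu(1)]] by simp
    next
      fix a assume "a \<in> X"
      then obtain u v where uv: "u \<in> U" "v \<in> V" "a = u \<oplus>\<^bsub>M\<^esub> v" unfolding X by (rule sumsetE)
      then obtain y where y: "y \<in> ?P" "v = psum y ?n" using im by blast
      have "a = psum (y(?n := u)) (Suc ?n)" unfolding psum_fun_upd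
        using uv y cl clU by (simp add: M.a_comm)
      then show "a \<in> (\<lambda>x. psum x (Suc ?n)) ` ?Q" using upd[OF y(1) uv(1)] by blast
    qed
    moreover have "\<forall>N\<in>set (Ns @ [U]). submodule N R M" using V U by (auto simp: direct_sum_def)
    ultimately show "direct_sum X (Ns @ [U])" by (simp add: direct_sum_def bij_betw_def)
  qed
  then show ?case using snoc.IH by simp
qed

lemma basic_decomposition_iff:
  "basic_decomposition R M Ns \<longleftrightarrow>
    dsum (carrier M) (rev Ns) \<and> (\<forall>N\<in>set (rev Ns). basic R (M\<lparr>carrier := N\<rparr>))"
  by (simp add: basic_decomposition_def is_direct_sum_iff direct_sum_iff_dsum)

end

context root_module
begin

theorem theta_reflexive_iff_multibasic: "theta_reflexive R M \<longleftrightarrow> multibasic R M"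
proof -
  have "multibasic R M \<longleftrightarrow> (\<exists>Us. dsum (carrier M) Us \<and> (\<forall>U\<in>set Us. basic R (M\<lparr>carrier := U\<rparr>)))"
    unfolding multibasic_def basic_decomposition_iff by (metis rev_rev_ident)
  then show ?thesis
    unfolding theta_reflexive_iff_linearly_compact
    using linearly_compact_imp_dsum dsum_basic_linearly_compact by blast
qed

text \<open>The exchange starts with the zero submodule as common complement, both remaining parts
  being M. The permutation is recovered from the multisets only afterwards.\<close>

theorem basic_decomposition_unique:
  assumes Ms: "basic_decomposition R M Ms" and Ns: "basic_decomposition R M Ns"
  shows "length Ms = length Ns \<and> (\<exists>\<sigma>. \<sigma> permutes {..<length Ms} \<and>
    (\<forall>i<length Ms. module_iso R (M\<lparr>carrier := Ms ! i\<rparr>) (M\<lparr>carrier := Ns ! \<sigma> i\<rparr>) \<noteq> {}))"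
proof -
  let ?iso = "\<lambda>U N. module_iso R (M\<lparr>carrier := U\<rparr>) (M\<lparr>carrier := N\<rparr>) \<noteq> {}"
  have d: "is_dsum (carrier M) {\<zero>\<^bsub>M\<^esub>} (carrier M)"
  proof -
    have "sumset {\<zero>\<^bsub>M\<^esub>} (carrier M) = carrier M"
      using sumset_right[OF zero_submodule carrier_is_submodule]
        submodule_carrier[OF sumset_submodule[OF zero_submodule carrier_is_submodule]] by blast
    then show ?thesis using zero_submodule carrier_is_submodule by (simp add: is_dsum_def)
  qed
  have "rel_mset ?iso (mset (rev Ms)) (mset (rev Ns))"
    by (rule basic_dsum_unique[OF _ _ d d]) (use Ms Ns basic_decomposition_iff in blast)+
  then have "rel_mset ?iso (mset Ms) (mset Ns)" by simp
  then obtain xs ys where xy: "mset xs = mset Ms" "mset ys = mset Ns" "list_all2 ?iso xs ys"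
    unfolding rel_mset_def by blast
  \<comment> \<open>Arranging the matched pairs in the order of \<open>Ms\<close> leaves a
    reordering \<open>zs\<close> of \<open>Ns\<close>, which comes from a permutation of
    positions.\<close>
  from list_all2_reorder_left_invariance[OF xy(3) xy(1)[symmetric]] obtain zs
    where zs: "list_all2 ?iso Ms zs" "mset zs = mset Ns" using xy(2) by auto
  obtain \<sigma> where \<sigma>: "\<sigma> permutes {..<length Ns}" "permute_list \<sigma> Ns = zs"
    using mset_eq_permutation[OF zs(2)] .
  have len: "length Ms = length Ns" using list_all2_lengthD[OF zs(1)] mset_eq_length[OF zs(2)] by simp
  moreover have "?iso (Ms ! i) (Ns ! \<sigma> i)" if "i < length Ms" for i
    using list_all2_nthD[OF zs(1) that] \<sigma> that len permute_list_nth[OF \<sigma>(1), of i] by simp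
  ultimately show ?thesis using \<sigma>(1) by auto
qed

end


theorem theorem4p1p11:
  fixes M :: "((real \<Rightarrow> bit) set, 'a, 'm) module_scheme"
  assumes "Module.module root_algebra M"
  shows "(theta_reflexive root_algebra M \<longleftrightarrow> multibasic root_algebra M) \<and>
    (theta_reflexive root_algebra M \<longrightarrow>
       (\<exists>Ms. basic_decomposition root_algebra M Ms) \<and>
       (\<forall>Ms Ns. basic_decomposition root_algebra M Ms \<and> basic_decomposition root_algebra M Ns \<longrightarrow>
          length Ms = length Ns \<and>
          (\<exists>\<sigma>. \<sigma> permutes {..<length Ms} \<and>
             (\<forall>i<length Ms.
                module_iso root_algebra (M\<lparr>carrier := Ms ! i\<rparr>) (M\<lparr>carrier := Ns ! \<sigma> i\<rparr>) \<noteq> {}))))"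
proof -
  interpret M: Module.module root_algebra M by (rule assms)
  \<comment> \<open>The ring axioms for P, on which \<open>root_ring_root_algebra\<close> depends,
    are part of the module assumption on M.\<close>
  interpret root_module root_algebra tpow M
    by (rule root_module.intro[OF assms root_ring_root_algebra[OF M.R.is_cring]])
  show ?thesis
    using theta_reflexive_iff_multibasic basic_decomposition_unique unfolding multibasic_def by blast
qed

end
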